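(* Let $V$ be a fine diffeological vector space, let $G$ be a group, and let $\varphi$ be a linear action of $G$ on $V$ (automatically, this action is pointwise smooth and $0$ is a fixed point). Let $\pi\colon V\to V/G$ be the projection to the orbit space. Then the induced map $$(T_0(V))_G\to T_{[0]}(V/G)$$ (induced by $T(\pi)\colon T_0(V)\to T_{[0]}(V/G)$) is an isomorphism. In particular, there is an isomorphism of diffeological vector spaces $$T_{[0]}(V/G)\cong V_G .$$
   Context: A Euclidean open set is an open subset of $\mathbb{R}^n$ for some $n\ge 0$. A parametrization of a set $X$ is a map $U\to X$ with $U$ a Euclidean open set. A diffeology on $X$ is a set of parametrizations, called plots, such that: every constant parametrization is a plot; a parametrization $U\to X$ that restricts to a plot on each member of some open cover of $U$ is a plot; if $p\colon U\to X$ is a plot and $f\colon V\to U$ is a $C^\infty$ map from a Euclidean open set, then $p\circ f$ is a plot. A diffeological space is a set with a diffeology. A map $f\colon X\to Y$ of diffeological spaces is smooth if $f\circ p$ is a plot of $Y$ for every plot $p$ of $X$. Euclidean open sets carry the diffeology of all $C^\infty$ parametrizations. Subsets carry the subdiffeology (parametrizations that are plots of the ambient space), products the product diffeology (all components are plots), and quotients $X/{\sim}$ the quotient diffeology: a parametrization is a plot iff locally it is $\pi\circ f$ with $f$ a plot of $X$. A diffeological vector space is a real vector space with a diffeology making addition and scalar multiplication smooth; a fine diffeological vector space is a real vector space with the fine diffeology, i.e. the smallest diffeology making it a diffeological vector space. Quotient vector spaces carry the quotient diffeology. Isomorphisms of diffeological vector spaces are linear bijections that are smooth with smooth inverse. For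 a linear action of a group $H$ on a diffeological vector space $W$, $W_H=W/\langle w-h\cdot w\mid w\in W,\ h\in H\rangle$. The orbit space $V/G$ is a diffeological space with the quotient diffeology (not a vector space in general). An action is pointwise smooth if each $\varphi_g\colon y\mapsto g\cdot y$ is smooth. $G$ acts on $T_0(V)$ by $g\mapsto T(\varphi_g)$. Internal tangent space of a diffeological space $X$ at $x\in X$: let $p$ range over plots $p\colon U_p\to X$ with $0\in U_p$ and $p(0)=x$. Then $T_x(X)=\bigoplus_p T_0(U_p)/R$, where $R$ is spanned by all $v-w$ with $v\in T_0(U_p)$, $w\in T_0(U_q)$ such that $p=q\circ f$ for some smooth $f\colon U_p\to U_q$ with $f(0)=0$ and $df_0(v)=w$. The class of $v\in T_0(U_p)$ is written $[p,v]$. A smooth map $f\colon X\to Y$ induces $T(f)\colon T_x(X)\to T_{f(x)}(Y)$, $[p,v]\mapsto[f\circ p,v]$. Diffeology on $T_x(X)$: on $TX=\coprod_{x\in X}T_x(X)$ consider the diffeology generated by the maps $TU\to TX$ induced by plots $p\colon U\to X$ (sending $v\in T_uU$ to $[p(\cdot+u),v]\in T_{p(u)}(X)$); $TX$ is given the smallest diffeology containing it and making $TX\to X$ a diffeological vector space over $X$, i.e. making the projection, fibrewise addition $TX\times_X TX\to TX$, scalar multiplication $\mathbb{R}\times TX\to TX$ and the zero section $X\to TX$ smooth. $T_x(X)$ carries the subdiffeology of $TX$; it is then a diffeological vector space. *)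

theory Defs
  imports "HOL-Analysis.Analysis" "HOL-Algebra.Module" "HOL-Algebra.AbelCoset"
    "HOL-Algebra.Group_Action"
begin

section \<open>Euclidean open sets and smooth maps\<close>

text \<open>
  The space \<open>\<real>\<^sup>n\<close> is the carrier of the library's \<open>Euclidean_space n\<close>: sequences vanishing from
  index \<open>n\<close> on. Its tangent spaces are identified with \<open>\<real>\<^sup>n\<close> itself.
\<close>

abbreviation eopen :: "nat \<Rightarrow> (nat \<Rightarrow> real) set \<Rightarrow> bool" where
  "eopen n U \<equiv> openin (Euclidean_space n) U"

abbreviation origin :: "nat \<Rightarrow> real" where
  "origin \<equiv> \<lambda>_. 0"

definition partial :: "nat \<Rightarrow> ((nat \<Rightarrow> real) \<Rightarrow> real) \<Rightarrow> (nat \<Rightarrow> real) \<Rightarrow> real" where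
  "partial i g x = deriv (\<lambda>t. g (x(i := t))) (x i)"

text \<open>Coinduction: all iterated partial derivatives exist on \<open>U\<close> and are continuous there.\<close>

coinductive C_infinity :: "nat \<Rightarrow> (nat \<Rightarrow> real) set \<Rightarrow> ((nat \<Rightarrow> real) \<Rightarrow> real) \<Rightarrow> bool"
  for n :: nat and U :: "(nat \<Rightarrow> real) set" where
  "\<lbrakk> continuous_on U g;
     \<And>i x. i < n \<Longrightarrow> x \<in> U \<Longrightarrow> (\<lambda>t. g (x(i := t))) differentiable (at (x i));
     \<And>i. i < n \<Longrightarrow> C_infinity n U (partial i g) \<rbrakk> \<Longrightarrow> C_infinity n U g"

definition smooth_map ::
    "nat \<Rightarrow> (nat \<Rightarrow> real) set \<Rightarrow> (nat \<Rightarrow> real) set \<Rightarrow> ((nat \<Rightarrow> real) \<Rightarrow> (nat \<Rightarrow> real)) \<Rightarrow> bool" where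
  "smooth_map n U V f \<longleftrightarrow> f \<in> U \<rightarrow> V \<and> (\<forall>j. C_infinity n U (\<lambda>x. f x j))"

definition differential ::
    "nat \<Rightarrow> ((nat \<Rightarrow> real) \<Rightarrow> (nat \<Rightarrow> real)) \<Rightarrow> (nat \<Rightarrow> real) \<Rightarrow> (nat \<Rightarrow> real) \<Rightarrow> (nat \<Rightarrow> real)" where
  "differential n f x v = (\<lambda>j. \<Sum>i<n. partial i (\<lambda>y. f y j) x * v i)"


section \<open>Diffeologies\<close>

text \<open>
  A parametrization \<open>U \<rightarrow> X\<close> with \<open>U \<subseteq> \<real>\<^sup>n\<close> is a triple \<open>(n, U, p)\<close> where \<open>p\<close> takes the value
  \<open>undefined\<close> outside \<open>U\<close>, so that equality of triples is equality of maps.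
\<close>

type_synonym 'a param = "nat \<times> (nat \<Rightarrow> real) set \<times> ((nat \<Rightarrow> real) \<Rightarrow> 'a)"

definition params :: "'a set \<Rightarrow> 'a param set" where
  "params X = {(n, U, p). eopen n U \<and> p \<in> U \<rightarrow>\<^sub>E X}"

definition open_cover :: "nat \<Rightarrow> (nat \<Rightarrow> real) set set \<Rightarrow> (nat \<Rightarrow> real) set \<Rightarrow> bool" where
  "open_cover n \<W> U \<longleftrightarrow> (\<forall>W\<in>\<W>. eopen n W) \<and> \<Union>\<W> = U"

locale diffeology =
  fixes X :: "'a set" and D :: "'a param set"
  assumes plots_params: "D \<subseteq> params X"
    and plot_const: "\<lbrakk> eopen n U; x \<in> X \<rbrakk> \<Longrightarrow> (n, U, \<lambda>u\<in>U. x) \<in> D"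
    and plot_local: "\<lbrakk> (n, U, p) \<in> params X; open_cover n \<W> U;
        \<And>W. W \<in> \<W> \<Longrightarrow> (n, W, restrict p W) \<in> D \<rbrakk> \<Longrightarrow> (n, U, p) \<in> D"
    and plot_compose: "\<lbrakk> (n, U, p) \<in> D; eopen m V; smooth_map m V U f \<rbrakk>
        \<Longrightarrow> (m, V, compose V p f) \<in> D"

definition dsmooth :: "'a set \<Rightarrow> 'a param set \<Rightarrow> 'b set \<Rightarrow> 'b param set \<Rightarrow> ('a \<Rightarrow> 'b) \<Rightarrow> bool" where
  "dsmooth X D Y E f \<longleftrightarrow> f \<in> X \<rightarrow> Y \<and> (\<forall>(n, U, p)\<in>D. (n, U, compose U f p) \<in> E)"

definition real_diff :: "real param set" where
  "real_diff = {(n, U, p) \<in> params UNIV. C_infinity n U p}"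

definition sub_diff :: "'a param set \<Rightarrow> 'a set \<Rightarrow> 'a param set" where
  "sub_diff D A = D \<inter> params A"

definition prod_diff :: "'a param set \<Rightarrow> 'b param set \<Rightarrow> ('a \<times> 'b) param set" where
  "prod_diff D E = {(n, U, p). p \<in> extensional U \<and>
     (n, U, compose U fst p) \<in> D \<and> (n, U, compose U snd p) \<in> E}"

text \<open>The quotient diffeology on \<open>Q\<close> along a surjection \<open>\<pi> : X \<rightarrow> Q\<close>, for \<open>D\<close> a diffeology on \<open>X\<close>.\<close>

definition quot_diff :: "'a param set \<Rightarrow> 'b set \<Rightarrow> ('a \<Rightarrow> 'b) \<Rightarrow> 'b param set" where
  "quot_diff D Q \<pi> = {(n, U, q) \<in> params Q. \<exists>\<W>. open_cover n \<W> U \<and>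
     (\<forall>W\<in>\<W>. \<exists>f. (n, W, f) \<in> D \<and> restrict q W = compose W \<pi> f)}"

definition gen_diff :: "'a set \<Rightarrow> 'a param set \<Rightarrow> 'a param set" where
  "gen_diff X S = \<Inter>{D. diffeology X D \<and> S \<subseteq> D}"


section \<open>Real vector spaces\<close>

text \<open>
  Real vector spaces are modules over the field of reals. The record of modules extends that of
  rings, so the vector spaces built below leave the multiplicative fields undefined.
\<close>

definition real_ring :: "real ring" where
  "real_ring = \<lparr>carrier = UNIV, mult = (*), one = 1, zero = 0, add = (+)\<rparr>"

type_synonym 'a vsp = "(real, 'a) module"

abbreviation is_vsp :: "'a vsp \<Rightarrow> bool" where
  "is_vsp V \<equiv> Module.module real_ring V"

definition linear_map :: "'a vsp \<Rightarrow> 'b vsp \<Rightarrow> ('a \<Rightarrow> 'b) \<Rightarrow> bool" where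
  "linear_map V W f \<longleftrightarrow> f \<in> carrier V \<rightarrow> carrier W \<and>
     (\<forall>x\<in>carrier V. \<forall>y\<in>carrier V. f (x \<oplus>\<^bsub>V\<^esub> y) = f x \<oplus>\<^bsub>W\<^esub> f y) \<and>
     (\<forall>a. \<forall>x\<in>carrier V. f (a \<odot>\<^bsub>V\<^esub> x) = a \<odot>\<^bsub>W\<^esub> f x)"

definition vspan :: "'a vsp \<Rightarrow> 'a set \<Rightarrow> 'a set" where
  "vspan V S = (\<lambda>H. submodule H real_ring V) hull S"

text \<open>In the scalar multiplication, the image of a coset under \<open>x \<mapsto> W + a x\<close> is a singleton.\<close>

definition quot_vsp :: "'a vsp \<Rightarrow> 'a set \<Rightarrow> 'a set vsp" where
  "quot_vsp V W = \<lparr>carrier = a_rcosets\<^bsub>V\<^esub> W, mult = undefined, one = undefined,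
     zero = W, add = set_add V,
     smult = (\<lambda>a A. the_elem ((\<lambda>x. W +>\<^bsub>V\<^esub> (a \<odot>\<^bsub>V\<^esub> x)) ` A))\<rparr>"


section \<open>Diffeological vector spaces\<close>

definition dvs :: "'a vsp \<Rightarrow> 'a param set \<Rightarrow> bool" where
  "dvs V D \<longleftrightarrow> is_vsp V \<and> diffeology (carrier V) D \<and>
     dsmooth (carrier V \<times> carrier V) (prod_diff D D) (carrier V) D (\<lambda>(x, y). x \<oplus>\<^bsub>V\<^esub> y) \<and>
     dsmooth (UNIV \<times> carrier V) (prod_diff real_diff D) (carrier V) D (\<lambda>(a, x). a \<odot>\<^bsub>V\<^esub> x)"

definition fine_dvs :: "'a vsp \<Rightarrow> 'a param set \<Rightarrow> bool" where
  "fine_dvs V D \<longleftrightarrow> dvs V D \<and> (\<forall>E. dvs V E \<longrightarrow> D \<subseteq> E)"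

definition dvs_iso ::
    "'a vsp \<Rightarrow> 'a param set \<Rightarrow> 'b vsp \<Rightarrow> 'b param set \<Rightarrow> ('a \<Rightarrow> 'b) \<Rightarrow> bool" where
  "dvs_iso V D W E h \<longleftrightarrow> linear_map V W h \<and> bij_betw h (carrier V) (carrier W) \<and>
     dsmooth (carrier V) D (carrier W) E h \<and>
     dsmooth (carrier W) E (carrier V) D (inv_into (carrier V) h)"

definition quot_vsp_diff :: "'a vsp \<Rightarrow> 'a param set \<Rightarrow> 'a set \<Rightarrow> 'a set param set" where
  "quot_vsp_diff V D W = quot_diff D (carrier (quot_vsp V W)) (\<lambda>x. W +>\<^bsub>V\<^esub> x)"


section \<open>Linear actions and coinvariants\<close>

definition linear_action :: "('g, 'm) monoid_scheme \<Rightarrow> 'a vsp \<Rightarrow> ('g \<Rightarrow> 'a \<Rightarrow> 'a) \<Rightarrow> bool" where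
  "linear_action G V \<phi> \<longleftrightarrow> group_action G (carrier V) \<phi> \<and>
     (\<forall>g\<in>carrier G. linear_map V V (\<phi> g))"

definition coinv_sub :: "('g, 'm) monoid_scheme \<Rightarrow> 'a vsp \<Rightarrow> ('g \<Rightarrow> 'a \<Rightarrow> 'a) \<Rightarrow> 'a set" where
  "coinv_sub G W \<rho> = vspan W {w \<ominus>\<^bsub>W\<^esub> \<rho> h w | w h. w \<in> carrier W \<and> h \<in> carrier G}"

definition coinv :: "('g, 'm) monoid_scheme \<Rightarrow> 'a vsp \<Rightarrow> ('g \<Rightarrow> 'a \<Rightarrow> 'a) \<Rightarrow> 'a set vsp" where
  "coinv G W \<rho> = quot_vsp W (coinv_sub G W \<rho>)"

definition coinv_diff ::
    "('g, 'm) monoid_scheme \<Rightarrow> 'a vsp \<Rightarrow> 'a param set \<Rightarrow> ('g \<Rightarrow> 'a \<Rightarrow> 'a) \<Rightarrow> 'a set param set" where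
  "coinv_diff G W D \<rho> = quot_vsp_diff W D (coinv_sub G W \<rho>)"

definition orbit_diff ::
    "('g, 'm) monoid_scheme \<Rightarrow> 'a set \<Rightarrow> 'a param set \<Rightarrow> ('g \<Rightarrow> 'a \<Rightarrow> 'a) \<Rightarrow> 'a set param set" where
  "orbit_diff G X D \<phi> = quot_diff D (orbits G X \<phi>) (orbit G \<phi>)"


section \<open>Internal tangent spaces\<close>

definition plots_at :: "'a param set \<Rightarrow> 'a \<Rightarrow> 'a param set" where
  "plots_at D x = {(n, U, p) \<in> D. origin \<in> U \<and> p origin = x}"

text \<open>The direct sum of the spaces \<open>T\<^sub>0(U\<^sub>p) = \<real>\<^sup>n\<close> over all plots \<open>p : U\<^sub>p \<rightarrow> X\<close> centred at \<open>x\<close>.\<close>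

definition tan_sum :: "'a param set \<Rightarrow> 'a \<Rightarrow> ('a param \<Rightarrow> nat \<Rightarrow> real) vsp" where
  "tan_sum D x = \<lparr>
     carrier = {s. finite {P. s P \<noteq> origin} \<and> (\<forall>P. P \<notin> plots_at D x \<longrightarrow> s P = origin) \<and>
                   (\<forall>P. s P \<in> topspace (Euclidean_space (fst P)))},
     mult = undefined, one = undefined,
     zero = (\<lambda>P i. 0), add = (\<lambda>s t P i. s P i + t P i),
     smult = (\<lambda>a s P i. a * s P i)\<rparr>"

definition tan_single :: "'a param \<Rightarrow> (nat \<Rightarrow> real) \<Rightarrow> 'a param \<Rightarrow> nat \<Rightarrow> real" where
  "tan_single P v = (\<lambda>Q. if Q = P then v else origin)"

definition tan_rel :: "'a param set \<Rightarrow> 'a \<Rightarrow> ('a param \<Rightarrow> nat \<Rightarrow> real) set" where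
  "tan_rel D x = vspan (tan_sum D x)
     {tan_single (n, U, p) v \<ominus>\<^bsub>tan_sum D x\<^esub> tan_single (m, V, q) w | n U p v m V q w.
        (n, U, p) \<in> plots_at D x \<and> (m, V, q) \<in> plots_at D x \<and>
        v \<in> topspace (Euclidean_space n) \<and> w \<in> topspace (Euclidean_space m) \<and>
        (\<exists>f. smooth_map n U V f \<and> f origin = origin \<and> p = compose U q f \<and>
             differential n f origin v = w)}"

type_synonym 'a tvec = "('a param \<Rightarrow> nat \<Rightarrow> real) set"

definition tan_space :: "'a param set \<Rightarrow> 'a \<Rightarrow> 'a tvec vsp" where
  "tan_space D x = quot_vsp (tan_sum D x) (tan_rel D x)"

definition tan_class :: "'a param set \<Rightarrow> 'a \<Rightarrow> 'a param \<Rightarrow> (nat \<Rightarrow> real) \<Rightarrow> 'a tvec" where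
  "tan_class D x P v = tan_rel D x +>\<^bsub>tan_sum D x\<^esub> tan_single P v"

text \<open>
  \<open>tan_push f\<close> is the linear extension of \<open>v \<in> T\<^sub>0(U\<^sub>p) \<mapsto> v \<in> T\<^sub>0(U\<^sub>f\<^sub>\<circ>\<^sub>p)\<close> to the direct sums; distinct
  plots \<open>p\<close> may have the same composite with \<open>f\<close>. \<open>tan_map D E f x\<close> is the map it induces on
  \<open>T\<^sub>x(X) \<rightarrow> T\<^sub>f\<^sub>x(Y)\<close>, i.e. \<open>[p, v] \<mapsto> [f \<circ> p, v]\<close>, where \<open>D\<close> and \<open>E\<close> are the diffeologies of \<open>X\<close> and \<open>Y\<close>.
\<close>

definition param_map :: "('a \<Rightarrow> 'b) \<Rightarrow> 'a param \<Rightarrow> 'b param" where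
  "param_map f = (\<lambda>(n, U, p). (n, U, compose U f p))"

definition tan_push :: "('a \<Rightarrow> 'b) \<Rightarrow> ('a param \<Rightarrow> nat \<Rightarrow> real) \<Rightarrow> 'b param \<Rightarrow> nat \<Rightarrow> real" where
  "tan_push f s = (\<lambda>Q i. \<Sum>P \<in> {P. s P \<noteq> origin \<and> param_map f P = Q}. s P i)"

definition tan_map ::
    "'a param set \<Rightarrow> 'b param set \<Rightarrow> ('a \<Rightarrow> 'b) \<Rightarrow> 'a \<Rightarrow> 'a tvec \<Rightarrow> 'b tvec" where
  "tan_map D E f x \<xi> =
     the_elem ((\<lambda>s. tan_rel E (f x) +>\<^bsub>tan_sum E (f x)\<^esub> tan_push f s) ` \<xi>)"


section \<open>The tangent bundle and the diffeology of tangent spaces\<close>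

definition dvs_over :: "'a set \<Rightarrow> 'a param set \<Rightarrow> ('a \<Rightarrow> 'b vsp) \<Rightarrow> ('a \<times> 'b) param set \<Rightarrow> bool" where
  "dvs_over X D F E \<longleftrightarrow>
    (let T = (SIGMA x:X. carrier (F x)); T2 = {(a, b) \<in> T \<times> T. fst a = fst b} in
     (\<forall>x\<in>X. is_vsp (F x)) \<and> diffeology T E \<and>
     dsmooth T E X D fst \<and>
     dsmooth T2 (sub_diff (prod_diff E E) T2) T E
       (\<lambda>((x, \<xi>), (_, \<eta>)). (x, \<xi> \<oplus>\<^bsub>F x\<^esub> \<eta>)) \<and>
     dsmooth (UNIV \<times> T) (prod_diff real_diff E) T E (\<lambda>(a, (x, \<xi>)). (x, a \<odot>\<^bsub>F x\<^esub> \<xi>)) \<and>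
     dsmooth X D T E (\<lambda>x. (x, \<zero>\<^bsub>F x\<^esub>)))"

definition tan_bundle :: "'a set \<Rightarrow> 'a param set \<Rightarrow> ('a \<times> 'a tvec) set" where
  "tan_bundle X D = (SIGMA x:X. carrier (tan_space D x))"

definition translate_plot :: "(nat \<Rightarrow> real) \<Rightarrow> 'a param \<Rightarrow> 'a param" where
  "translate_plot u = (\<lambda>(n, U, p).
     let U' = {y \<in> topspace (Euclidean_space n). (\<lambda>i. y i + u i) \<in> U}
     in (n, U', \<lambda>y\<in>U'. p (\<lambda>i. y i + u i)))"

text \<open>
  For \<open>U \<subseteq> \<real>\<^sup>n\<close>, a point \<open>(u, v)\<close> of \<open>TU = U \<times> \<real>\<^sup>n \<subseteq> \<real>\<^sup>2\<^sup>n\<close> is the sequence \<open>z\<close> with first \<open>n\<close>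
  coordinates \<open>u\<close> and next \<open>n\<close> coordinates \<open>v\<close>.
\<close>

definition base_part :: "nat \<Rightarrow> (nat \<Rightarrow> real) \<Rightarrow> nat \<Rightarrow> real" where
  "base_part n z = (\<lambda>i. if i < n then z i else 0)"

definition vec_part :: "nat \<Rightarrow> (nat \<Rightarrow> real) \<Rightarrow> nat \<Rightarrow> real" where
  "vec_part n z = (\<lambda>i. z (n + i))"

definition tan_plot :: "'a param set \<Rightarrow> 'a param \<Rightarrow> ('a \<times> 'a tvec) param" where
  "tan_plot D = (\<lambda>(n, U, p).
     let TU = {z \<in> topspace (Euclidean_space (2 * n)). base_part n z \<in> U}
     in (2 * n, TU, \<lambda>z\<in>TU. let u = base_part n z
           in (p u, tan_class D (p u) (translate_plot u (n, U, p)) (vec_part n z))))"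

definition tan_bundle_diff :: "'a set \<Rightarrow> 'a param set \<Rightarrow> ('a \<times> 'a tvec) param set" where
  "tan_bundle_diff X D = \<Inter>{E. dvs_over X D (tan_space D) E \<and>
     gen_diff (tan_bundle X D) (tan_plot D ` D) \<subseteq> E}"

text \<open>The subdiffeology of the tangent bundle on the fibre \<open>{x} \<times> T\<^sub>x(X)\<close>, read on \<open>T\<^sub>x(X)\<close>.\<close>

definition tan_diff :: "'a set \<Rightarrow> 'a param set \<Rightarrow> 'a \<Rightarrow> 'a tvec param set" where
  "tan_diff X D x = {P \<in> params (carrier (tan_space D x)).
     param_map (Pair x) P \<in> sub_diff (tan_bundle_diff X D) ({x} \<times> carrier (tan_space D x))}"

end

theory Submission
  imports Defs
begin

text \<open>
  Plots of a fine vector space are locally finite combinations \<open>\<Sum> f\<^sub>i(u) v\<^sub>i\<close> with smooth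
  coefficients, so they have well-defined derivatives. The map \<open>c : V/G \<rightarrow> V\<^sub>G\<close> sending an orbit to its
  class is smooth into a fine space; differentiating along it gives a smooth linear map
  \<open>T\<^sub>0(V/G) \<rightarrow> V\<^sub>G\<close>, \<open>[p, v] \<mapsto> d(c \<circ> p)\<^sub>0(v)\<close>. In the other direction, \<open>v \<mapsto> [t \<mapsto> \<pi>(t v), 1]\<close> is a
  linear map \<open>V \<rightarrow> T\<^sub>0(V/G)\<close>, smooth because \<open>V\<close> is fine, constant on orbits, and onto because
  every plot centred at \<open>[0]\<close> lifts locally to a plot of \<open>V\<close> centred at \<open>0\<close> (the only point of its
  orbit). The two maps induce mutually inverse isomorphisms. The same argument with \<open>G\<close> trivial gives
  \<open>T\<^sub>0(V) \<cong> V\<close>, equivariantly.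
\<close>

section \<open>Calculus on Euclidean open sets\<close>

text \<open>Two obstacles shape the proof. The first is that a plot of a fine space has many
  presentations as a local combination, with vectors that may be dependent, and no basis is chosen.
  Independence of the derivative from the presentation is proved by an elimination on lists of
  coefficient functions of one real variable. The second is that the diffeology of the tangent
  bundle is an intersection, so its plots have no explicit description. Smoothness of the derivative
  on tangent spaces is shown by a competitor: one vector space diffeology over the base that
  contains the generating plots and makes the derivative smooth. The intersection lies inside it.
  The competitor also shows that the intersected family is nonempty. The group enters late. The
  isomorphism is proved for an abstract surjection \<open>\<pi>\<close> from a fine space whose
  fibre over \<open>\<pi> 0\<close> is trivial, with a linear surjection \<open>r\<close> that
  factors through \<open>\<pi>\<close>. What remains for the action is that the kernel of
  \<open>r\<close> maps to zero in the tangent space, and the comparison of the two spaces of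
  coinvariants.\<close>

abbreviation Euc :: "nat \<Rightarrow> (nat \<Rightarrow> real) set" where
  "Euc n \<equiv> topspace (Euclidean_space n)"

lemma topspace_Euc [simp]: "x \<in> Euc n \<longleftrightarrow> (\<forall>i\<ge>n. x i = 0)"
  by (simp add: topspace_Euclidean_space)

lemma eopen_iff: "eopen n U \<longleftrightarrow> (\<exists>T. open T \<and> U = T \<inter> Euc n)"
  by (auto simp: Euclidean_space_def openin_subtopology euclidean_product_topology)

lemma eopen_support: "eopen n U \<Longrightarrow> x \<in> U \<Longrightarrow> i \<ge> n \<Longrightarrow> x i = 0"
  using openin_subset by fastforce

lemma eopen_space [simp]: "eopen n (Euc n)"
  by blast

lemma tendsto_fun_iff:
  fixes f :: "'a \<Rightarrow> nat \<Rightarrow> real"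
  shows "(f \<longlongrightarrow> l) F \<longleftrightarrow> (\<forall>i. ((\<lambda>x. f x i) \<longlongrightarrow> l i) F)"
  using limitin_componentwise[of "\<lambda>_. euclidean" UNIV f l F]
  by (simp add: euclidean_product_topology)

lemma eopen_preimage:
  assumes "eopen n U" "eopen m V" "continuous_on U f" "f \<in> U \<rightarrow> Euc m"
  shows "eopen n {x \<in> U. f x \<in> V}"
proof -
  obtain S where S: "open S" "U = S \<inter> Euc n"
    using assms(1)[unfolded eopen_iff] by metis
  obtain T where T: "open T" "V = T \<inter> Euc m"
    using assms(2)[unfolded eopen_iff] by metis
  obtain A where A: "open A" "A \<inter> U = f -` T \<inter> U"
    using assms(3)[unfolded continuous_on_open_invariant] T(1) by metis
  have "f x \<in> Euc m" if "x \<in> U" for x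
    using assms(4) that by blast
  then have "{x \<in> U. f x \<in> V} = (A \<inter> U)"
    using A(2) T(2) by blast
  then have "{x \<in> U. f x \<in> V} = (A \<inter> S) \<inter> Euc n"
    using S(2) by blast
  then show ?thesis
    unfolding eopen_iff using A(1) S(1) by blast
qed

lemma eopen_box:
  assumes "eopen n U" "x \<in> U"
  obtains e where "e > 0" "\<And>y. (\<forall>i<n. \<bar>y i - x i\<bar> < e) \<Longrightarrow> (\<forall>i\<ge>n. y i = 0) \<Longrightarrow> y \<in> U"
proof -
  obtain T where T: "open T" "U = T \<inter> Euc n"
    using assms(1) by (auto simp: eopen_iff)
  obtain X where X: "x \<in> Pi\<^sub>E UNIV X" "\<And>i. open (X i)" "Pi\<^sub>E UNIV X \<subseteq> T"
    using product_topology_open_contains_basis[of "\<lambda>_. euclidean" UNIV T x] T assms(2)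
    by (auto simp: euclidean_product_topology)
  have "\<exists>d>0. ball (x i) d \<subseteq> X i" for i
    using X(1,2) open_contains_ball by (metis PiE_mem UNIV_I)
  then obtain d where d: "\<And>i. d i > 0" "\<And>i. ball (x i) (d i) \<subseteq> X i" by metis
  \<comment> \<open>The entry \<open>1\<close> keeps the minimum defined for \<open>n = 0\<close>.
    Coordinates from \<open>n\<close> on impose no bound, since both points vanish there.\<close>
  define e where "e = Min (insert 1 (d ` {..<n}))"
  have e: "e > 0" "\<And>i. i < n \<Longrightarrow> e \<le> d i"
    using d(1) by (auto simp: e_def)
  show ?thesis
  proof (rule that[OF e(1)])
    fix y assume y: "\<forall>i<n. \<bar>y i - x i\<bar> < e" "\<forall>i\<ge>n. y i = 0"
    have "y i \<in> X i" for i
    proof (cases "i < n")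
      case True
      then have "y i \<in> ball (x i) (d i)"
        using y(1) e(2)[OF True] by (force simp: dist_real_def)
      then show ?thesis using d(2) by blast
    next
      case False
      then have "y i = x i"
        using y(2) eopen_support[OF assms] by simp
      then show ?thesis using X(1) by auto
    qed
    then show "y \<in> U"
      using X(3) T(2) y(2) by auto
  qed
qed

lemma eventually_update_in:
  assumes "eopen n U" "x \<in> U" "i < n"
  shows "\<forall>\<^sub>F t in nhds (x i). x(i := t) \<in> U"
proof -
  obtain e where e: "e > 0" "\<And>y. (\<forall>i<n. \<bar>y i - x i\<bar> < e) \<Longrightarrow> (\<forall>i\<ge>n. y i = 0) \<Longrightarrow> y \<in> U"
    using eopen_box[OF assms(1,2)] by metis
  show ?thesis
    unfolding eventually_nhds_metric
    using e assms(3) eopen_support[OF assms(1,2)] by (force simp: dist_real_def)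
qed

text \<open>Partial derivatives of products and composites are sums of terms of mixed shape, which
  direct coinduction on \<open>C_infinity\<close> handles badly. With a finite order the closure
  properties become ordinary inductions.\<close>

primrec Ck :: "nat \<Rightarrow> nat \<Rightarrow> (nat \<Rightarrow> real) set \<Rightarrow> ((nat \<Rightarrow> real) \<Rightarrow> real) \<Rightarrow> bool" where
  "Ck 0 n U g \<longleftrightarrow> continuous_on U g"
| "Ck (Suc k) n U g \<longleftrightarrow> continuous_on U g \<and>
     (\<forall>i<n. \<forall>x\<in>U. (\<lambda>t. g (x(i := t))) differentiable (at (x i))) \<and>
     (\<forall>i<n. Ck k n U (partial i g))"

lemma C_infinity_iff_Ck: "C_infinity n U g \<longleftrightarrow> (\<forall>k. Ck k n U g)"
proof
  assume "C_infinity n U g"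
  moreover have "C_infinity n U g \<Longrightarrow> Ck k n U g" for k
  proof (induction k arbitrary: g)
    case 0
    then show ?case by (auto elim: C_infinity.cases)
  next
    case (Suc k)
    from Suc.prems show ?case by (cases rule: C_infinity.cases) (auto intro: Suc.IH)
  qed
  ultimately show "\<forall>k. Ck k n U g" by blast
next
  assume "\<forall>k. Ck k n U g"
  then show "C_infinity n U g"
  proof (coinduction arbitrary: g)
    case C_infinity
    then have "Ck (Suc k) n U g" for k by blast
    then show ?case by auto
  qed
qed

lemma Ck_antimono: "Ck (Suc k) n U g \<Longrightarrow> Ck k n U g"
  by (induction k arbitrary: g) auto

lemma Ck_continuous: "Ck k n U g \<Longrightarrow> continuous_on U g"
  by (cases k) auto

lemma C_infinity_continuous: "C_infinity n U g \<Longrightarrow> continuous_on U g"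
  using C_infinity.cases by blast

lemma C_infinity_partial: "C_infinity n U g \<Longrightarrow> i < n \<Longrightarrow> C_infinity n U (partial i g)"
  using C_infinity.cases by blast

lemma DERIV_partial:
  assumes "(\<lambda>t. g (x(i := t))) differentiable (at (x i))"
  shows "((\<lambda>t. g (x(i := t))) has_real_derivative partial i g x) (at (x i))"
  using assms by (simp add: partial_def DERIV_deriv_iff_real_differentiable)

lemma partial_eqI:
  "((\<lambda>t. g (x(i := t))) has_real_derivative d) (at (x i)) \<Longrightarrow> partial i g x = d"
  by (simp add: partial_def DERIV_imp_deriv)

lemma partial_cong:
  assumes "eopen n U" "x \<in> U" "i < n" "\<And>y. y \<in> U \<Longrightarrow> f y = g y"
  shows "partial i f x = partial i g x"
  unfolding partial_def
  by (rule deriv_cong_ev[OF eventually_mono[OF eventually_update_in[OF assms(1-3)]]])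
     (use assms(4) in auto)

text \<open>Openness of \<open>U\<close> is the point: \<open>partial\<close> sees only values on a
  short coordinate segment around a point, and this segment stays in \<open>U\<close>. It allows a
  function to be exchanged for its restriction, the form in which plots are stored.\<close>

lemma Ck_cong:
  assumes "eopen n U" "\<And>y. y \<in> U \<Longrightarrow> f y = g y"
  shows "Ck k n U f \<longleftrightarrow> Ck k n U g"
  using assms(2)
proof (induction k arbitrary: f g)
  case 0
  then show ?case by (simp cong: continuous_on_cong)
next
  case (Suc k)
  have "continuous_on U f \<longleftrightarrow> continuous_on U g"
    using Suc.prems by (simp cong: continuous_on_cong)
  moreover have "(\<lambda>t. f (x(i := t))) differentiable (at (x i)) \<longleftrightarrow>
      (\<lambda>t. g (x(i := t))) differentiable (at (x i))" if "i < n" "x \<in> U" for i x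
  proof -
    have "\<forall>\<^sub>F t in nhds (x i). f (x(i := t)) = g (x(i := t))"
      by (rule eventually_mono[OF eventually_update_in[OF assms(1) that(2,1)]]) (rule Suc.prems)
    then show ?thesis
      unfolding real_differentiable_def using DERIV_cong_ev[OF refl _ refl] by metis
  qed
  moreover have "Ck k n U (partial i f) \<longleftrightarrow> Ck k n U (partial i g)" if "i < n" for i
    using Suc.IH partial_cong[OF assms(1) _ that] Suc.prems by metis
  ultimately show ?case by (simp cong: conj_cong)
qed

lemma C_infinity_cong:
  assumes "eopen n U" "\<And>y. y \<in> U \<Longrightarrow> f y = g y"
  shows "C_infinity n U f \<longleftrightarrow> C_infinity n U g"
  unfolding C_infinity_iff_Ck using Ck_cong[OF assms(1), of f g] assms(2) by blast

lemma Ck_subset: "Ck k n U g \<Longrightarrow> W \<subseteq> U \<Longrightarrow> Ck k n W g"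
  by (induction k arbitrary: g) (auto intro: continuous_on_subset)

lemma C_infinity_subset: "C_infinity n U g \<Longrightarrow> W \<subseteq> U \<Longrightarrow> C_infinity n W g"
  unfolding C_infinity_iff_Ck using Ck_subset by blast

lemma Ck_const: "Ck k n U (\<lambda>_. a)"
proof (induction k arbitrary: a)
  case (Suc k)
  have "partial i (\<lambda>_. a) = (\<lambda>_. 0)" for i by (auto simp: partial_def)
  then show ?case using Suc by auto
qed auto

lemma Ck_coord: "Ck k n U (\<lambda>x. x j)"
proof (cases k)
  case (Suc l)
  have D: "((\<lambda>t. (x(i := t)) j) has_real_derivative of_bool (i = j)) (at (x i))"
    for x :: "nat \<Rightarrow> real" and i
    by (cases "i = j") auto
  then have "partial i (\<lambda>x. x j) = (\<lambda>_. of_bool (i = j))" for i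
    using partial_eqI[of "\<lambda>x. x j"] by fast
  moreover have "(\<lambda>t. (x(i := t)) j) differentiable (at (x i))"
    for x :: "nat \<Rightarrow> real" and i
    using D real_differentiable_def by blast
  ultimately show ?thesis
    using Suc Ck_const by (auto simp: continuous_on_subset[OF continuous_on_product_coordinates])
qed (auto simp: continuous_on_subset[OF continuous_on_product_coordinates])

lemma Ck_add:
  assumes "eopen n U"
  shows "Ck k n U f \<Longrightarrow> Ck k n U g \<Longrightarrow> Ck k n U (\<lambda>x. f x + g x)"
proof (induction k arbitrary: f g)
  case 0
  then show ?case by (auto intro: continuous_intros)
next
  case (Suc k)
  have D: "((\<lambda>t. f (x(i := t)) + g (x(i := t))) has_real_derivative
      (partial i f x + partial i g x)) (at (x i))" if "i < n" "x \<in> U" for i x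
    using Suc.prems that by (intro DERIV_add DERIV_partial) auto
  have "Ck k n U (partial i (\<lambda>x. f x + g x))" if "i < n" for i
    using Suc that
    by (subst Ck_cong[OF assms, where g = "\<lambda>x. partial i f x + partial i g x"])
       (auto intro!: partial_eqI D)
  then show ?case
    using Suc.prems D by (auto intro!: continuous_intros simp: real_differentiable_def)
qed

lemma Ck_mult:
  assumes "eopen n U"
  shows "Ck k n U f \<Longrightarrow> Ck k n U g \<Longrightarrow> Ck k n U (\<lambda>x. f x * g x)"
proof (induction k arbitrary: f g)
  case 0
  then show ?case by (auto intro: continuous_intros)
next
  case (Suc k)
  have D: "((\<lambda>t. f (x(i := t)) * g (x(i := t))) has_real_derivative
      (partial i f x * g x + partial i g x * f x)) (at (x i))" if "i < n" "x \<in> U" for i x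
    using DERIV_mult[OF DERIV_partial[of f x i] DERIV_partial[of g x i]] Suc.prems that by simp
  have "Ck k n U (partial i (\<lambda>x. f x * g x))" if "i < n" for i
    using Suc that Ck_antimono[OF Suc.prems(1)] Ck_antimono[OF Suc.prems(2)]
    by (subst Ck_cong[OF assms, where g = "\<lambda>x. partial i f x * g x + partial i g x * f x"])
       (auto intro!: partial_eqI D Ck_add[OF assms])
  then show ?case
    using Suc.prems D by (auto intro!: continuous_intros simp: real_differentiable_def)
qed

lemma Ck_sum:
  assumes "eopen n U" "\<And>j. j \<in> A \<Longrightarrow> Ck k n U (f j)"
  shows "Ck k n U (\<lambda>x. \<Sum>j\<in>A. f j x)"
  using assms(2)
  by (induction A rule: infinite_finite_induct) (auto intro: Ck_const Ck_add[OF assms(1)])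

text \<open>The chain rule for a function with continuous partial derivatives. The increment of
  \<open>g\<close> is split along a path that changes one coordinate at a time, each piece is
  treated by the one-variable mean value theorem, and continuity of the partials at
  \<open>c t0\<close> gives the limit.\<close>

lemma has_derivative_along_curve:
  assumes V: "eopen m V" "c t0 \<in> V" "\<forall>\<^sub>F t in at t0. c t \<in> V"
    and diff: "\<And>j x. j < m \<Longrightarrow> x \<in> V \<Longrightarrow> (\<lambda>t. g (x(j := t))) differentiable (at (x j))"
    and cont: "\<And>j. j < m \<Longrightarrow> continuous_on V (partial j g)"
    and c': "\<And>j. j < m \<Longrightarrow> ((\<lambda>t. c t j) has_real_derivative c' j) (at t0)"
  shows "((\<lambda>t. g (c t)) has_real_derivative (\<Sum>j<m. partial j g (c t0) * c' j)) (at t0)"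
proof -
  \<comment> \<open>Corners of the staircase from \<open>c t0\<close> (at \<open>j = 0\<close>) to
    \<open>c t\<close> (at \<open>j = m\<close>). Neighbouring corners differ in one
    coordinate.\<close>
  define z where "z j t = (\<lambda>i. if i < j then c t i else c t0 i)" for j t
  obtain e where e: "e > 0"
    "\<And>y. (\<forall>i<m. \<bar>y i - c t0 i\<bar> < e) \<Longrightarrow> (\<forall>i\<ge>m. y i = 0) \<Longrightarrow> y \<in> V"
    using eopen_box[OF V(1,2)] by metis
  have lim: "((\<lambda>t. c t i) \<longlongrightarrow> c t0 i) (at t0)" if "i < m" for i
    using c'[OF that] DERIV_isCont isContD by blast
  have "\<forall>\<^sub>F t in at t0. \<forall>i<m. \<bar>c t i - c t0 i\<bar> < e"
  proof -
    have "\<forall>\<^sub>F t in at t0. \<forall>i\<in>{..<m}. \<bar>c t i - c t0 i\<bar> < e"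
      by (rule eventually_ball_finite) (use lim e(1) in \<open>auto simp: tendsto_iff dist_real_def\<close>)
    then show ?thesis by (rule eventually_mono) auto
  qed
  then have near: "\<forall>\<^sub>F t in at t0. c t \<in> V \<and> (\<forall>i<m. \<bar>c t i - c t0 i\<bar> < e)"
    using V(3) eventually_conj by blast
  have step: "\<exists>x. x \<in> V \<and> (\<forall>i. \<bar>x i - c t0 i\<bar> \<le> \<bar>c t i - c t0 i\<bar>) \<and>
      g (z (Suc j) t) - g (z j t) = partial j g x * (c t j - c t0 j)"
    if t: "c t \<in> V" "\<forall>i<m. \<bar>c t i - c t0 i\<bar> < e" and j: "j < m" for t j
  proof -
    define y where "y s = (z j t)(j := s)" for s
    \<comment> \<open>A box around \<open>c t0\<close> rather than an arbitrary neighbourhood is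
      used here: moving single coordinates towards those of \<open>c t\<close> never leaves it, so
      the whole staircase lies in \<open>V\<close>.\<close>
    have yV: "y s \<in> V" if "\<bar>s - c t0 j\<bar> \<le> \<bar>c t j - c t0 j\<bar>" for s
      using that t(2) j e eopen_support[OF V(1) V(2)] eopen_support[OF V(1) t(1)]
      by (intro e(2)) (auto simp: y_def z_def intro: le_less_trans)
    have yD: "((\<lambda>s. g (y s)) has_real_derivative partial j g (y s)) (at s)"
      if "\<bar>s - c t0 j\<bar> \<le> \<bar>c t j - c t0 j\<bar>" for s
      using DERIV_partial[OF diff[OF j yV[OF that]]] unfolding y_def fun_upd_upd fun_upd_same .
    have "\<exists>s. \<bar>s - c t0 j\<bar> \<le> \<bar>c t j - c t0 j\<bar> \<and>
        g (y (c t j)) - g (y (c t0 j)) = partial j g (y s) * (c t j - c t0 j)"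
    proof -
      consider "c t j = c t0 j" | "c t j < c t0 j" | "c t j > c t0 j" by linarith
      then show ?thesis
      proof cases
        case 2
        then have "\<exists>s>c t j. s < c t0 j \<and>
            g (y (c t0 j)) - g (y (c t j)) = (c t0 j - c t j) * partial j g (y s)"
          by (intro MVT2) (auto intro!: yD)
        then obtain s where s: "c t j < s" "s < c t0 j"
          "g (y (c t0 j)) - g (y (c t j)) = (c t0 j - c t j) * partial j g (y s)" by blast
        then have "g (y (c t j)) - g (y (c t0 j)) = partial j g (y s) * (c t j - c t0 j)"
          by (simp add: algebra_simps)
        then show ?thesis using s(1,2) by (intro exI[of _ s]) auto
      next
        case 3
        then have "\<exists>s>c t0 j. s < c t j \<and>
            g (y (c t j)) - g (y (c t0 j)) = (c t j - c t0 j) * partial j g (y s)"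
          by (intro MVT2) (auto intro!: yD)
        then show ?thesis by (force simp: mult.commute)
      qed auto
    qed
    then obtain s where s: "\<bar>s - c t0 j\<bar> \<le> \<bar>c t j - c t0 j\<bar>"
        "g (y (c t j)) - g (y (c t0 j)) = partial j g (y s) * (c t j - c t0 j)" by blast
    have "y (c t j) = z (Suc j) t" "y (c t0 j) = z j t"
      by (auto simp: y_def z_def fun_eq_iff less_Suc_eq)
    then show ?thesis
      using s yV by (intro exI[of _ "y s"]) (auto simp: y_def z_def)
  qed
  \<comment> \<open>The mean value points become functions of \<open>t\<close>. Each coordinate of
    \<open>\<xi> t j\<close> is at least as close to \<open>c t0\<close> as that of
    \<open>c t\<close>, which squeezes \<open>\<xi> t j\<close> to \<open>c t0\<close>.\<close>
  then obtain \<xi> where \<xi>: "\<And>t j. c t \<in> V \<Longrightarrow> \<forall>i<m. \<bar>c t i - c t0 i\<bar> < e \<Longrightarrow> j < m \<Longrightarrow>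
      \<xi> t j \<in> V \<and> (\<forall>i. \<bar>\<xi> t j i - c t0 i\<bar> \<le> \<bar>c t i - c t0 i\<bar>) \<and>
      g (z (Suc j) t) - g (z j t) = partial j g (\<xi> t j) * (c t j - c t0 j)"
    by metis
  have lim\<xi>: "((\<lambda>t. \<xi> t j) \<longlongrightarrow> c t0) (at t0)" if "j < m" for j
    unfolding tendsto_fun_iff
  proof
    fix i
    have c: "((\<lambda>t. c t i - c t0 i) \<longlongrightarrow> 0) (at t0)"
    proof (cases "i < m")
      case True
      then show ?thesis using lim[OF True] LIM_zero by blast
    next
      case False
      have "\<forall>\<^sub>F t in at t0. c t i - c t0 i = 0"
        using V(3)
      proof eventually_elim
        case (elim t)
        then show ?case
          using False eopen_support[OF V(1,2), of i] eopen_support[OF V(1) elim, of i] by simp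
      qed
      then show ?thesis by (rule tendsto_eventually)
    qed
    have "\<forall>\<^sub>F t in at t0. norm (\<xi> t j i - c t0 i) \<le> norm (c t i - c t0 i)"
      using near
    proof (rule eventually_mono)
      fix t assume "c t \<in> V \<and> (\<forall>i<m. \<bar>c t i - c t0 i\<bar> < e)"
      then show "norm (\<xi> t j i - c t0 i) \<le> norm (c t i - c t0 i)"
        using \<xi>[of t j] that unfolding real_norm_def by blast
    qed
    then have "((\<lambda>t. \<xi> t j i - c t0 i) \<longlongrightarrow> 0) (at t0)"
      using tendsto_norm_zero[OF c] by (rule Lim_null_comparison)
    then show "((\<lambda>t. \<xi> t j i) \<longlongrightarrow> c t0 i) (at t0)"
      by (rule LIM_zero_cancel)
  qed
  have lim_partial: "((\<lambda>t. partial j g (\<xi> t j)) \<longlongrightarrow> partial j g (c t0)) (at t0)" if "j < m" for j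
  proof (rule continuous_on_tendsto_compose[OF cont[OF that] lim\<xi>[OF that] V(2)])
    show "\<forall>\<^sub>F t in at t0. \<xi> t j \<in> V"
      using near
    proof (rule eventually_mono)
      fix t assume "c t \<in> V \<and> (\<forall>i<m. \<bar>c t i - c t0 i\<bar> < e)"
      then show "\<xi> t j \<in> V"
        using \<xi>[of t j] that unfolding real_norm_def by blast
    qed
  qed
  have "((\<lambda>t. \<Sum>j<m. partial j g (\<xi> t j) * ((c t j - c t0 j) / (t - t0))) \<longlongrightarrow>
      (\<Sum>j<m. partial j g (c t0) * c' j)) (at t0)"
    using c' lim_partial by (intro tendsto_sum tendsto_mult) (auto simp: has_field_derivative_iff)
  moreover have "\<forall>\<^sub>F t in at t0. (\<Sum>j<m. partial j g (\<xi> t j) * ((c t j - c t0 j) / (t - t0))) =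
      (g (c t) - g (c t0)) / (t - t0)"
    using near
  proof eventually_elim
    case (elim t)
    have "z m t = c t"
      using eopen_support[OF V(1) V(2)] eopen_support[OF V(1), of "c t"] elim
      by (auto simp: z_def fun_eq_iff not_less)
    moreover have "z 0 t = c t0" by (auto simp: z_def)
    ultimately have "g (c t) - g (c t0) = (\<Sum>j<m. g (z (Suc j) t) - g (z j t))"
      by (simp add: sum_lessThan_telescope[of "\<lambda>j. g (z j t)"])
    also have "\<dots> = (\<Sum>j<m. partial j g (\<xi> t j) * (c t j - c t0 j))"
      using \<xi> elim by simp
    finally show ?case by (simp add: sum_divide_distrib)
  qed
  ultimately show ?thesis
    unfolding has_field_derivative_iff by (rule Lim_transform_eventually)
qed

lemma partial_compose:
  assumes V: "eopen m V" and U: "eopen n U" and f: "f \<in> U \<rightarrow> V"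
    and g: "Ck (Suc 0) m V g" and f1: "\<And>j. j < m \<Longrightarrow> Ck (Suc 0) n U (\<lambda>x. f x j)"
    and x: "x \<in> U" and i: "i < n"
  shows "((\<lambda>t. g (f (x(i := t)))) has_real_derivative
    (\<Sum>j<m. partial j g (f x) * partial i (\<lambda>y. f y j) x)) (at (x i))"
proof -
  have "((\<lambda>t. g (f (x(i := t)))) has_real_derivative
    (\<Sum>j<m. partial j g (f (x(i := x i))) * partial i (\<lambda>y. f y j) x)) (at (x i))"
  proof (rule has_derivative_along_curve[where V = V])
    have "\<forall>\<^sub>F t in at (x i). x(i := t) \<in> U"
      using eventually_update_in[OF U x i] eventually_nhds_conv_at by blast
    then show "\<forall>\<^sub>F t in at (x i). f (x(i := t)) \<in> V"
      by eventually_elim (use f in auto)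
    show "((\<lambda>t. f (x(i := t)) j) has_real_derivative partial i (\<lambda>y. f y j) x) (at (x i))"
      if "j < m" for j
      using f1[OF that] x i by (intro DERIV_partial) auto
  qed (use V f x g in \<open>auto simp del: fun_upd_apply\<close>)
  then show ?thesis by simp
qed

lemma continuous_on_componentwise:
  fixes f :: "'a::topological_space \<Rightarrow> nat \<Rightarrow> real"
  assumes "f \<in> U \<rightarrow> Euc m" "\<And>j. j < m \<Longrightarrow> continuous_on U (\<lambda>x. f x j)"
  shows "continuous_on U f"
proof (rule continuous_on_coordinatewise_then_product)
  fix j
  have "continuous_on U (\<lambda>x. f x j)" if "j \<ge> m"
    using funcset_mem[OF assms(1)] that by (subst continuous_on_cong[where g = "\<lambda>_. 0"]) auto
  then show "continuous_on U (\<lambda>x. f x j)" using assms(2) not_less by blast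
qed

text \<open>The partials of the composite are sums of products of \<open>partial j g\<close> after
  \<open>f\<close> with partials of \<open>f\<close>. The first factor is again a composite with the
  same inner map and lower order, so the induction keeps \<open>f\<close> fixed and varies
  \<open>g\<close>.\<close>

lemma Ck_compose:
  assumes V: "eopen m V" and U: "eopen n U" and f: "f \<in> U \<rightarrow> V"
  shows "Ck k m V g \<Longrightarrow> (\<And>j. j < m \<Longrightarrow> Ck k n U (\<lambda>x. f x j)) \<Longrightarrow> Ck k n U (\<lambda>x. g (f x))"
proof (induction k arbitrary: g)
  case (0 g)
  have "f \<in> U \<rightarrow> Euc m"
    using f openin_subset[OF V] by (meson Pi_mono subsetD)
  then have "continuous_on U f"
    using 0(2) continuous_on_componentwise[of f U m] by simp
  then show ?case
    using 0(1) f by (auto intro: continuous_on_compose2[of V g])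
next
  case (Suc k)
  have f1: "Ck (Suc 0) n U (\<lambda>x. f x j)" if "j < m" for j
    using Suc.prems(2)[OF that] Ck_continuous by auto
  have g1: "Ck (Suc 0) m V g"
    using Suc.prems(1) Ck_continuous by auto
  note D = partial_compose[OF V U f g1 f1]
  have "Ck k n U (partial i (\<lambda>x. g (f x)))" if i: "i < n" for i
  proof (subst Ck_cong[OF U])
    show "partial i (\<lambda>x. g (f x)) x = (\<Sum>j<m. partial j g (f x) * partial i (\<lambda>y. f y j) x)"
      if "x \<in> U" for x
      using D[OF _ that i] by (intro partial_eqI) auto
    show "Ck k n U (\<lambda>x. \<Sum>j<m. partial j g (f x) * partial i (\<lambda>y. f y j) x)"
    proof (rule Ck_sum[OF U], rule Ck_mult[OF U])
      fix j assume "j \<in> {..<m}"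
      then have j: "j < m" by simp
      show "Ck k n U (partial i (\<lambda>y. f y j))"
        using Suc.prems(2)[OF j] i by simp
      show "Ck k n U (\<lambda>x. partial j g (f x))"
        by (rule Suc.IH) (use Suc.prems(1) j Ck_antimono[OF Suc.prems(2)] in auto)
    qed
  qed
  moreover have "continuous_on U (\<lambda>x. g (f x))"
  proof (rule continuous_on_compose2[of V g])
    have "f \<in> U \<rightarrow> Euc m"
      using f openin_subset[OF V] by (meson Pi_mono subsetD)
    then show "continuous_on U f"
      using f1 by (simp add: continuous_on_componentwise)
  qed (use f g1 in auto)
  moreover have "(\<lambda>t. g (f (x(i := t)))) differentiable at (x i)" if "i < n" "x \<in> U" for i x
    using D[OF _ that(2,1)] unfolding real_differentiable_def by blast
  ultimately show ?case by (simp del: fun_upd_apply)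
qed

section \<open>Closure properties of smooth functions\<close>

lemma C_infinity_const: "C_infinity n U (\<lambda>_. a)"
  and C_infinity_coord: "C_infinity n U (\<lambda>x. x j)"
  by (simp_all add: C_infinity_iff_Ck Ck_const Ck_coord)

lemma C_infinity_add: "eopen n U \<Longrightarrow> C_infinity n U f \<Longrightarrow> C_infinity n U g \<Longrightarrow> C_infinity n U (\<lambda>x. f x + g x)"
  and C_infinity_mult: "eopen n U \<Longrightarrow> C_infinity n U f \<Longrightarrow> C_infinity n U g \<Longrightarrow> C_infinity n U (\<lambda>x. f x * g x)"
  by (simp_all add: C_infinity_iff_Ck Ck_add Ck_mult)

lemma C_infinity_sum:
  "eopen n U \<Longrightarrow> (\<And>j. j \<in> A \<Longrightarrow> C_infinity n U (f j)) \<Longrightarrow> C_infinity n U (\<lambda>x. \<Sum>j\<in>A. f j x)"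
  by (simp add: C_infinity_iff_Ck Ck_sum)

lemma C_infinity_compose:
  "eopen m V \<Longrightarrow> eopen n U \<Longrightarrow> smooth_map n U V f \<Longrightarrow> C_infinity m V g \<Longrightarrow>
    C_infinity n U (\<lambda>x. g (f x))"
  by (simp add: C_infinity_iff_Ck smooth_map_def Ck_compose)

section \<open>Vector spaces, quotients and linear combinations\<close>

lemma real_ring_simps [simp]:
  "carrier real_ring = UNIV" "a \<oplus>\<^bsub>real_ring\<^esub> b = a + b" "a \<otimes>\<^bsub>real_ring\<^esub> b = a * b"
  "\<zero>\<^bsub>real_ring\<^esub> = 0" "\<one>\<^bsub>real_ring\<^esub> = 1"
  by (simp_all add: real_ring_def)

lemma cring_real_ring: "cring real_ring"
proof (rule cringI)
  show "abelian_group real_ring"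
    by (rule abelian_groupI) (auto simp: algebra_simps intro: exI[of _ "- x" for x])
  show "comm_monoid real_ring"
    by (rule comm_monoidI) (auto simp: algebra_simps)
qed (auto simp: algebra_simps)

lemma real_ring_minus [simp]: "\<ominus>\<^bsub>real_ring\<^esub> a = - a"
proof -
  interpret cring real_ring by (rule cring_real_ring)
  show ?thesis by (rule minus_equality) auto
qed

text \<open>Negatives come from scalar multiplication: \<open>(-1) \<odot> x\<close> is inverse to
  \<open>x\<close> by distributivity and \<open>0 \<odot> x = 0\<close>.\<close>

lemma is_vspI:
  assumes "\<And>x y. x \<in> carrier W \<Longrightarrow> y \<in> carrier W \<Longrightarrow> x \<oplus>\<^bsub>W\<^esub> y \<in> carrier W"
    and "\<zero>\<^bsub>W\<^esub> \<in> carrier W"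
    and "\<And>x y z. x \<in> carrier W \<Longrightarrow> y \<in> carrier W \<Longrightarrow> z \<in> carrier W \<Longrightarrow>
      (x \<oplus>\<^bsub>W\<^esub> y) \<oplus>\<^bsub>W\<^esub> z = x \<oplus>\<^bsub>W\<^esub> (y \<oplus>\<^bsub>W\<^esub> z)"
    and "\<And>x y. x \<in> carrier W \<Longrightarrow> y \<in> carrier W \<Longrightarrow> x \<oplus>\<^bsub>W\<^esub> y = y \<oplus>\<^bsub>W\<^esub> x"
    and "\<And>x. x \<in> carrier W \<Longrightarrow> \<zero>\<^bsub>W\<^esub> \<oplus>\<^bsub>W\<^esub> x = x"
    and "\<And>a x. x \<in> carrier W \<Longrightarrow> a \<odot>\<^bsub>W\<^esub> x \<in> carrier W"
    and "\<And>a b x. x \<in> carrier W \<Longrightarrow> (a + b) \<odot>\<^bsub>W\<^esub> x = a \<odot>\<^bsub>W\<^esub> x \<oplus>\<^bsub>W\<^esub> b \<odot>\<^bsub>W\<^esub> x"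
    and "\<And>a x y. x \<in> carrier W \<Longrightarrow> y \<in> carrier W \<Longrightarrow>
      a \<odot>\<^bsub>W\<^esub> (x \<oplus>\<^bsub>W\<^esub> y) = a \<odot>\<^bsub>W\<^esub> x \<oplus>\<^bsub>W\<^esub> a \<odot>\<^bsub>W\<^esub> y"
    and "\<And>a b x. x \<in> carrier W \<Longrightarrow> (a * b) \<odot>\<^bsub>W\<^esub> x = a \<odot>\<^bsub>W\<^esub> (b \<odot>\<^bsub>W\<^esub> x)"
    and "\<And>x. x \<in> carrier W \<Longrightarrow> 1 \<odot>\<^bsub>W\<^esub> x = x"
    and zero: "\<And>x. x \<in> carrier W \<Longrightarrow> 0 \<odot>\<^bsub>W\<^esub> x = \<zero>\<^bsub>W\<^esub>"
  shows "is_vsp W"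
proof (rule moduleI[OF cring_real_ring])
  show "abelian_group W"
  proof (rule abelian_groupI)
    fix x assume x: "x \<in> carrier W"
    have "(-1 + 1) \<odot>\<^bsub>W\<^esub> x = (-1) \<odot>\<^bsub>W\<^esub> x \<oplus>\<^bsub>W\<^esub> x"
      using assms(7)[OF x, of "-1" 1] assms(10)[OF x] by simp
    then show "\<exists>y\<in>carrier W. y \<oplus>\<^bsub>W\<^esub> x = \<zero>\<^bsub>W\<^esub>"
      using assms(6)[OF x] zero[OF x] by auto
  qed (use assms in auto)
qed (use assms in auto)

lemma vsp_smult:
  assumes "is_vsp V"
  shows "x \<in> carrier V \<Longrightarrow> a \<odot>\<^bsub>V\<^esub> x \<in> carrier V"
    and "x \<in> carrier V \<Longrightarrow> (a + b) \<odot>\<^bsub>V\<^esub> x = a \<odot>\<^bsub>V\<^esub> x \<oplus>\<^bsub>V\<^esub> b \<odot>\<^bsub>V\<^esub> x"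
    and "x \<in> carrier V \<Longrightarrow> y \<in> carrier V \<Longrightarrow> a \<odot>\<^bsub>V\<^esub> (x \<oplus>\<^bsub>V\<^esub> y) = a \<odot>\<^bsub>V\<^esub> x \<oplus>\<^bsub>V\<^esub> a \<odot>\<^bsub>V\<^esub> y"
    and "x \<in> carrier V \<Longrightarrow> (a * b) \<odot>\<^bsub>V\<^esub> x = a \<odot>\<^bsub>V\<^esub> (b \<odot>\<^bsub>V\<^esub> x)"
    and "x \<in> carrier V \<Longrightarrow> 1 \<odot>\<^bsub>V\<^esub> x = x"
    and "x \<in> carrier V \<Longrightarrow> 0 \<odot>\<^bsub>V\<^esub> x = \<zero>\<^bsub>V\<^esub>"
    and "a \<odot>\<^bsub>V\<^esub> \<zero>\<^bsub>V\<^esub> = \<zero>\<^bsub>V\<^esub>"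
    and "x \<in> carrier V \<Longrightarrow> (- a) \<odot>\<^bsub>V\<^esub> x = \<ominus>\<^bsub>V\<^esub> (a \<odot>\<^bsub>V\<^esub> x)"
  using module.smult_closed[OF assms, of a x] module.smult_l_distr[OF assms, of a b x]
    module.smult_r_distr[OF assms, of a x y] module.smult_assoc1[OF assms, of a b x]
    module.smult_one[OF assms, of x] module.smult_l_null[OF assms, of x]
    module.smult_r_null[OF assms, of a] module.smult_l_minus[OF assms, of a x]
  by simp_all

lemma vsp_minus:
  assumes "is_vsp V" "x \<in> carrier V" "y \<in> carrier V"
  shows "x \<ominus>\<^bsub>V\<^esub> y = x \<oplus>\<^bsub>V\<^esub> (-1) \<odot>\<^bsub>V\<^esub> y"
proof -
  interpret module real_ring V by fact
  show ?thesis
    using assms by (simp add: a_minus_def vsp_smult)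
qed

lemma linear_mapD:
  assumes "linear_map V W f"
  shows "x \<in> carrier V \<Longrightarrow> f x \<in> carrier W"
    and "x \<in> carrier V \<Longrightarrow> y \<in> carrier V \<Longrightarrow> f (x \<oplus>\<^bsub>V\<^esub> y) = f x \<oplus>\<^bsub>W\<^esub> f y"
    and "x \<in> carrier V \<Longrightarrow> f (a \<odot>\<^bsub>V\<^esub> x) = a \<odot>\<^bsub>W\<^esub> f x"
  using assms by (auto simp: linear_map_def)

lemma linear_map_zero:
  assumes "is_vsp V" "is_vsp W" "linear_map V W f"
  shows "f \<zero>\<^bsub>V\<^esub> = \<zero>\<^bsub>W\<^esub>"
proof -
  interpret V: module real_ring V by fact
  interpret W: module real_ring W by fact
  show ?thesis
    using linear_mapD(3)[OF assms(3), of "\<zero>\<^bsub>V\<^esub>" 0] linear_mapD(1)[OF assms(3), of "\<zero>\<^bsub>V\<^esub>"]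
      V.smult_l_null W.smult_l_null by simp
qed

lemma linear_map_minus:
  assumes "is_vsp V" "is_vsp W" "linear_map V W f" "x \<in> carrier V" "y \<in> carrier V"
  shows "f (x \<ominus>\<^bsub>V\<^esub> y) = f x \<ominus>\<^bsub>W\<^esub> f y"
proof -
  interpret V: module real_ring V by fact
  show ?thesis
    using assms by (simp add: vsp_minus linear_mapD)
qed

lemma linear_map_compose:
  "linear_map V W f \<Longrightarrow> linear_map W Z g \<Longrightarrow> linear_map V Z (\<lambda>x. g (f x))"
  by (auto simp: linear_map_def Pi_iff)

lemma linear_map_inv_into:
  assumes "is_vsp V" "linear_map V W f" "bij_betw f (carrier V) (carrier W)"
  shows "linear_map W V (inv_into (carrier V) f)"
proof -
  interpret V: module real_ring V by fact
  note inj = bij_betw_imp_inj_on[OF assms(3)]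
  have im: "f ` carrier V = carrier W" using assms(3) by (simp add: bij_betw_def)
  have *: "inv_into (carrier V) f (f x) = x" if "x \<in> carrier V" for x
    using inj that by simp
  show ?thesis
    unfolding linear_map_def im[symmetric]
    using * linear_mapD(2,3)[OF assms(2), symmetric] by auto
qed

section \<open>Subspaces and spans\<close>

lemma submoduleD:
  assumes "submodule S real_ring V"
  shows "S \<subseteq> carrier V" "\<zero>\<^bsub>V\<^esub> \<in> S" "x \<in> S \<Longrightarrow> y \<in> S \<Longrightarrow> x \<oplus>\<^bsub>V\<^esub> y \<in> S"
    "x \<in> S \<Longrightarrow> a \<odot>\<^bsub>V\<^esub> x \<in> S"
  using assms subgroup.subset[OF submodule.axioms(1)[OF assms]]
    subgroup.one_closed[OF submodule.axioms(1)[OF assms]]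
    subgroup.m_closed[OF submodule.axioms(1)[OF assms]]
    submodule.smult_closed[OF assms] by auto

lemma vsp_submoduleI:
  assumes "is_vsp V" "S \<subseteq> carrier V" "\<zero>\<^bsub>V\<^esub> \<in> S" "\<And>x y. x \<in> S \<Longrightarrow> y \<in> S \<Longrightarrow> x \<oplus>\<^bsub>V\<^esub> y \<in> S"
    "\<And>a x. x \<in> S \<Longrightarrow> a \<odot>\<^bsub>V\<^esub> x \<in> S"
  shows "submodule S real_ring V"
proof -
  interpret module real_ring V by fact
  have "\<ominus>\<^bsub>V\<^esub> x \<in> S" if "x \<in> S" for x
    using assms(5)[OF that, of "-1"] assms(1,2) that by (simp add: subset_iff vsp_smult)
  then show ?thesis
    using assms by (intro submoduleI) auto
qed

lemma vspan_superset: "S \<subseteq> vspan V S"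
  by (simp add: vspan_def hull_subset)

lemma vspan_minimal: "S \<subseteq> H \<Longrightarrow> submodule H real_ring V \<Longrightarrow> vspan V S \<subseteq> H"
  by (simp add: vspan_def hull_minimal)

lemma submodule_vspan:
  assumes "is_vsp V" "S \<subseteq> carrier V"
  shows "submodule (vspan V S) real_ring V"
proof -
  interpret module real_ring V by fact
  have "submodule (carrier V) real_ring V"
    by (rule vsp_submoduleI[OF assms(1)]) auto
  then have "vspan V S \<subseteq> carrier V"
    using vspan_minimal assms(2) by blast
  then show ?thesis
  proof (rule vsp_submoduleI[OF assms(1)])
    show "\<zero>\<^bsub>V\<^esub> \<in> vspan V S"
      using submoduleD(2)[of _ V] by (simp add: vspan_def hull_def)
    show "x \<oplus>\<^bsub>V\<^esub> y \<in> vspan V S" if "x \<in> vspan V S" "y \<in> vspan V S" for x y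
      using submoduleD(3)[of _ V] that by (simp add: vspan_def hull_def)
    show "a \<odot>\<^bsub>V\<^esub> x \<in> vspan V S" if "x \<in> vspan V S" for a x
      using submoduleD(4)[of _ V] that by (simp add: vspan_def hull_def)
  qed
qed

lemma submodule_preimage:
  assumes "is_vsp V" "is_vsp W" "linear_map V W f" "submodule S real_ring W"
  shows "submodule {x \<in> carrier V. f x \<in> S} real_ring V"
proof -
  interpret V: module real_ring V by fact
  show ?thesis
    using submoduleD[OF assms(4)] linear_mapD[OF assms(3)] linear_map_zero[OF assms(1-3)]
    by (intro vsp_submoduleI[OF assms(1)]) auto
qed

lemma submodule_zero:
  assumes "is_vsp V"
  shows "submodule {\<zero>\<^bsub>V\<^esub>} real_ring V"
proof -
  interpret V: module real_ring V by fact
  show ?thesis by (intro vsp_submoduleI[OF assms]) auto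
qed

text \<open>The preimage of a subspace is a subspace, so it contains the span as soon as it contains
  the generators. This is how relations in tangent spaces and in coinvariants are checked.\<close>

lemma linear_map_vspan:
  assumes "is_vsp V" "is_vsp W" "linear_map V W f" "submodule S real_ring W"
    and "A \<subseteq> carrier V" "\<And>x. x \<in> A \<Longrightarrow> f x \<in> S" "x \<in> vspan V A"
  shows "f x \<in> S"
  using vspan_minimal[OF _ submodule_preimage[OF assms(1-4)]] assms(5-7) by blast

section \<open>Quotient vector spaces\<close>

context
  fixes V :: "'a vsp" and S :: "'a set"
  assumes vsp: "is_vsp V" and sub: "submodule S real_ring V"
begin

interpretation module real_ring V by (rule vsp)

lemma coset_eq: "S +>\<^bsub>V\<^esub> x = (\<lambda>s. s \<oplus>\<^bsub>V\<^esub> x) ` S"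
  by (auto simp: a_r_coset_def r_coset_def)

lemma mem_coset_self: "x \<in> carrier V \<Longrightarrow> x \<in> S +>\<^bsub>V\<^esub> x"
  unfolding coset_eq using submoduleD(2)[OF sub] by (metis image_eqI l_zero)

lemma coset_mem:
  assumes "x \<in> carrier V" "y \<in> S +>\<^bsub>V\<^esub> x"
  shows "y \<in> carrier V" "y \<ominus>\<^bsub>V\<^esub> x \<in> S"
proof -
  obtain s where s: "s \<in> S" "y = s \<oplus>\<^bsub>V\<^esub> x" using assms(2) by (auto simp: coset_eq)
  have "s \<in> carrier V" using s submoduleD(1)[OF sub] by blast
  then show "y \<in> carrier V" "y \<ominus>\<^bsub>V\<^esub> x \<in> S"
    using s assms(1) by (auto simp: a_minus_def a_assoc r_neg)
qed

lemma coset_eq_iff: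
  assumes "x \<in> carrier V" "y \<in> carrier V"
  shows "S +>\<^bsub>V\<^esub> x = S +>\<^bsub>V\<^esub> y \<longleftrightarrow> x \<ominus>\<^bsub>V\<^esub> y \<in> S"
proof
  assume "S +>\<^bsub>V\<^esub> x = S +>\<^bsub>V\<^esub> y"
  then show "x \<ominus>\<^bsub>V\<^esub> y \<in> S" using coset_mem(2)[OF assms(2)] mem_coset_self[OF assms(1)] by simp
next
  have *: "S +>\<^bsub>V\<^esub> x \<subseteq> S +>\<^bsub>V\<^esub> y" if xy: "x \<in> carrier V" "y \<in> carrier V" "x \<ominus>\<^bsub>V\<^esub> y \<in> S" for x y
  proof
    fix z assume "z \<in> S +>\<^bsub>V\<^esub> x"
    then obtain s where s: "s \<in> S" "z = s \<oplus>\<^bsub>V\<^esub> x" by (auto simp: coset_eq)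
    have sV: "s \<in> carrier V" using s submoduleD(1)[OF sub] by blast
    have "z = (s \<oplus>\<^bsub>V\<^esub> (x \<ominus>\<^bsub>V\<^esub> y)) \<oplus>\<^bsub>V\<^esub> y"
      using s(2) sV xy by (simp add: a_minus_def a_assoc l_neg)
    moreover have "s \<oplus>\<^bsub>V\<^esub> (x \<ominus>\<^bsub>V\<^esub> y) \<in> S"
      using s(1) xy(3) submoduleD(3)[OF sub] by blast
    ultimately show "z \<in> S +>\<^bsub>V\<^esub> y" by (auto simp: coset_eq)
  qed
  assume xy: "x \<ominus>\<^bsub>V\<^esub> y \<in> S"
  have "y \<ominus>\<^bsub>V\<^esub> x = (-1) \<odot>\<^bsub>V\<^esub> (x \<ominus>\<^bsub>V\<^esub> y)"
    using assms by (simp add: minus_add a_minus_def a_comm vsp_smult[OF vsp])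
  then have "y \<ominus>\<^bsub>V\<^esub> x \<in> S"
    using xy submoduleD(4)[OF sub] by simp
  then show "S +>\<^bsub>V\<^esub> x = S +>\<^bsub>V\<^esub> y" using * assms xy by blast
qed

lemma carrier_quot_vsp: "carrier (quot_vsp V S) = (\<lambda>x. S +>\<^bsub>V\<^esub> x) ` carrier V"
  by (auto simp: quot_vsp_def A_RCOSETS_def RCOSETS_def a_r_coset_def)

lemma zero_quot_vsp: "\<zero>\<^bsub>quot_vsp V S\<^esub> = S +>\<^bsub>V\<^esub> \<zero>\<^bsub>V\<^esub>"
  using submoduleD(1)[OF sub] by (force simp: quot_vsp_def coset_eq)

lemma add_quot_vsp:
  assumes "x \<in> carrier V" "y \<in> carrier V"
  shows "(S +>\<^bsub>V\<^esub> x) \<oplus>\<^bsub>quot_vsp V S\<^esub> (S +>\<^bsub>V\<^esub> y) = S +>\<^bsub>V\<^esub> (x \<oplus>\<^bsub>V\<^esub> y)"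
proof -
  have "abelian_subgroup S V"
    using submodule.axioms(1)[OF sub] module.axioms(2)[OF vsp] by (intro abelian_subgroupI3 additive_subgroupI)
  then interpret abelian_subgroup S V .
  show ?thesis using assms a_rcos_sum by (simp add: quot_vsp_def)
qed

lemma smult_quot_vsp:
  assumes "x \<in> carrier V"
  shows "a \<odot>\<^bsub>quot_vsp V S\<^esub> (S +>\<^bsub>V\<^esub> x) = S +>\<^bsub>V\<^esub> (a \<odot>\<^bsub>V\<^esub> x)"
proof -
  have "S +>\<^bsub>V\<^esub> (a \<odot>\<^bsub>V\<^esub> y) = S +>\<^bsub>V\<^esub> (a \<odot>\<^bsub>V\<^esub> x)" if y: "y \<in> S +>\<^bsub>V\<^esub> x" for y
  proof -
    note yV = coset_mem[OF assms y]
    have "a \<odot>\<^bsub>V\<^esub> y \<ominus>\<^bsub>V\<^esub> a \<odot>\<^bsub>V\<^esub> x = a \<odot>\<^bsub>V\<^esub> (y \<ominus>\<^bsub>V\<^esub> x)"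
      using yV(1) assms by (simp add: a_minus_def smult_r_distr smult_r_minus)
    then show ?thesis
      using coset_eq_iff yV assms submoduleD(4)[OF sub] by simp
  qed
  then have "(\<lambda>y. S +>\<^bsub>V\<^esub> (a \<odot>\<^bsub>V\<^esub> y)) ` (S +>\<^bsub>V\<^esub> x) = {S +>\<^bsub>V\<^esub> (a \<odot>\<^bsub>V\<^esub> x)}"
    using mem_coset_self[OF assms] by blast
  then show ?thesis by (simp add: quot_vsp_def)
qed

lemma is_vsp_quot_vsp: "is_vsp (quot_vsp V S)"
  by (rule is_vspI; clarsimp simp: carrier_quot_vsp zero_quot_vsp add_quot_vsp smult_quot_vsp a_assoc vsp_smult[OF vsp])
    (simp add: a_comm)

lemma linear_map_coset: "linear_map V (quot_vsp V S) (\<lambda>x. S +>\<^bsub>V\<^esub> x)"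
  by (auto simp: linear_map_def carrier_quot_vsp add_quot_vsp smult_quot_vsp)

lemma coset_eq_zero_iff: "x \<in> carrier V \<Longrightarrow> S +>\<^bsub>V\<^esub> x = \<zero>\<^bsub>quot_vsp V S\<^esub> \<longleftrightarrow> x \<in> S"
  unfolding zero_quot_vsp by (subst coset_eq_iff) (auto simp: vsp_minus[OF vsp] vsp_smult[OF vsp])

end

text \<open>The \<open>the_elem\<close> form agrees with that of \<open>tan_map\<close>, so the map
  induced on tangent spaces is an instance. The value is meaningful when \<open>f\<close> is
  constant on the coset.\<close>

definition coset_lift :: "('a \<Rightarrow> 'b) \<Rightarrow> 'a set \<Rightarrow> 'b" where
  "coset_lift f A = the_elem (f ` A)"

lemma coset_lift_coset:
  assumes "is_vsp V" "is_vsp W" "submodule S real_ring V" "linear_map V W f"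
    and "\<And>s. s \<in> S \<Longrightarrow> f s = \<zero>\<^bsub>W\<^esub>" "x \<in> carrier V"
  shows "coset_lift f (S +>\<^bsub>V\<^esub> x) = f x"
proof -
  interpret V: module real_ring V by fact
  interpret W: module real_ring W by fact
  have "f (s \<oplus>\<^bsub>V\<^esub> x) = f x" if "s \<in> S" for s
    using linear_mapD(1,2)[OF assms(4)] assms(5)[OF that] assms(6) that submoduleD(1)[OF assms(3)]
    by auto
  then have "f ` (S +>\<^bsub>V\<^esub> x) = {f x}"
    using submoduleD(2)[OF assms(3)] by (auto simp: coset_eq[OF assms(1,3)] image_image)
  then show ?thesis by (simp add: coset_lift_def)
qed

lemma linear_map_coset_lift:
  assumes "is_vsp V" "is_vsp W" "submodule S real_ring V" "linear_map V W f"
    and "\<And>s. s \<in> S \<Longrightarrow> f s = \<zero>\<^bsub>W\<^esub>"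
  shows "linear_map (quot_vsp V S) W (coset_lift f)"
proof -
  interpret V: module real_ring V by fact
  note [simp] = coset_lift_coset[OF assms(1-5)] linear_mapD[OF assms(4)]
    add_quot_vsp[OF assms(1,3)] smult_quot_vsp[OF assms(1,3)]
  show ?thesis
    by (auto simp: linear_map_def carrier_quot_vsp[OF assms(1,3)])
qed

text \<open>Linear combinations are indexed by lists, so that sums of combinations are concatenations.\<close>

primrec lcomb :: "'a vsp \<Rightarrow> (real \<times> 'a) list \<Rightarrow> 'a" where
  "lcomb V [] = \<zero>\<^bsub>V\<^esub>"
| "lcomb V (p # L) = fst p \<odot>\<^bsub>V\<^esub> snd p \<oplus>\<^bsub>V\<^esub> lcomb V L"

context
  fixes V :: "'a vsp"
  assumes vsp: "is_vsp V"
begin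

interpretation module real_ring V by (rule vsp)

lemma lcomb_closed: "snd ` set L \<subseteq> carrier V \<Longrightarrow> lcomb V L \<in> carrier V"
  by (induction L) auto

lemma lcomb_append:
  "snd ` set L \<subseteq> carrier V \<Longrightarrow> snd ` set M \<subseteq> carrier V \<Longrightarrow>
    lcomb V (L @ M) = lcomb V L \<oplus>\<^bsub>V\<^esub> lcomb V M"
  by (induction L) (auto simp: lcomb_closed a_assoc)

lemma lcomb_middle:
  assumes "snd ` set A \<subseteq> carrier V" "snd p \<in> carrier V" "snd ` set B \<subseteq> carrier V"
  shows "lcomb V (A @ p # B) = fst p \<odot>\<^bsub>V\<^esub> snd p \<oplus>\<^bsub>V\<^esub> lcomb V (A @ B)"
  using assms by (simp add: lcomb_append lcomb_closed a_lcomm)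

text \<open>The first components of \<open>L\<close> are labels of arbitrary type, and
  \<open>F\<close>, \<open>G\<close> read a coefficient off a label. Labels are coefficient
  functions evaluated at a point or differentiated there, or positions in a coordinate vector; the
  same lemma serves each case.\<close>

lemma lcomb_add:
  assumes "snd ` set L \<subseteq> carrier V"
  shows "lcomb V (map (apfst (\<lambda>f. F f + G f)) L) =
    lcomb V (map (apfst F) L) \<oplus>\<^bsub>V\<^esub> lcomb V (map (apfst G) L)"
  using assms
proof (induction L)
  case (Cons p L)
  have "lcomb V (map (apfst F) L) \<in> carrier V" for F :: "'b \<Rightarrow> real"
    using Cons.prems by (intro lcomb_closed) auto
  then show ?case
    using Cons by (simp add: vsp_smult[OF vsp] a_ac)
qed simp

lemma lcomb_smult:
  assumes "snd ` set L \<subseteq> carrier V"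
  shows "lcomb V (map (apfst (\<lambda>f. a * F f)) L) = a \<odot>\<^bsub>V\<^esub> lcomb V (map (apfst F) L)"
  using assms
proof (induction L)
  case (Cons p L)
  have "lcomb V (map (apfst F) L) \<in> carrier V"
    using Cons.prems by (intro lcomb_closed) auto
  then show ?case
    using Cons by (simp add: vsp_smult[OF vsp])
qed (simp add: vsp_smult[OF vsp])

lemma lcomb_zero:
  assumes "snd ` set L \<subseteq> carrier V" "\<And>f x. (f, x) \<in> set L \<Longrightarrow> F f = 0"
  shows "lcomb V (map (apfst F) L) = \<zero>\<^bsub>V\<^esub>"
  using assms
proof (induction L)
  case (Cons p L)
  have "F (fst p) = 0" using Cons.prems(2)[of "fst p" "snd p"] by simp
  moreover have "lcomb V (map (apfst F) L) = \<zero>\<^bsub>V\<^esub>"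
    using Cons by (metis image_subset_iff list.set_intros(2))
  ultimately show ?case using Cons.prems(1) by (simp add: vsp_smult[OF vsp])
qed simp

lemma lcomb_linear:
  assumes "is_vsp W" "linear_map V W h" "snd ` set L \<subseteq> carrier V"
  shows "h (lcomb V L) = lcomb W (map (apsnd h) L)"
  using assms(3)
  by (induction L) (auto simp: linear_map_zero[OF vsp assms(1,2)] linear_mapD[OF assms(2)] lcomb_closed)

text \<open>
  Every coefficient that does not vanish identically near \<open>t0\<close> can be eliminated: evaluating the
  relation at a point \<open>t1\<close> where \<open>f t1 \<noteq> 0\<close> expresses its vector through the others.
\<close>

lemma lcomb_deriv_zero:
  assumes "snd ` set L \<subseteq> carrier V"
    and "\<And>f x. (f, x) \<in> set L \<Longrightarrow> f differentiable at (t0 :: real)"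
    and "\<forall>\<^sub>F t in nhds t0. lcomb V (map (apfst (\<lambda>f. f t)) L) = \<zero>\<^bsub>V\<^esub>"
  shows "lcomb V (map (apfst (\<lambda>f. deriv f t0)) L) = \<zero>\<^bsub>V\<^esub>"
  using assms
proof (induction "length L" arbitrary: L rule: less_induct)
  case less
  show ?case
  proof (cases "\<forall>(f, x) \<in> set L. \<forall>\<^sub>F t in nhds t0. f t = 0")
    case True
    have "deriv f t0 = 0" if "(f, x) \<in> set L" for f x
      using deriv_cong_ev[of f "\<lambda>_. 0" t0] True that by auto
    then show ?thesis by (rule lcomb_zero[OF less.prems(1)])
  next
    case False
    then obtain f x where fx: "(f, x) \<in> set L" "\<not> (\<forall>\<^sub>F t in nhds t0. f t = 0)" by blast
    obtain A B where L: "L = A @ (f, x) # B" using fx(1) split_list by metis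
    define M where "M = A @ B"
    have x: "x \<in> carrier V" and M: "snd ` set M \<subseteq> carrier V"
      using less.prems(1) by (auto simp: L M_def)
    have MF: "lcomb V (map (apfst F) M) \<in> carrier V" for F :: "(real \<Rightarrow> real) \<Rightarrow> real"
      using M by (intro lcomb_closed) auto
    have LM: "lcomb V (map (apfst F) L) = F f \<odot>\<^bsub>V\<^esub> x \<oplus>\<^bsub>V\<^esub> lcomb V (map (apfst F) M)"
      for F :: "(real \<Rightarrow> real) \<Rightarrow> real"
      using M x by (simp add: L M_def lcomb_middle image_image image_Un)
    obtain t1 where t1: "f t1 \<noteq> 0" "lcomb V (map (apfst (\<lambda>f. f t1)) L) = \<zero>\<^bsub>V\<^esub>"
      using fx(2) less.prems(3) eventually_mono by (smt (verit))
    define c where "c g = - g t1 / f t1" for g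
    have *: "lcomb V (map (apfst c) M) = x"
    proof -
      have "(1 / f t1) \<odot>\<^bsub>V\<^esub> (f t1 \<odot>\<^bsub>V\<^esub> x \<oplus>\<^bsub>V\<^esub> lcomb V (map (apfst (\<lambda>f. f t1)) M)) = \<zero>\<^bsub>V\<^esub>"
        using t1(2) LM by (simp add: vsp_smult[OF vsp])
      then have "x \<oplus>\<^bsub>V\<^esub> (1 / f t1) \<odot>\<^bsub>V\<^esub> lcomb V (map (apfst (\<lambda>f. f t1)) M) = \<zero>\<^bsub>V\<^esub>"
        using t1(1) x MF by (simp add: vsp_smult[OF vsp] vsp_smult(4)[OF vsp, symmetric])
      then have "\<ominus>\<^bsub>V\<^esub> ((1 / f t1) \<odot>\<^bsub>V\<^esub> lcomb V (map (apfst (\<lambda>f. f t1)) M)) = x"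
        using x MF by (intro minus_equality) auto
      moreover have "lcomb V (map (apfst (\<lambda>g. (- 1 / f t1) * g t1)) M) =
          (- 1 / f t1) \<odot>\<^bsub>V\<^esub> lcomb V (map (apfst (\<lambda>f. f t1)) M)"
        by (rule lcomb_smult[OF M])
      moreover have "(\<lambda>g. (- 1 / f t1) * g t1) = c" by (auto simp: c_def)
      ultimately show ?thesis
        using MF by (simp add: vsp_smult(8)[OF vsp, symmetric])
    qed
    \<comment> \<open>Replacing \<open>x\<close> by its expression through \<open>M\<close> adds the
      coefficient \<open>f\<close> to those of the remaining vectors. The combination keeps its
      value at every \<open>t\<close>, while the list is shorter by one.\<close>
    define N where "N = map (apfst (\<lambda>g t. g t + f t * c g)) M"
    have NF: "lcomb V (map (apfst (\<lambda>g. F g + a * c g)) M) = lcomb V (map (apfst F) M) \<oplus>\<^bsub>V\<^esub> a \<odot>\<^bsub>V\<^esub> x"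
      for F :: "(real \<Rightarrow> real) \<Rightarrow> real" and a
      using lcomb_add[OF M, of F "\<lambda>g. a * c g"] lcomb_smult[OF M, of a c] * by simp
    have diff: "g differentiable at t0" if "(g, y) \<in> set M \<or> g = f" for g y
      using less.prems(2) that by (auto simp: L M_def)
    have dN: "deriv (\<lambda>t. g t + f t * c g) t0 = deriv g t0 + deriv f t0 * c g" if "(g, y) \<in> set M" for g y
      using diff[of g y] diff[of f] that
      by (auto intro!: DERIV_imp_deriv derivative_eq_intros simp: DERIV_deriv_iff_real_differentiable)
    have "lcomb V (map (apfst (\<lambda>g. deriv g t0)) N) = \<zero>\<^bsub>V\<^esub>"
    proof (rule less.hyps)
      show "length N < length L" by (simp add: N_def L M_def)
      show "snd ` set N \<subseteq> carrier V" using M by (auto simp: N_def)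
      show "g differentiable at t0" if gN: "(g, y) \<in> set N" for g y
      proof -
        obtain a where a: "(a, y) \<in> set M" "g = (\<lambda>t. a t + f t * c a)"
          using gN by (auto simp: N_def)
        show ?thesis
          unfolding a(2) using diff[of a y] diff[of f] a(1) by (auto intro!: derivative_intros)
      qed
      have "lcomb V (map (apfst (\<lambda>f. f t)) N) = lcomb V (map (apfst (\<lambda>f. f t)) L)" for t
        unfolding LM N_def using NF[of "\<lambda>g. g t" "f t"] MF x
        by (simp add: o_def apfst_compose a_comm)
      then show "\<forall>\<^sub>F t in nhds t0. lcomb V (map (apfst (\<lambda>f. f t)) N) = \<zero>\<^bsub>V\<^esub>"
        using less.prems(3) by simp
    qed
    moreover have "map (apfst (\<lambda>g. deriv g t0)) N = map (apfst (\<lambda>g. deriv g t0 + deriv f t0 * c g)) M"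
      using dN by (auto simp: N_def)
    ultimately show ?thesis
      using NF[of "\<lambda>g. deriv g t0" "deriv f t0"] LM MF x by (simp add: a_comm)
  qed
qed

end

section \<open>Diffeologies and fine vector spaces\<close>

lemma smooth_map_id: "W \<subseteq> U \<Longrightarrow> smooth_map n W U (\<lambda>x. x)"
  by (auto simp: smooth_map_def C_infinity_coord)

lemma smooth_map_continuous:
  assumes "eopen m V" "smooth_map n U V f"
  shows "continuous_on U f"
  using assms(2) by (auto simp: smooth_map_def intro: continuous_on_coordinatewise_then_product C_infinity_continuous)

lemma smooth_map_space:
  assumes "eopen m V" "smooth_map n U V f"
  shows "f \<in> U \<rightarrow> Euc m"
proof -
  have "f \<in> U \<rightarrow> V" using assms(2) by (simp add: smooth_map_def)
  then show ?thesis using openin_subset[OF assms(1)] by (meson Pi_mono subsetD)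
qed

lemma eopen_smooth_preimage:
  assumes "eopen n U" "eopen m V" "smooth_map n U V f" "eopen m N"
  shows "eopen n {x \<in> U. f x \<in> N}"
  using eopen_preimage[OF assms(1,4) smooth_map_continuous[OF assms(2,3)] smooth_map_space[OF assms(2,3)]] .

lemma smooth_map_restrict:
  assumes "smooth_map n U V f" "U' \<subseteq> U" "\<And>x. x \<in> U' \<Longrightarrow> f x \<in> V'"
  shows "smooth_map n U' V' f"
  using assms C_infinity_subset[of n U _ U'] by (auto simp: smooth_map_def)

lemma params_iff: "(n, U, p) \<in> params X \<longleftrightarrow> eopen n U \<and> (\<forall>u\<in>U. p u \<in> X) \<and> p \<in> extensional U"
  by (auto simp: params_def PiE_iff)

lemma compose_cong: "(\<And>x. x \<in> U \<Longrightarrow> f (p x) = g (q x)) \<Longrightarrow> compose U f p = compose U g q"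
  by (auto simp: compose_def)

lemma diffeologyD:
  assumes "diffeology X D" "(n, U, p) \<in> D"
  shows "eopen n U" "u \<in> U \<Longrightarrow> p u \<in> X" "p \<in> extensional U" "(n, U, p) \<in> params X"
  using diffeology.plots_params[OF assms(1)] assms(2) by (auto simp: params_iff subset_iff)

lemma plot_restrict:
  assumes "diffeology X D" "(n, U, p) \<in> D" "eopen n W" "W \<subseteq> U"
  shows "(n, W, restrict p W) \<in> D"
  using diffeology.plot_compose[OF assms(1,2,3) smooth_map_id[OF assms(4)]]
  by (simp add: compose_def restrict_def)

lemma plot_localI:
  assumes "diffeology X D" "(n, U, p) \<in> params X"
    and "\<And>u. u \<in> U \<Longrightarrow> \<exists>W. eopen n W \<and> u \<in> W \<and> W \<subseteq> U \<and> (n, W, restrict p W) \<in> D"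
  shows "(n, U, p) \<in> D"
proof (rule diffeology.plot_local[OF assms(1,2)])
  show "open_cover n {W. eopen n W \<and> W \<subseteq> U \<and> (n, W, restrict p W) \<in> D} U"
    using assms(3) unfolding open_cover_def by blast
qed auto

lemma dsmoothD:
  assumes "dsmooth X D Y E f"
  shows "x \<in> X \<Longrightarrow> f x \<in> Y" "(n, U, p) \<in> D \<Longrightarrow> (n, U, compose U f p) \<in> E"
  using assms by (auto simp: dsmooth_def)

lemma dsmoothI:
  assumes "\<And>x. x \<in> X \<Longrightarrow> f x \<in> Y" "\<And>n U p. (n, U, p) \<in> D \<Longrightarrow> (n, U, compose U f p) \<in> E"
  shows "dsmooth X D Y E f"
  using assms by (auto simp: dsmooth_def)

lemma dsmooth_compose:
  assumes "dsmooth X D Y E f" "dsmooth Y E Z F g"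
  shows "dsmooth X D Z F (\<lambda>x. g (f x))"
proof (rule dsmoothI)
  fix n U p assume "(n, U, p) \<in> D"
  then have "(n, U, compose U g (compose U f p)) \<in> F"
    using assms dsmoothD(2) by metis
  moreover have "compose U g (compose U f p) = compose U (\<lambda>x. g (f x)) p"
    by (auto simp: compose_def)
  ultimately show "(n, U, compose U (\<lambda>x. g (f x)) p) \<in> F" by simp
qed (use assms in \<open>auto dest: dsmoothD\<close>)

lemma dsmooth_cong:
  assumes "diffeology X D" "\<And>x. x \<in> X \<Longrightarrow> f x = g x" "dsmooth X D Y E f"
  shows "dsmooth X D Y E g"
proof (rule dsmoothI)
  fix n U p assume p: "(n, U, p) \<in> D"
  then have "compose U f p = compose U g p"
    using diffeologyD(2)[OF assms(1) p] assms(2) by (intro compose_cong) auto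
  then show "(n, U, compose U g p) \<in> E" using dsmoothD(2)[OF assms(3) p] by simp
qed (use assms dsmoothD(1) in metis)

section \<open>Quotient diffeologies\<close>

lemma quot_diff_iff:
  "(n, U, q) \<in> quot_diff D Q \<pi> \<longleftrightarrow> (n, U, q) \<in> params Q \<and>
    (\<forall>u\<in>U. \<exists>W f. eopen n W \<and> u \<in> W \<and> W \<subseteq> U \<and> (n, W, f) \<in> D \<and> (\<forall>y\<in>W. q y = \<pi> (f y)))"
    (is "?l \<longleftrightarrow> ?p \<and> ?r")
proof -
  have eq: "restrict q W = compose W \<pi> f \<longleftrightarrow> (\<forall>y\<in>W. q y = \<pi> (f y))" for W f
    by (auto simp: compose_def fun_eq_iff restrict_def)
  have "(\<exists>\<W>. open_cover n \<W> U \<and> (\<forall>W\<in>\<W>. \<exists>f. (n, W, f) \<in> D \<and> restrict q W = compose W \<pi> f)) \<longleftrightarrow> ?r"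
  proof
    assume "\<exists>\<W>. open_cover n \<W> U \<and> (\<forall>W\<in>\<W>. \<exists>f. (n, W, f) \<in> D \<and> restrict q W = compose W \<pi> f)"
    then obtain \<W> where cov: "open_cover n \<W> U"
      and W: "\<And>W. W \<in> \<W> \<Longrightarrow> \<exists>f. (n, W, f) \<in> D \<and> (\<forall>y\<in>W. q y = \<pi> (f y))"
      unfolding eq by blast
    show ?r
    proof
      fix u assume "u \<in> U"
      then obtain W where "W \<in> \<W>" "u \<in> W" "W \<subseteq> U" "eopen n W"
        using cov unfolding open_cover_def by blast
      then show "\<exists>W f. eopen n W \<and> u \<in> W \<and> W \<subseteq> U \<and> (n, W, f) \<in> D \<and> (\<forall>y\<in>W. q y = \<pi> (f y))"
        using W[of W] by blast
    qed
  next
    assume r: ?r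
    let ?W = "{W. eopen n W \<and> W \<subseteq> U \<and> (\<exists>f. (n, W, f) \<in> D \<and> (\<forall>y\<in>W. q y = \<pi> (f y)))}"
    have "U \<subseteq> \<Union> ?W"
    proof
      fix u assume "u \<in> U"
      then obtain W f where "eopen n W" "u \<in> W" "W \<subseteq> U" "(n, W, f) \<in> D" "\<forall>y\<in>W. q y = \<pi> (f y)"
        using r by metis
      then show "u \<in> \<Union> ?W" by (intro UnionI[of W]) auto
    qed
    then have "open_cover n ?W U" unfolding open_cover_def by auto
    then show "\<exists>\<W>. open_cover n \<W> U \<and> (\<forall>W\<in>\<W>. \<exists>f. (n, W, f) \<in> D \<and> restrict q W = compose W \<pi> f)"
      unfolding eq by (intro exI[of _ ?W]) simp
  qed
  then show ?thesis by (simp add: quot_diff_def)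
qed

lemma diffeology_quot_diff:
  assumes D: "diffeology X D" and \<pi>: "\<pi> ` X = Q"
  shows "diffeology Q (quot_diff D Q \<pi>)"
proof
  show "quot_diff D Q \<pi> \<subseteq> params Q" by (auto simp: quot_diff_def)
next
  fix n U x assume U: "eopen n U" and "x \<in> Q"
  then obtain a where a: "a \<in> X" "x = \<pi> a" using \<pi> by blast
  have "(n, U, \<lambda>u\<in>U. a) \<in> D" using diffeology.plot_const[OF D U a(1)] .
  then show "(n, U, \<lambda>u\<in>U. x) \<in> quot_diff D Q \<pi>"
    unfolding quot_diff_iff using U \<open>x \<in> Q\<close> a
    by (auto simp: params_iff intro!: exI[of _ U] exI[of _ "\<lambda>u\<in>U. a"])
next
  fix n U p \<W>
  assume p: "(n, U, p) \<in> params Q" and cov: "open_cover n \<W> U"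
    and W: "\<And>W. W \<in> \<W> \<Longrightarrow> (n, W, restrict p W) \<in> quot_diff D Q \<pi>"
  have "\<exists>W f. eopen n W \<and> u \<in> W \<and> W \<subseteq> U \<and> (n, W, f) \<in> D \<and> (\<forall>y\<in>W. p y = \<pi> (f y))" if u: "u \<in> U" for u
  proof -
    obtain W where w: "W \<in> \<W>" "u \<in> W" "W \<subseteq> U" using cov u unfolding open_cover_def by blast
    obtain W' f where "eopen n W'" "u \<in> W'" "W' \<subseteq> W" "(n, W', f) \<in> D" "\<forall>y\<in>W'. restrict p W y = \<pi> (f y)"
      using W[OF w(1)] w(2) unfolding quot_diff_iff by blast
    then show ?thesis
      using w(3) by (intro exI[of _ W'] exI[of _ f]) (auto simp: subset_iff)
  qed
  then show "(n, U, p) \<in> quot_diff D Q \<pi>" using p quot_diff_iff by blast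
next
  fix n U p m V f
  assume p: "(n, U, p) \<in> quot_diff D Q \<pi>" and V: "eopen m V" and f: "smooth_map m V U f"
  note p' = p[unfolded quot_diff_iff]
  have U: "eopen n U" using p' by (auto simp: params_iff)
  have fU: "f v \<in> U" if "v \<in> V" for v using f that by (auto simp: smooth_map_def)
  have "\<exists>W g. eopen m W \<and> v \<in> W \<and> W \<subseteq> V \<and> (m, W, g) \<in> D \<and> (\<forall>y\<in>W. compose V p f y = \<pi> (g y))"
    if v: "v \<in> V" for v
  proof -
    obtain W g where W: "eopen n W" "f v \<in> W" "W \<subseteq> U" "(n, W, g) \<in> D" "\<forall>y\<in>W. p y = \<pi> (g y)"
      using p' fU[OF v] by blast
    define W' where "W' = {x \<in> V. f x \<in> W}"
    have W': "eopen m W'" unfolding W'_def by (rule eopen_smooth_preimage[OF V U f W(1)])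
    have "smooth_map m W' W f" by (rule smooth_map_restrict[OF f]) (auto simp: W'_def)
    then have "(m, W', compose W' g f) \<in> D" using diffeology.plot_compose[OF D W(4) W'] by blast
    moreover have "compose V p f y = \<pi> (compose W' g f y)" if "y \<in> W'" for y
      using that W(5) by (auto simp: compose_def W'_def)
    ultimately show ?thesis using W' W(2) v W'_def by blast
  qed
  moreover have "(m, V, compose V p f) \<in> params Q"
    using p' V fU by (auto simp: params_iff compose_def)
  ultimately show "(m, V, compose V p f) \<in> quot_diff D Q \<pi>" unfolding quot_diff_iff by blast
qed

lemma dsmooth_quot_map:
  assumes "diffeology X D" "\<pi> ` X \<subseteq> Q"
  shows "dsmooth X D Q (quot_diff D Q \<pi>) \<pi>"
proof (rule dsmoothI)
  fix n U p assume p: "(n, U, p) \<in> D"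
  then show "(n, U, compose U \<pi> p) \<in> quot_diff D Q \<pi>"
    unfolding quot_diff_iff using diffeologyD[OF assms(1) p] assms(2)
    by (auto simp: params_iff compose_def intro!: exI[of _ U] exI[of _ p])
qed (use assms in auto)

text \<open>Plots of a quotient lift locally and being a plot is a local property, so it suffices to
  test \<open>h\<close> after \<open>\<pi>\<close>. Every smooth map out of an orbit space or a
  space of coinvariants is obtained this way.\<close>

lemma dsmooth_quot_lift:
  assumes D: "diffeology X D" and E: "diffeology Y E" and h: "\<And>x. x \<in> Q \<Longrightarrow> h x \<in> Y"
    and s: "dsmooth X D Y E (\<lambda>x. h (\<pi> x))"
  shows "dsmooth Q (quot_diff D Q \<pi>) Y E h"
proof (rule dsmoothI[OF h])
  fix n U p assume p: "(n, U, p) \<in> quot_diff D Q \<pi>"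
  note p' = p[unfolded quot_diff_iff]
  show "(n, U, compose U h p) \<in> E"
  proof (rule plot_localI[OF E])
    show "(n, U, compose U h p) \<in> params Y"
      using p' h by (auto simp: params_iff compose_def)
    fix u assume "u \<in> U"
    then obtain W f where W: "eopen n W" "u \<in> W" "W \<subseteq> U" "(n, W, f) \<in> D" "\<forall>y\<in>W. p y = \<pi> (f y)"
      using p' by blast
    have "(n, W, compose W (\<lambda>x. h (\<pi> x)) f) \<in> E" using dsmoothD(2)[OF s W(4)] .
    moreover have "restrict (compose U h p) W = compose W (\<lambda>x. h (\<pi> x)) f"
      using W(3,5) by (auto simp: compose_def fun_eq_iff restrict_def)
    ultimately show "\<exists>W. eopen n W \<and> u \<in> W \<and> W \<subseteq> U \<and> (n, W, restrict (compose U h p) W) \<in> E"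
      using W by metis
  qed
qed

section \<open>Products and diffeological vector spaces\<close>

lemma prod_diff_iff:
  assumes "\<And>n U p. (n, U, p) \<in> D \<Longrightarrow> p \<in> extensional U" "\<And>n U p. (n, U, p) \<in> E \<Longrightarrow> p \<in> extensional U"
  shows "(n, U, r) \<in> prod_diff D E \<longleftrightarrow> (\<exists>p q. (n, U, p) \<in> D \<and> (n, U, q) \<in> E \<and> r = (\<lambda>y\<in>U. (p y, q y)))"
proof
  assume r: "(n, U, r) \<in> prod_diff D E"
  then show "\<exists>p q. (n, U, p) \<in> D \<and> (n, U, q) \<in> E \<and> r = (\<lambda>y\<in>U. (p y, q y))"
    by (intro exI[of _ "compose U fst r"] exI[of _ "compose U snd r"])
      (auto simp: prod_diff_def compose_def intro!: extensionalityI[of r U])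
next
  assume "\<exists>p q. (n, U, p) \<in> D \<and> (n, U, q) \<in> E \<and> r = (\<lambda>y\<in>U. (p y, q y))"
  then obtain p q where pq: "(n, U, p) \<in> D" "(n, U, q) \<in> E" "r = (\<lambda>y\<in>U. (p y, q y))" by blast
  have "compose U fst r = p" "compose U snd r = q"
    using pq assms by (auto simp: compose_def intro!: extensionalityI[of _ U])
  then show "(n, U, r) \<in> prod_diff D E" using pq by (auto simp: prod_diff_def)
qed

lemma real_diff_iff: "(n, U, f) \<in> real_diff \<longleftrightarrow> eopen n U \<and> f \<in> extensional U \<and> C_infinity n U f"
  by (auto simp: real_diff_def params_iff)

lemma restrict_real_diff: "eopen n U \<Longrightarrow> C_infinity n U f \<Longrightarrow> (n, U, restrict f U) \<in> real_diff"
  using C_infinity_cong[of n U f "restrict f U"] by (simp add: real_diff_iff)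

text \<open>Plots of a product are pairs of plots with a common domain. Joint smoothness of the
  operations thus becomes closure of the plots under pointwise sums and under multiplication by
  smooth functions.\<close>

lemma dvs_iff:
  "dvs V D \<longleftrightarrow> is_vsp V \<and> diffeology (carrier V) D \<and>
    (\<forall>n U p q. (n, U, p) \<in> D \<longrightarrow> (n, U, q) \<in> D \<longrightarrow> (n, U, \<lambda>y\<in>U. p y \<oplus>\<^bsub>V\<^esub> q y) \<in> D) \<and>
    (\<forall>n U f p. C_infinity n U f \<longrightarrow> (n, U, p) \<in> D \<longrightarrow> (n, U, \<lambda>y\<in>U. f y \<odot>\<^bsub>V\<^esub> p y) \<in> D)"
proof (cases "is_vsp V \<and> diffeology (carrier V) D")
  case True
  then interpret module real_ring V by blast
  have D: "diffeology (carrier V) D" using True by blast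
  have ext: "p \<in> extensional U" if "(n, U, p) \<in> D" for n U p
    using diffeologyD(3)[OF D that] .
  have prod1: "(n, U, r) \<in> prod_diff D D \<longleftrightarrow>
      (\<exists>p q. (n, U, p) \<in> D \<and> (n, U, q) \<in> D \<and> r = (\<lambda>y\<in>U. (p y, q y)))" for n U r
    by (rule prod_diff_iff) (auto intro: ext)
  have prod2: "(n, U, r) \<in> prod_diff real_diff D \<longleftrightarrow>
      (\<exists>p q. (n, U, p) \<in> real_diff \<and> (n, U, q) \<in> D \<and> r = (\<lambda>y\<in>U. (p y, q y)))" for n U r
    by (rule prod_diff_iff) (auto simp: real_diff_iff ext)
  have "dsmooth (carrier V \<times> carrier V) (prod_diff D D) (carrier V) D (\<lambda>(x, y). x \<oplus>\<^bsub>V\<^esub> y) \<longleftrightarrow>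
      (\<forall>n U p q. (n, U, p) \<in> D \<longrightarrow> (n, U, q) \<in> D \<longrightarrow> (n, U, \<lambda>y\<in>U. p y \<oplus>\<^bsub>V\<^esub> q y) \<in> D)"
    (is "?l \<longleftrightarrow> ?r")
  proof
    assume l: ?l
    show ?r
    proof (intro allI impI)
      fix n U p q assume "(n, U, p) \<in> D" "(n, U, q) \<in> D"
      then have "(n, U, compose U (\<lambda>(x, y). x \<oplus>\<^bsub>V\<^esub> y) (\<lambda>y\<in>U. (p y, q y))) \<in> D"
        using prod1 by (intro dsmoothD(2)[OF l]) blast
      then show "(n, U, \<lambda>y\<in>U. p y \<oplus>\<^bsub>V\<^esub> q y) \<in> D"
        by (simp add: compose_def cong: restrict_cong)
    qed
  next
    assume r: ?r
    show ?l
    proof (rule dsmoothI)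
      fix n U s assume "(n, U, s) \<in> prod_diff D D"
      then obtain p q where "(n, U, p) \<in> D" "(n, U, q) \<in> D" "s = (\<lambda>y\<in>U. (p y, q y))"
        using prod1 by blast
      then show "(n, U, compose U (\<lambda>(x, y). x \<oplus>\<^bsub>V\<^esub> y) s) \<in> D"
        using r by (simp add: compose_def cong: restrict_cong)
    qed auto
  qed
  moreover have "dsmooth (UNIV \<times> carrier V) (prod_diff real_diff D) (carrier V) D (\<lambda>(a, x). a \<odot>\<^bsub>V\<^esub> x) \<longleftrightarrow>
      (\<forall>n U f p. C_infinity n U f \<longrightarrow> (n, U, p) \<in> D \<longrightarrow> (n, U, \<lambda>y\<in>U. f y \<odot>\<^bsub>V\<^esub> p y) \<in> D)"
    (is "?l \<longleftrightarrow> ?r")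
  proof
    assume l: ?l
    show ?r
    proof (intro allI impI)
      fix n U f q assume f: "C_infinity n U f" and q: "(n, U, q) \<in> D"
      have "(n, U, restrict f U) \<in> real_diff"
        using restrict_real_diff f diffeologyD(1)[OF D q] by blast
      then have "(n, U, \<lambda>y\<in>U. (restrict f U y, q y)) \<in> prod_diff real_diff D"
        using q prod2 by blast
      then have "(n, U, compose U (\<lambda>(a, x). a \<odot>\<^bsub>V\<^esub> x) (\<lambda>y\<in>U. (restrict f U y, q y))) \<in> D"
        by (rule dsmoothD(2)[OF l])
      then show "(n, U, \<lambda>y\<in>U. f y \<odot>\<^bsub>V\<^esub> q y) \<in> D"
        by (simp add: compose_def cong: restrict_cong)
    qed
  next
    assume r: ?r
    show ?l
    proof (rule dsmoothI)
      fix n U s assume "(n, U, s) \<in> prod_diff real_diff D"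
      then obtain p q where "(n, U, p) \<in> real_diff" "(n, U, q) \<in> D" "s = (\<lambda>y\<in>U. (p y, q y))"
        using prod2 by blast
      then show "(n, U, compose U (\<lambda>(a, x). a \<odot>\<^bsub>V\<^esub> x) s) \<in> D"
        using r by (simp add: compose_def real_diff_iff cong: restrict_cong)
    qed (use True vsp_smult(1) in auto)
  qed
  ultimately show ?thesis using True by (simp add: dvs_def)
qed (auto simp: dvs_def)

lemma dvsD:
  assumes "dvs V D"
  shows "is_vsp V" "diffeology (carrier V) D"
    "(n, U, p) \<in> D \<Longrightarrow> (n, U, q) \<in> D \<Longrightarrow> (n, U, \<lambda>y\<in>U. p y \<oplus>\<^bsub>V\<^esub> q y) \<in> D"
    "C_infinity n U f \<Longrightarrow> (n, U, p) \<in> D \<Longrightarrow> (n, U, \<lambda>y\<in>U. f y \<odot>\<^bsub>V\<^esub> p y) \<in> D"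
  using assms unfolding dvs_iff by blast+

abbreviation pullback_diff :: "'a set \<Rightarrow> ('a \<Rightarrow> 'b) \<Rightarrow> 'b param set \<Rightarrow> 'a param set" where
  "pullback_diff X j E \<equiv> {(n, U, p) \<in> params X. (n, U, compose U j p) \<in> E}"

lemma diffeology_pullback:
  assumes D: "diffeology Y E" and j: "\<And>x. x \<in> X \<Longrightarrow> j x \<in> Y"
  shows "diffeology X (pullback_diff X j E)"
proof
  fix n U x assume U: "eopen n U" and x: "x \<in> X"
  have "compose U j (\<lambda>u\<in>U. x) = (\<lambda>u\<in>U. j x)" by (auto simp: compose_def)
  then show "(n, U, \<lambda>u\<in>U. x) \<in> pullback_diff X j E"
    using diffeology.plot_const[OF D U j[OF x]] U x by (auto simp: params_iff)
next
  fix n U p \<W>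
  assume p: "(n, U, p) \<in> params X" and cov: "open_cover n \<W> U"
    and W: "\<And>W. W \<in> \<W> \<Longrightarrow> (n, W, restrict p W) \<in> pullback_diff X j E"
  have "(n, U, compose U j p) \<in> E"
  proof (rule diffeology.plot_local[OF D _ cov])
    show "(n, U, compose U j p) \<in> params Y" using p j by (auto simp: params_iff compose_def)
    fix W assume w: "W \<in> \<W>"
    then have "W \<subseteq> U" using cov by (auto simp: open_cover_def)
    then have "restrict (compose U j p) W = compose W j (restrict p W)"
      by (auto simp: compose_def fun_eq_iff restrict_def)
    then show "(n, W, restrict (compose U j p) W) \<in> E" using W[OF w] by simp
  qed
  then show "(n, U, p) \<in> pullback_diff X j E" using p by simp
next
  fix n U p m V f
  assume p: "(n, U, p) \<in> pullback_diff X j E"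
    and V: "eopen m V" and f: "smooth_map m V U f"
  have fU: "f v \<in> U" if "v \<in> V" for v using f that by (auto simp: smooth_map_def)
  have "compose V (compose U j p) f = compose V j (compose V p f)"
    using fU by (auto simp: compose_def fun_eq_iff)
  then have "(m, V, compose V j (compose V p f)) \<in> E"
    using diffeology.plot_compose[OF D _ V f, where n = n and p = "compose U j p"] p by simp
  then show "(m, V, compose V p f) \<in> pullback_diff X j E"
    using p V fU by (auto simp: params_iff compose_def)
qed auto

lemma dvs_pullback:
  assumes V: "is_vsp V" and W: "dvs W E" and j: "linear_map V W j"
  shows "dvs V (pullback_diff (carrier V) j E)"
proof -
  interpret V: module real_ring V by (rule V)
  have "diffeology (carrier V) (pullback_diff (carrier V) j E)"
    by (rule diffeology_pullback[OF dvsD(2)[OF W]]) (rule linear_mapD(1)[OF j])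
  moreover have "(n, U, compose U j (\<lambda>y\<in>U. p y \<oplus>\<^bsub>V\<^esub> q y)) \<in> E"
    if p: "(n, U, p) \<in> params (carrier V)" "(n, U, compose U j p) \<in> E"
      and q: "(n, U, q) \<in> params (carrier V)" "(n, U, compose U j q) \<in> E" for n U p q
  proof -
    have "compose U j (\<lambda>y\<in>U. p y \<oplus>\<^bsub>V\<^esub> q y) = (\<lambda>y\<in>U. compose U j p y \<oplus>\<^bsub>W\<^esub> compose U j q y)"
      using p(1) q(1) linear_mapD(2)[OF j] by (auto simp: compose_def fun_eq_iff params_iff)
    then show ?thesis using dvsD(3)[OF W p(2) q(2)] by simp
  qed
  moreover have "(n, U, compose U j (\<lambda>y\<in>U. f y \<odot>\<^bsub>V\<^esub> p y)) \<in> E"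
    if f: "C_infinity n U f" and p: "(n, U, p) \<in> params (carrier V)" "(n, U, compose U j p) \<in> E" for n U f p
  proof -
    have "compose U j (\<lambda>y\<in>U. f y \<odot>\<^bsub>V\<^esub> p y) = (\<lambda>y\<in>U. f y \<odot>\<^bsub>W\<^esub> compose U j p y)"
      using p(1) linear_mapD(3)[OF j] by (auto simp: compose_def fun_eq_iff params_iff)
    then show ?thesis using dvsD(4)[OF W f p(2)] by simp
  qed
  ultimately show ?thesis
    unfolding dvs_iff using V by (auto simp: params_iff vsp_smult(1))
qed

text \<open>The pullback of \<open>E\<close> along \<open>j\<close> is a vector space diffeology on
  \<open>V\<close>, and the fine diffeology is contained in every such diffeology.\<close>

lemma fine_dvs_linear_smooth:
  assumes "fine_dvs V D" "dvs W E" "linear_map V W j"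
  shows "dsmooth (carrier V) D (carrier W) E j"
proof (rule dsmoothI)
  have V: "dvs V D" and *: "\<And>E. dvs V E \<Longrightarrow> D \<subseteq> E" using assms(1) by (auto simp: fine_dvs_def)
  show "(n, U, compose U j p) \<in> E" if "(n, U, p) \<in> D" for n U p
    using *[OF dvs_pullback[OF dvsD(1)[OF V] assms(2,3)]] that by auto
qed (rule linear_mapD(1)[OF assms(3)])

section \<open>The fine diffeology through local linear combinations\<close>

definition lc_on :: "'a vsp \<Rightarrow> nat \<Rightarrow> (nat \<Rightarrow> real) set \<Rightarrow> (((nat \<Rightarrow> real) \<Rightarrow> real) \<times> 'a) list \<Rightarrow>
    ((nat \<Rightarrow> real) \<Rightarrow> 'a) \<Rightarrow> bool" where
  "lc_on W n N L p \<longleftrightarrow> (\<forall>(f, x)\<in>set L. C_infinity n N f \<and> x \<in> carrier W) \<and>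
    (\<forall>y\<in>N. p y = lcomb W (map (apfst (\<lambda>f. f y)) L))"

text \<open>An explicit model of the fine diffeology; \<open>fine_dvs_iff\<close> identifies the
  two.\<close>

definition fine_diff :: "'a vsp \<Rightarrow> 'a param set" where
  "fine_diff W = {(n, U, p) \<in> params (carrier W).
    \<forall>u\<in>U. \<exists>N L. eopen n N \<and> u \<in> N \<and> N \<subseteq> U \<and> lc_on W n N L p}"

lemma lc_on_snd: "lc_on W n N L p \<Longrightarrow> snd ` set L \<subseteq> carrier W"
  by (auto simp: lc_on_def)

lemma lc_on_snd': "lc_on W n N L p \<Longrightarrow> snd ` set (map (apfst F) L) \<subseteq> carrier W"
  by (auto simp: lc_on_def)

lemma lc_on_coeff: "lc_on W n N L p \<Longrightarrow> (f, x) \<in> set L \<Longrightarrow> C_infinity n N f"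
  by (auto simp: lc_on_def)

lemma lc_on_eq: "lc_on W n N L p \<Longrightarrow> y \<in> N \<Longrightarrow> p y = lcomb W (map (apfst (\<lambda>f. f y)) L)"
  by (auto simp: lc_on_def)

lemma lc_on_cong: "lc_on W n N L p \<Longrightarrow> (\<And>y. y \<in> N \<Longrightarrow> p y = q y) \<Longrightarrow> lc_on W n N L q"
  by (auto simp: lc_on_def)

lemma lc_on_subset: "lc_on W n N L p \<Longrightarrow> M \<subseteq> N \<Longrightarrow> lc_on W n M L p"
  using C_infinity_subset by (fastforce simp: lc_on_def)

lemma lc_on_compose:
  assumes "eopen m V" "eopen n U" "smooth_map n U V f" "lc_on W m V L p"
  shows "lc_on W n U (map (apfst (\<lambda>g x. g (f x))) L) (\<lambda>x. p (f x))"
proof -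
  have "f x \<in> V" if "x \<in> U" for x using assms(3) that by (auto simp: smooth_map_def)
  then show ?thesis
    using assms(4) C_infinity_compose[OF assms(1-3) lc_on_coeff[OF assms(4)]]
    by (auto simp: lc_on_def o_def apfst_compose)
qed

lemma dvs_fine_diff:
  assumes W: "is_vsp W"
  shows "dvs W (fine_diff W)"
proof -
  interpret module real_ring W by (rule W)
  have "diffeology (carrier W) (fine_diff W)"
  proof
    show "fine_diff W \<subseteq> params (carrier W)" by (auto simp: fine_diff_def)
  next
    fix n U x assume "eopen n U" "x \<in> carrier W"
    moreover then have "lc_on W n U [(\<lambda>_. 1, x)] (\<lambda>u\<in>U. x)"
      by (simp add: lc_on_def C_infinity_const vsp_smult[OF W])
    ultimately show "(n, U, \<lambda>u\<in>U. x) \<in> fine_diff W"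
      by (auto simp: fine_diff_def params_iff)
  next
    fix n U p \<W>
    assume p: "(n, U, p) \<in> params (carrier W)" and cov: "open_cover n \<W> U"
      and w: "\<And>S. S \<in> \<W> \<Longrightarrow> (n, S, restrict p S) \<in> fine_diff W"
    have "\<exists>N L. eopen n N \<and> u \<in> N \<and> N \<subseteq> U \<and> lc_on W n N L p" if u: "u \<in> U" for u
    proof -
      obtain S where S: "S \<in> \<W>" "u \<in> S" "S \<subseteq> U" using cov u unfolding open_cover_def by blast
      obtain N L where "eopen n N" "u \<in> N" "N \<subseteq> S" "lc_on W n N L (restrict p S)"
        using w[OF S(1)] S(2) unfolding fine_diff_def by blast
      then show ?thesis
        using S(3) lc_on_cong[of W n N L "restrict p S" p] by (metis restrict_apply' subset_iff)
    qed
    then show "(n, U, p) \<in> fine_diff W" using p by (auto simp: fine_diff_def)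
  next
    fix n U p m V f
    assume p: "(n, U, p) \<in> fine_diff W" and V: "eopen m V" and f: "smooth_map m V U f"
    have U: "eopen n U" using p by (auto simp: fine_diff_def params_iff)
    have fU: "f v \<in> U" if "v \<in> V" for v using f that by (auto simp: smooth_map_def)
    have "\<exists>N L. eopen m N \<and> v \<in> N \<and> N \<subseteq> V \<and> lc_on W m N L (compose V p f)" if v: "v \<in> V" for v
    proof -
      obtain N L where N: "eopen n N" "f v \<in> N" "N \<subseteq> U" "lc_on W n N L p"
        using p fU[OF v] unfolding fine_diff_def by blast
      define M where "M = {x \<in> V. f x \<in> N}"
      have M: "eopen m M" unfolding M_def by (rule eopen_smooth_preimage[OF V U f N(1)])
      have fM: "smooth_map m M N f" by (rule smooth_map_restrict[OF f]) (auto simp: M_def)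
      have "lc_on W m M (map (apfst (\<lambda>g x. g (f x))) L) (compose V p f)"
        by (rule lc_on_cong[OF lc_on_compose[OF N(1) M fM N(4)]]) (auto simp: M_def compose_def)
      moreover have "v \<in> M" "M \<subseteq> V" using v N(2) by (auto simp: M_def)
      ultimately show ?thesis using M by blast
    qed
    then show "(m, V, compose V p f) \<in> fine_diff W"
      using p V fU by (auto simp: fine_diff_def params_iff compose_def)
  qed
  moreover have "(n, U, \<lambda>y\<in>U. p y \<oplus>\<^bsub>W\<^esub> q y) \<in> fine_diff W"
    if p: "(n, U, p) \<in> fine_diff W" and q: "(n, U, q) \<in> fine_diff W" for n U p q
  proof -
    have "\<exists>N L. eopen n N \<and> u \<in> N \<and> N \<subseteq> U \<and> lc_on W n N L (\<lambda>y\<in>U. p y \<oplus>\<^bsub>W\<^esub> q y)" if u: "u \<in> U" for u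
    proof -
      obtain N L where N: "eopen n N" "u \<in> N" "N \<subseteq> U" "lc_on W n N L p"
        using p u unfolding fine_diff_def by blast
      obtain M K where M: "eopen n M" "u \<in> M" "M \<subseteq> U" "lc_on W n M K q"
        using q u unfolding fine_diff_def by blast
      have L: "lc_on W n (N \<inter> M) L p" and K: "lc_on W n (N \<inter> M) K q"
        using N M lc_on_subset by blast+
      have "lc_on W n (N \<inter> M) (L @ K) (\<lambda>y\<in>U. p y \<oplus>\<^bsub>W\<^esub> q y)"
        using L K N(3) lcomb_append[OF W lc_on_snd'[OF L] lc_on_snd'[OF K]]
        unfolding lc_on_def by (auto simp: subset_iff)
      then show ?thesis using N M openin_Int[OF N(1) M(1)] by blast
    qed
    then show ?thesis using p q by (auto simp: fine_diff_def params_iff)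
  qed
  moreover have "(n, U, \<lambda>y\<in>U. f y \<odot>\<^bsub>W\<^esub> p y) \<in> fine_diff W"
    if f: "C_infinity n U f" and p: "(n, U, p) \<in> fine_diff W" for n U f p
  proof -
    have "\<exists>N L. eopen n N \<and> u \<in> N \<and> N \<subseteq> U \<and> lc_on W n N L (\<lambda>y\<in>U. f y \<odot>\<^bsub>W\<^esub> p y)" if u: "u \<in> U" for u
    proof -
      obtain N L where N: "eopen n N" "u \<in> N" "N \<subseteq> U" "lc_on W n N L p"
        using p u unfolding fine_diff_def by blast
      have "lc_on W n N (map (apfst (\<lambda>g y. f y * g y)) L) (\<lambda>y\<in>U. f y \<odot>\<^bsub>W\<^esub> p y)"
        using N C_infinity_mult[OF N(1) C_infinity_subset[OF f N(3)] lc_on_coeff[OF N(4)]]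
          lcomb_smult[OF W lc_on_snd[OF N(4)], symmetric]
        unfolding lc_on_def by (auto simp: subset_iff o_def apfst_compose)
      then show ?thesis using N by blast
    qed
    then show ?thesis using p by (auto simp: fine_diff_def params_iff vsp_smult(1)[OF W])
  qed
  ultimately show ?thesis unfolding dvs_iff using W by blast
qed

text \<open>A local combination is built from constant plots by smooth scalar multiples and sums,
  and every vector space diffeology is closed under these. Locality of plots then removes the
  restriction to a neighbourhood.\<close>

lemma fine_diff_least:
  assumes E: "dvs W E"
  shows "fine_diff W \<subseteq> E"
proof clarify
  fix n U p assume p: "(n, U, p) \<in> fine_diff W"
  note W = dvsD(1)[OF E] and D = dvsD(2)[OF E]
  interpret module real_ring W by (rule W)
  have lc: "(n, N, \<lambda>y\<in>N. lcomb W (map (apfst (\<lambda>f. f y)) L)) \<in> E"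
    if N: "eopen n N" and "\<And>f x. (f, x) \<in> set L \<Longrightarrow> C_infinity n N f \<and> x \<in> carrier W" for N L
    using that(2)
  proof (induction L)
    case Nil
    then show ?case
      using diffeology.plot_const[OF D N, of "\<zero>\<^bsub>W\<^esub>"] by (simp only: list.map lcomb.simps zero_closed)
  next
    case (Cons a L)
    obtain f x where a: "a = (f, x)" by fastforce
    have f: "C_infinity n N f" and x: "x \<in> carrier W" using Cons.prems[of f x] a by auto
    have C: "C_infinity n N f \<and> x \<in> carrier W" if "(f, x) \<in> set L" for f x
      using Cons.prems[of f x] that by simp
    have "(n, N, \<lambda>y\<in>N. f y \<odot>\<^bsub>W\<^esub> (\<lambda>u\<in>N. x) y) \<in> E"
      by (rule dvsD(4)[OF E f]) (rule diffeology.plot_const[OF D N x])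
    moreover have "(n, N, \<lambda>y\<in>N. lcomb W (map (apfst (\<lambda>f. f y)) L)) \<in> E"
      by (rule Cons.IH[OF C])
    ultimately have "(n, N, \<lambda>y\<in>N. (\<lambda>y\<in>N. f y \<odot>\<^bsub>W\<^esub> (\<lambda>u\<in>N. x) y) y \<oplus>\<^bsub>W\<^esub>
        (\<lambda>y\<in>N. lcomb W (map (apfst (\<lambda>f. f y)) L)) y) \<in> E"
      by (rule dvsD(3)[OF E])
    then show ?case by (simp add: a restrict_def cong: if_cong)
  qed
  show "(n, U, p) \<in> E"
  proof (rule plot_localI[OF D])
    show "(n, U, p) \<in> params (carrier W)" using p by (auto simp: fine_diff_def)
    fix u assume "u \<in> U"
    then obtain N L where N: "eopen n N" "u \<in> N" "N \<subseteq> U" "lc_on W n N L p"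
      using p unfolding fine_diff_def by blast
    have "(\<lambda>y\<in>N. lcomb W (map (apfst (\<lambda>f. f y)) L)) = restrict p N"
      using lc_on_eq[OF N(4)] by (auto simp: fun_eq_iff restrict_def)
    then have "(n, N, restrict p N) \<in> E"
      using lc[OF N(1), of L] N(4) by (auto simp: lc_on_def)
    then show "\<exists>N. eopen n N \<and> u \<in> N \<and> N \<subseteq> U \<and> (n, N, restrict p N) \<in> E" using N by blast
  qed
qed

lemma fine_dvs_iff: "fine_dvs V D \<longleftrightarrow> is_vsp V \<and> D = fine_diff V"
proof
  assume "fine_dvs V D"
  then show "is_vsp V \<and> D = fine_diff V"
    using dvs_fine_diff fine_diff_least dvsD(1) unfolding fine_dvs_def by blast
qed (use dvs_fine_diff fine_diff_least fine_dvs_def in blast)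

lemma fine_diff_linear_smooth:
  assumes "is_vsp V" "dvs W E" "linear_map V W j"
  shows "dsmooth (carrier V) (fine_diff V) (carrier W) E j"
  using fine_dvs_linear_smooth assms fine_dvs_iff by blast

text \<open>A local combination in \<open>W\<close> lifts to \<open>V\<close> by lifting its
  finitely many vectors and keeping its coefficients; the other inclusion is smoothness of
  \<open>r\<close>. Consequently a linear quotient of a fine space is fine, and maps out of it may
  be tested on \<open>V\<close>.\<close>

lemma fine_diff_quot:
  assumes "is_vsp V" "is_vsp W" "linear_map V W r" "r ` carrier V = carrier W"
  shows "quot_diff (fine_diff V) (carrier W) r = fine_diff W"
proof (intro equalityI subsetI; clarify)
  note DV = dvsD(2)[OF dvs_fine_diff[OF assms(1)]] and DW = dvsD(2)[OF dvs_fine_diff[OF assms(2)]]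
  fix n U p assume p: "(n, U, p) \<in> quot_diff (fine_diff V) (carrier W) r"
  have "dsmooth (carrier W) (quot_diff (fine_diff V) (carrier W) r) (carrier W) (fine_diff W) (\<lambda>x. x)"
    by (rule dsmooth_quot_lift[OF DV DW])
      (auto intro: fine_diff_linear_smooth[OF assms(1) dvs_fine_diff[OF assms(2)] assms(3)])
  then have "(n, U, compose U (\<lambda>x. x) p) \<in> fine_diff W" using p by (rule dsmoothD(2))
  moreover have "compose U (\<lambda>x. x) p = p"
    using p by (auto simp: quot_diff_iff params_iff compose_def intro!: extensionalityI[of _ U])
  ultimately show "(n, U, p) \<in> fine_diff W" by simp
next
  fix n U p assume p: "(n, U, p) \<in> fine_diff W"
  \<comment> \<open>A set-theoretic section is enough: it is applied to the vectors of a
    combination, never to the values of a plot, so neither linearity nor smoothness of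
    \<open>s\<close> enters.\<close>
  obtain s where s: "\<And>w. w \<in> carrier W \<Longrightarrow> s w \<in> carrier V \<and> r (s w) = w"
  proof (rule that[of "inv_into (carrier V) r"])
    fix w assume "w \<in> carrier W"
    then show "inv_into (carrier V) r w \<in> carrier V \<and> r (inv_into (carrier V) r w) = w"
      using inv_into_into[of w r "carrier V"] f_inv_into_f[of w r "carrier V"] assms(4) by simp
  qed
  have "\<exists>N f. eopen n N \<and> u \<in> N \<and> N \<subseteq> U \<and> (n, N, f) \<in> fine_diff V \<and> (\<forall>y\<in>N. p y = r (f y))"
    if u: "u \<in> U" for u
  proof -
    obtain N L where N: "eopen n N" "u \<in> N" "N \<subseteq> U" "lc_on W n N L p"
      using p u unfolding fine_diff_def by blast
    define f where "f = (\<lambda>y\<in>N. lcomb V (map (apfst (\<lambda>f. f y)) (map (apsnd s) L)))"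
    have sub: "snd ` set (map (apfst F) (map (apsnd s) L)) \<subseteq> carrier V" for F :: "_ \<Rightarrow> real"
      using lc_on_snd[OF N(4)] s by (fastforce simp: image_subset_iff)
    have f: "lc_on V n N (map (apsnd s) L) f"
      using N(4) s by (fastforce simp: lc_on_def f_def)
    moreover have "f y \<in> carrier V" if "y \<in> N" for y
      using lcomb_closed[OF assms(1) sub] that by (simp add: f_def del: map_map)
    ultimately have "(n, N, f) \<in> fine_diff V"
      using N(1) by (auto simp: fine_diff_def params_iff f_def)
    moreover have "p y = r (f y)" if y: "y \<in> N" for y
    proof -
      have "r (f y) = lcomb W (map (apsnd r) (map (apfst (\<lambda>f. f y)) (map (apsnd s) L)))"
        using lcomb_linear[OF assms(1-3) sub] y by (simp add: f_def del: map_map)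
      also have "map (apsnd r) (map (apfst (\<lambda>f. f y)) (map (apsnd s) L)) = map (apfst (\<lambda>f. f y)) L"
        using lc_on_snd[OF N(4)] s by (auto simp: image_subset_iff)
      finally show ?thesis using lc_on_eq[OF N(4) y] by simp
    qed
    ultimately show ?thesis using N by blast
  qed
  moreover have "(n, U, p) \<in> params (carrier W)" using p by (auto simp: fine_diff_def)
  ultimately show "(n, U, p) \<in> quot_diff (fine_diff V) (carrier W) r" unfolding quot_diff_iff by blast
qed

section \<open>Internal tangent spaces\<close>

lemma plots_at_iff: "(n, U, p) \<in> plots_at D x \<longleftrightarrow> (n, U, p) \<in> D \<and> origin \<in> U \<and> p origin = x"
  by (auto simp: plots_at_def)

lemma carrier_tan_sum: "s \<in> carrier (tan_sum D x) \<longleftrightarrow> finite {P. s P \<noteq> origin} \<and>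
    (\<forall>P. P \<notin> plots_at D x \<longrightarrow> s P = origin) \<and> (\<forall>P. s P \<in> Euc (fst P))"
  by (auto simp: tan_sum_def)

lemma tan_sum_ops:
  "\<zero>\<^bsub>tan_sum D x\<^esub> = (\<lambda>P i. 0)"
  "s \<oplus>\<^bsub>tan_sum D x\<^esub> t = (\<lambda>P i. s P i + t P i)"
  "a \<odot>\<^bsub>tan_sum D x\<^esub> s = (\<lambda>P i. a * s P i)"
  by (simp_all add: tan_sum_def)

lemma is_vsp_tan_sum: "is_vsp (tan_sum D x)"
proof (rule is_vspI)
  fix s t assume s: "s \<in> carrier (tan_sum D x)" and t: "t \<in> carrier (tan_sum D x)"
  have "{P. (s \<oplus>\<^bsub>tan_sum D x\<^esub> t) P \<noteq> origin} \<subseteq> {P. s P \<noteq> origin} \<union> {P. t P \<noteq> origin}"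
    by (auto simp: tan_sum_ops)
  then have "finite {P. (s \<oplus>\<^bsub>tan_sum D x\<^esub> t) P \<noteq> origin}"
    using s t finite_subset unfolding carrier_tan_sum by blast
  then show "s \<oplus>\<^bsub>tan_sum D x\<^esub> t \<in> carrier (tan_sum D x)"
    using s t by (simp add: carrier_tan_sum tan_sum_ops)
next
  fix a s assume s: "s \<in> carrier (tan_sum D x)"
  have "{P. (a \<odot>\<^bsub>tan_sum D x\<^esub> s) P \<noteq> origin} \<subseteq> {P. s P \<noteq> origin}"
    by (auto simp: tan_sum_ops)
  then have "finite {P. (a \<odot>\<^bsub>tan_sum D x\<^esub> s) P \<noteq> origin}"
    using s finite_subset unfolding carrier_tan_sum by blast
  then show "a \<odot>\<^bsub>tan_sum D x\<^esub> s \<in> carrier (tan_sum D x)"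
    using s by (simp add: carrier_tan_sum tan_sum_ops)
qed (auto simp: carrier_tan_sum tan_sum_ops algebra_simps)

lemma tan_single_closed:
  assumes "(n, U, p) \<in> plots_at D x" "v \<in> Euc n"
  shows "tan_single (n, U, p) v \<in> carrier (tan_sum D x)"
proof -
  have "{P. tan_single (n, U, p) v P \<noteq> origin} \<subseteq> {(n, U, p)}" by (auto simp: tan_single_def)
  then have "finite {P. tan_single (n, U, p) v P \<noteq> origin}" using finite_subset by blast
  then show ?thesis using assms by (auto simp: carrier_tan_sum tan_single_def)
qed

lemma tan_single_add:
  "tan_single P (\<lambda>i. v i + w i) = tan_single P v \<oplus>\<^bsub>tan_sum D x\<^esub> tan_single P w"
  by (auto simp: tan_single_def tan_sum_ops)

lemma tan_single_smult: "tan_single P (\<lambda>i. a * v i) = a \<odot>\<^bsub>tan_sum D x\<^esub> tan_single P v"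
  by (auto simp: tan_single_def tan_sum_ops)

lemma tan_sum_induct [consumes 1, case_names zero add]:
  assumes s: "s \<in> carrier (tan_sum D x)"
    and zero: "H \<zero>\<^bsub>tan_sum D x\<^esub>"
    and add: "\<And>n U p v s. (n, U, p) \<in> plots_at D x \<Longrightarrow> v \<in> Euc n \<Longrightarrow>
      s \<in> carrier (tan_sum D x) \<Longrightarrow> H s \<Longrightarrow> H (tan_single (n, U, p) v \<oplus>\<^bsub>tan_sum D x\<^esub> s)"
  shows "H s"
proof -
  have "finite {P. s P \<noteq> origin}" using s by (simp add: carrier_tan_sum)
  then show ?thesis
    using s
  proof (induction "{P. s P \<noteq> origin}" arbitrary: s rule: finite_psubset_induct)
    case (psubset s)
    show ?case
    proof (cases "\<forall>P. s P = origin")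
      case True
      then have "s = \<zero>\<^bsub>tan_sum D x\<^esub>" by (auto simp: tan_sum_ops)
      then show ?thesis using zero by simp
    next
      case False
      then obtain n U p where P: "s (n, U, p) \<noteq> origin" by auto
      define v where "v = s (n, U, p)"
      define t where "t = s((n, U, p) := origin)"
      have p: "(n, U, p) \<in> plots_at D x" and v: "v \<in> Euc n"
        using psubset.prems P unfolding carrier_tan_sum v_def by (metis, metis fst_conv)
      have supp: "{P. t P \<noteq> origin} = {P. s P \<noteq> origin} - {(n, U, p)}" by (auto simp: t_def)
      have t: "t \<in> carrier (tan_sum D x)"
        using psubset.prems unfolding carrier_tan_sum supp by (auto simp: t_def)
      have "{P. t P \<noteq> origin} \<subset> {P. s P \<noteq> origin}" using P unfolding supp by blast
      then have "H t" using psubset.hyps(2) t by blast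
      moreover have "s = tan_single (n, U, p) v \<oplus>\<^bsub>tan_sum D x\<^esub> t"
        by (intro ext) (simp add: tan_sum_ops tan_single_def t_def v_def)
      ultimately show ?thesis using add[OF p v t] by simp
    qed
  qed
qed

lemma tan_rel_generators_closed:
  "{tan_single (n, U, p) v \<ominus>\<^bsub>tan_sum D x\<^esub> tan_single (m, V, q) w | n U p v m V q w.
     (n, U, p) \<in> plots_at D x \<and> (m, V, q) \<in> plots_at D x \<and>
     v \<in> Euc n \<and> w \<in> Euc m \<and>
     (\<exists>f. smooth_map n U V f \<and> f origin = origin \<and> p = compose U q f \<and>
        differential n f origin v = w)} \<subseteq> carrier (tan_sum D x)"
proof -
  interpret module real_ring "tan_sum D x" by (rule is_vsp_tan_sum)
  show ?thesis by (clarify, intro minus_closed tan_single_closed)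
qed

lemma submodule_tan_rel: "submodule (tan_rel D x) real_ring (tan_sum D x)"
  unfolding tan_rel_def by (rule submodule_vspan[OF is_vsp_tan_sum tan_rel_generators_closed])

text \<open>The space of relations is a span, so its generators decide. Taking the zero subspace for
  \<open>S\<close> gives the criterion for a linear map on the direct sum to descend to the tangent
  space.\<close>

lemma tan_rel_linear:
  assumes W: "is_vsp W" "linear_map (tan_sum D x) W f" "submodule S real_ring W"
    and gen: "\<And>n U p v m V q g. (n, U, p) \<in> plots_at D x \<Longrightarrow> (m, V, q) \<in> plots_at D x \<Longrightarrow>
      v \<in> Euc n \<Longrightarrow> differential n g origin v \<in> Euc m \<Longrightarrow>
      smooth_map n U V g \<Longrightarrow> g origin = origin \<Longrightarrow> p = compose U q g \<Longrightarrow>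
      f (tan_single (n, U, p) v) \<ominus>\<^bsub>W\<^esub> f (tan_single (m, V, q) (differential n g origin v)) \<in> S"
    and s: "s \<in> tan_rel D x"
  shows "f s \<in> S"
proof (rule linear_map_vspan[OF is_vsp_tan_sum W tan_rel_generators_closed _ s[unfolded tan_rel_def]])
  fix s assume "s \<in> {tan_single (n, U, p) v \<ominus>\<^bsub>tan_sum D x\<^esub> tan_single (m, V, q) w | n U p v m V q w.
     (n, U, p) \<in> plots_at D x \<and> (m, V, q) \<in> plots_at D x \<and>
     v \<in> Euc n \<and> w \<in> Euc m \<and>
     (\<exists>f. smooth_map n U V f \<and> f origin = origin \<and> p = compose U q f \<and>
        differential n f origin v = w)}"
  then obtain n U p v m V q g where
    s: "s = tan_single (n, U, p) v \<ominus>\<^bsub>tan_sum D x\<^esub> tan_single (m, V, q) (differential n g origin v)"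
    and *: "(n, U, p) \<in> plots_at D x" "(m, V, q) \<in> plots_at D x"
     "v \<in> Euc n" "differential n g origin v \<in> Euc m"
     "smooth_map n U V g" "g origin = origin" "p = compose U q g"
    by blast
  show "f s \<in> S"
    unfolding s linear_map_minus[OF is_vsp_tan_sum W(1,2) tan_single_closed[OF *(1,3)] tan_single_closed[OF *(2,4)]]
    by (rule gen[OF *])
qed

lemma is_vsp_tan_space: "is_vsp (tan_space D x)"
  unfolding tan_space_def by (rule is_vsp_quot_vsp[OF is_vsp_tan_sum submodule_tan_rel])

lemma carrier_tan_space:
  "carrier (tan_space D x) = (\<lambda>s. tan_rel D x +>\<^bsub>tan_sum D x\<^esub> s) ` carrier (tan_sum D x)"
  unfolding tan_space_def by (rule carrier_quot_vsp[OF is_vsp_tan_sum submodule_tan_rel])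

lemma linear_map_tan_coset:
  "linear_map (tan_sum D x) (tan_space D x) (\<lambda>s. tan_rel D x +>\<^bsub>tan_sum D x\<^esub> s)"
  unfolding tan_space_def by (rule linear_map_coset[OF is_vsp_tan_sum submodule_tan_rel])

lemma tan_class_closed:
  "(n, U, p) \<in> plots_at D x \<Longrightarrow> v \<in> Euc n \<Longrightarrow>
    tan_class D x (n, U, p) v \<in> carrier (tan_space D x)"
  unfolding tan_class_def carrier_tan_space by (intro imageI tan_single_closed)

lemma tan_class_add:
  assumes "(n, U, p) \<in> plots_at D x" "v \<in> Euc n" "w \<in> Euc n"
  shows "tan_class D x (n, U, p) (\<lambda>i. v i + w i) =
    tan_class D x (n, U, p) v \<oplus>\<^bsub>tan_space D x\<^esub> tan_class D x (n, U, p) w"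
  unfolding tan_class_def tan_single_add[of "(n, U, p)" v w D x]
  by (intro linear_mapD(2)[OF linear_map_tan_coset] tan_single_closed assms)

lemma tan_class_smult:
  assumes "(n, U, p) \<in> plots_at D x" "v \<in> Euc n"
  shows "tan_class D x (n, U, p) (\<lambda>i. a * v i) = a \<odot>\<^bsub>tan_space D x\<^esub> tan_class D x (n, U, p) v"
  unfolding tan_class_def tan_single_smult[of "(n, U, p)" a v D x]
  by (intro linear_mapD(3)[OF linear_map_tan_coset] tan_single_closed assms)

lemma tan_class_eq:
  assumes "(n, U, p) \<in> plots_at D x" "(m, V, q) \<in> plots_at D x"
    "v \<in> Euc n" "differential n f origin v \<in> Euc m"
    "smooth_map n U V f" "f origin = origin" "p = compose U q f"
  shows "tan_class D x (n, U, p) v = tan_class D x (m, V, q) (differential n f origin v)"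
  unfolding tan_class_def
proof (subst coset_eq_iff[OF is_vsp_tan_sum submodule_tan_rel])
  show "tan_single (n, U, p) v \<ominus>\<^bsub>tan_sum D x\<^esub> tan_single (m, V, q) (differential n f origin v) \<in> tan_rel D x"
    unfolding tan_rel_def by (rule subsetD[OF vspan_superset]) (use assms in blast)
qed (use assms tan_single_closed in auto)

lemma tan_space_induct [consumes 1, case_names zero add]:
  assumes \<xi>: "\<xi> \<in> carrier (tan_space D x)"
    and zero: "H \<zero>\<^bsub>tan_space D x\<^esub>"
    and add: "\<And>n U p v \<xi>. (n, U, p) \<in> plots_at D x \<Longrightarrow> v \<in> Euc n \<Longrightarrow>
      \<xi> \<in> carrier (tan_space D x) \<Longrightarrow> H \<xi> \<Longrightarrow> H (tan_class D x (n, U, p) v \<oplus>\<^bsub>tan_space D x\<^esub> \<xi>)"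
  shows "H \<xi>"
proof -
  obtain s where s: "s \<in> carrier (tan_sum D x)" "\<xi> = tan_rel D x +>\<^bsub>tan_sum D x\<^esub> s"
    using \<xi> by (auto simp: carrier_tan_space)
  from s(1) have "H (tan_rel D x +>\<^bsub>tan_sum D x\<^esub> s)"
  proof (induction rule: tan_sum_induct)
    case zero
    then show ?case
      using assms(2) by (simp only: linear_map_zero[OF is_vsp_tan_sum is_vsp_tan_space linear_map_tan_coset])
  next
    case (add n U p v s)
    have "H (tan_class D x (n, U, p) v \<oplus>\<^bsub>tan_space D x\<^esub> (tan_rel D x +>\<^bsub>tan_sum D x\<^esub> s))"
      using add by (intro assms(3)) (auto simp: carrier_tan_space)
    then show ?case
      using linear_mapD(2)[OF linear_map_tan_coset tan_single_closed[OF add(1,2)] add(3)]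
      by (simp add: tan_class_def)
  qed
  then show ?thesis using s(2) by simp
qed

text \<open>\<open>tan_push\<close> sums over the support of \<open>s\<close>, which changes under
  addition and scaling. Over a common finite index set linearity becomes a termwise
  identity.\<close>

lemma tan_push_superset:
  assumes "finite A" "{P. s P \<noteq> origin} \<subseteq> A"
  shows "tan_push f s Q i = (\<Sum>P\<in>A. if param_map f P = Q then s P i else 0)"
proof -
  have "(\<Sum>P \<in> {P. s P \<noteq> origin \<and> param_map f P = Q}. s P i) =
      (\<Sum>P \<in> {P \<in> A. param_map f P = Q}. s P i)"
    using assms by (intro sum.mono_neutral_left) auto
  also have "\<dots> = (\<Sum>P\<in>A. if param_map f P = Q then s P i else 0)"
    using sum.inter_filter[OF assms(1)] by fast
  finally show ?thesis by (simp add: tan_push_def)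
qed

lemma tan_push_single: "tan_push f (tan_single P v) = tan_single (param_map f P) v"
proof (intro ext)
  fix Q i
  show "tan_push f (tan_single P v) Q i = tan_single (param_map f P) v Q i"
    by (subst tan_push_superset[of "{P}"]) (auto simp: tan_single_def)
qed

lemma param_map_plots_at:
  assumes "dsmooth X D Y E f" "(n, U, p) \<in> plots_at D x"
  shows "param_map f (n, U, p) \<in> plots_at E (f x)"
  using assms dsmoothD(2)[OF assms(1)] by (auto simp: param_map_def plots_at_iff compose_def)

lemma linear_map_tan_push:
  assumes f: "dsmooth X D Y E f"
  shows "linear_map (tan_sum D x) (tan_sum E (f x)) (tan_push f)"
proof -
  have push_add: "tan_push f (s \<oplus>\<^bsub>tan_sum D x\<^esub> t) = tan_push f s \<oplus>\<^bsub>tan_sum E (f x)\<^esub> tan_push f t"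
    if s: "s \<in> carrier (tan_sum D x)" and t: "t \<in> carrier (tan_sum D x)" for s t
  proof (intro ext)
    fix Q i
    define A where "A = {P. s P \<noteq> origin} \<union> {P. t P \<noteq> origin}"
    have A: "finite A" using s t by (auto simp: A_def carrier_tan_sum)
    have "tan_push f (\<lambda>P i. s P i + t P i) Q i =
        (\<Sum>P\<in>A. if param_map f P = Q then s P i + t P i else 0)"
      by (rule tan_push_superset[OF A]) (auto simp: A_def)
    also have "\<dots> = (\<Sum>P\<in>A. (if param_map f P = Q then s P i else 0) + (if param_map f P = Q then t P i else 0))"
      by (intro sum.cong) auto
    also have "\<dots> = tan_push f s Q i + tan_push f t Q i"
      unfolding sum.distrib by (subst (1 2) tan_push_superset[OF A]) (auto simp: A_def)
    finally show "tan_push f (s \<oplus>\<^bsub>tan_sum D x\<^esub> t) Q i = (tan_push f s \<oplus>\<^bsub>tan_sum E (f x)\<^esub> tan_push f t) Q i"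
      by (simp add: tan_sum_ops)
  qed
  have smult: "tan_push f (a \<odot>\<^bsub>tan_sum D x\<^esub> s) = a \<odot>\<^bsub>tan_sum E (f x)\<^esub> tan_push f s"
    if s: "s \<in> carrier (tan_sum D x)" for a s
  proof (intro ext)
    fix Q i
    have A: "finite {P. s P \<noteq> origin}" using s by (auto simp: carrier_tan_sum)
    have "tan_push f (\<lambda>P i. a * s P i) Q i =
        (\<Sum>P\<in>{P. s P \<noteq> origin}. if param_map f P = Q then a * s P i else 0)"
      by (rule tan_push_superset[OF A]) auto
    also have "\<dots> = (\<Sum>P\<in>{P. s P \<noteq> origin}. a * (if param_map f P = Q then s P i else 0))"
      by (intro sum.cong) auto
    also have "\<dots> = a * tan_push f s Q i"
      unfolding sum_distrib_left[symmetric] by (subst tan_push_superset[OF A]) auto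
    finally show "tan_push f (a \<odot>\<^bsub>tan_sum D x\<^esub> s) Q i = (a \<odot>\<^bsub>tan_sum E (f x)\<^esub> tan_push f s) Q i"
      by (simp add: tan_sum_ops)
  qed
  have "tan_push f s \<in> carrier (tan_sum E (f x))" if "s \<in> carrier (tan_sum D x)" for s
    using that
  proof (induction rule: tan_sum_induct)
    case zero
    have "tan_push f \<zero>\<^bsub>tan_sum D x\<^esub> = \<zero>\<^bsub>tan_sum E (f x)\<^esub>" by (simp add: tan_push_def tan_sum_ops)
    then show ?case by (simp add: carrier_tan_sum tan_sum_ops)
  next
    case (add n U p v s)
    interpret module real_ring "tan_sum E (f x)" by (rule is_vsp_tan_sum)
    have "tan_single (param_map f (n, U, p)) v \<in> carrier (tan_sum E (f x))"
      using tan_single_closed[of n U "compose U f p"] param_map_plots_at[OF f add(1)] add(2)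
      by (simp add: param_map_def)
    then show ?case
      unfolding push_add[OF tan_single_closed[OF add(1,2)] add(3)] tan_push_single
      using add(4) by blast
  qed
  then show ?thesis using push_add smult by (auto simp: linear_map_def)
qed

lemma linear_map_tan_push_class:
  assumes f: "dsmooth X D Y E f"
  shows "linear_map (tan_sum D x) (tan_space E (f x))
    (\<lambda>s. tan_rel E (f x) +>\<^bsub>tan_sum E (f x)\<^esub> tan_push f s)"
  by (rule linear_map_compose[OF linear_map_tan_push[OF f] linear_map_tan_coset])

text \<open>If \<open>p\<close> is \<open>q\<close> after \<open>g\<close>, then \<open>f\<close>
  after \<open>p\<close> is \<open>f\<close> after \<open>q\<close> after the same \<open>g\<close>,
  so generators of the relations go to generators.\<close>

lemma tan_push_rel:
  assumes f: "dsmooth X D Y E f" and s: "s \<in> tan_rel D x"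
  shows "tan_rel E (f x) +>\<^bsub>tan_sum E (f x)\<^esub> tan_push f s = \<zero>\<^bsub>tan_space E (f x)\<^esub>"
proof -
  interpret T: module real_ring "tan_space E (f x)" by (rule is_vsp_tan_space)
  have "tan_rel E (f x) +>\<^bsub>tan_sum E (f x)\<^esub> tan_push f s \<in> {\<zero>\<^bsub>tan_space E (f x)\<^esub>}"
  proof (rule tan_rel_linear[OF is_vsp_tan_space linear_map_tan_push_class[OF f]
        submodule_zero[OF is_vsp_tan_space] _ s])
    fix n U p v m V q g
    assume *: "(n, U, p) \<in> plots_at D x" "(m, V, q) \<in> plots_at D x"
      "v \<in> Euc n" "differential n g origin v \<in> Euc m"
      "smooth_map n U V g" "g origin = origin" "p = compose U q g"
    have n: "(n, U, compose U f p) \<in> plots_at E (f x)" and m: "(m, V, compose V f q) \<in> plots_at E (f x)"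
      using param_map_plots_at[OF f] *(1,2) by (auto simp: param_map_def)
    have "compose U f p = compose U (compose V f q) g"
      using *(5,7) by (auto simp: compose_def smooth_map_def fun_eq_iff)
    then have "tan_class E (f x) (n, U, compose U f p) v =
        tan_class E (f x) (m, V, compose V f q) (differential n g origin v)"
      by (intro tan_class_eq[OF n m *(3,4,5,6)])
    then show "(tan_rel E (f x) +>\<^bsub>tan_sum E (f x)\<^esub> tan_push f (tan_single (n, U, p) v)) \<ominus>\<^bsub>tan_space E (f x)\<^esub>
      (tan_rel E (f x) +>\<^bsub>tan_sum E (f x)\<^esub> tan_push f (tan_single (m, V, q) (differential n g origin v)))
      \<in> {\<zero>\<^bsub>tan_space E (f x)\<^esub>}"
      using tan_class_closed[OF m *(4)]
      by (simp add: tan_push_single param_map_def tan_class_def a_minus_def T.r_neg)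
  qed
  then show ?thesis by simp
qed

lemma tan_map_coset_lift:
  "tan_map D E f x = coset_lift (\<lambda>s. tan_rel E (f x) +>\<^bsub>tan_sum E (f x)\<^esub> tan_push f s)"
  by (rule ext) (simp add: tan_map_def coset_lift_def)

lemma tan_map_class:
  assumes f: "dsmooth X D Y E f" and "(n, U, p) \<in> plots_at D x" "v \<in> Euc n"
  shows "tan_map D E f x (tan_class D x (n, U, p) v) = tan_class E (f x) (n, U, compose U f p) v"
  unfolding tan_map_coset_lift
  by (subst tan_class_def,
      subst coset_lift_coset[OF is_vsp_tan_sum is_vsp_tan_space submodule_tan_rel
        linear_map_tan_push_class[OF f] tan_push_rel[OF f] tan_single_closed[OF assms(2,3)]])
    (simp_all add: tan_class_def tan_push_single param_map_def)

section \<open>Derivatives of plots of fine vector spaces\<close>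

definition dirderiv :: "nat \<Rightarrow> ((nat \<Rightarrow> real) \<Rightarrow> real) \<Rightarrow> (nat \<Rightarrow> real) \<Rightarrow> (nat \<Rightarrow> real) \<Rightarrow> real" where
  "dirderiv n f u v = (\<Sum>i<n. partial i f u * v i)"

lemma C_infinity_differentiable:
  "C_infinity n U g \<Longrightarrow> i < n \<Longrightarrow> x \<in> U \<Longrightarrow> (\<lambda>t. g (x(i := t))) differentiable (at (x i))"
  by (erule C_infinity.cases) simp

lemma C_infinity_Ck1: "C_infinity n U g \<Longrightarrow> Ck (Suc 0) n U g"
  by (simp only: C_infinity_iff_Ck)

lemma eventually_line_in:
  assumes N: "eopen n N" "u \<in> N" "v \<in> Euc n"
  shows "\<forall>\<^sub>F t in nhds 0. (\<lambda>i. u i + t * v i) \<in> N"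
proof -
  have u: "u i = 0" if "i \<ge> n" for i using eopen_support[OF N(1,2) that] .
  have c: "continuous_on UNIV (\<lambda>(t::real) i. u i + t * v i)"
    by (intro continuous_on_coordinatewise_then_product continuous_intros)
  obtain T where T: "open T" "N = T \<inter> Euc n"
    using N(1)[unfolded eopen_iff] by metis
  have "open ((\<lambda>t i. u i + t * v i) -` T)"
    using c T(1) by (simp add: continuous_on_open_vimage)
  moreover have "0 \<in> (\<lambda>t i. u i + t * v i) -` T" using N(2) T(2) by simp
  ultimately have "\<forall>\<^sub>F t in nhds 0. t \<in> (\<lambda>t i. u i + t * v i) -` T"
    by (rule eventually_nhds_in_open)
  then show ?thesis
    by (rule eventually_mono) (use T(2) u N(3) in simp)
qed

lemma has_derivative_along_line:
  assumes N: "eopen n N" "u \<in> N" "v \<in> Euc n" and f: "C_infinity n N f"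
  shows "((\<lambda>t. f (\<lambda>i. u i + t * v i)) has_real_derivative dirderiv n f u v) (at 0)"
proof -
  have "((\<lambda>t. f (\<lambda>i. u i + t * v i)) has_real_derivative
      (\<Sum>j<n. partial j f (\<lambda>i. u i + 0 * v i) * v j)) (at 0)"
  proof (rule has_derivative_along_curve[OF N(1)])
    show "\<forall>\<^sub>F t in at 0. (\<lambda>i. u i + t * v i) \<in> N"
      using eventually_line_in[OF N] eventually_nhds_conv_at by blast
    show "((\<lambda>t. u j + t * v j) has_real_derivative v j) (at 0)" for j
      by (auto intro!: derivative_eq_intros)
  qed (use N f C_infinity_differentiable[OF f] C_infinity_continuous[OF C_infinity_partial[OF f]] in \<open>auto simp del: fun_upd_apply\<close>)
  then show ?thesis by (simp add: dirderiv_def)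
qed

lemma dirderiv_compose:
  assumes V: "eopen m V" and U: "eopen n U" and f: "smooth_map n U V f" and g: "C_infinity m V g"
    and x: "x \<in> U"
  shows "dirderiv n (\<lambda>y. g (f y)) x v = dirderiv m g (f x) (differential n f x v)"
proof -
  have fUV: "f \<in> U \<rightarrow> V" and fC: "C_infinity n U (\<lambda>x. f x j)" for j using f by (auto simp: smooth_map_def)
  have "partial i (\<lambda>y. g (f y)) x = (\<Sum>j<m. partial j g (f x) * partial i (\<lambda>y. f y j) x)"
    if "i < n" for i
    by (intro partial_eqI partial_compose[OF V U fUV] C_infinity_Ck1 g fC x that)
  then have "dirderiv n (\<lambda>y. g (f y)) x v =
      (\<Sum>i<n. \<Sum>j<m. partial j g (f x) * (partial i (\<lambda>y. f y j) x * v i))"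
    by (simp add: dirderiv_def sum_distrib_right mult.assoc)
  also have "\<dots> = (\<Sum>j<m. \<Sum>i<n. partial j g (f x) * (partial i (\<lambda>y. f y j) x * v i))"
    by (rule sum.swap)
  finally show ?thesis
    by (simp add: dirderiv_def differential_def sum_distrib_left)
qed

text \<open>The derivative is read off any local presentation of \<open>p\<close>. Nothing forces
  the vectors of a presentation to be independent or distinct, so the description is justified only
  by \<open>lcomb_dirderiv_unique\<close>.\<close>

definition fine_deriv :: "'a vsp \<Rightarrow> nat \<Rightarrow> ((nat \<Rightarrow> real) \<Rightarrow> 'a) \<Rightarrow> (nat \<Rightarrow> real) \<Rightarrow> (nat \<Rightarrow> real) \<Rightarrow> 'a" where
  "fine_deriv W n p u v = (THE w. \<exists>N L. eopen n N \<and> u \<in> N \<and> lc_on W n N L p \<and>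
     w = lcomb W (map (apfst (\<lambda>f. dirderiv n f u v)) L))"

text \<open>The difference of the two presentations, restricted to the line
  \<open>t \<mapsto> u + t v\<close>, is a combination with coefficients in one variable that
  vanishes for \<open>t\<close> near \<open>0\<close>. By \<open>lcomb_deriv_zero\<close> the
  combination of the derivatives vanishes too. The list \<open>J\<close> encodes the difference,
  with the factor \<open>-1\<close> placed in the second block of coefficients.\<close>

lemma lcomb_dirderiv_unique:
  assumes W: "is_vsp W" and v: "v \<in> Euc n"
    and N: "eopen n N" "u \<in> N" "lc_on W n N L p" and M: "eopen n M" "u \<in> M" "lc_on W n M K p"
  shows "lcomb W (map (apfst (\<lambda>f. dirderiv n f u v)) L) = lcomb W (map (apfst (\<lambda>f. dirderiv n f u v)) K)"
proof -
  interpret module real_ring W by (rule W)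
  define c where "c = (\<lambda>t i. u i + t * v i)"
  define J where "J = map (apfst (\<lambda>f t. f (c t))) L @ map (apfst (\<lambda>f t. (-1) * f (c t))) K"
  have closed: "lcomb W (map (apfst F) L) \<in> carrier W" "lcomb W (map (apfst F) K) \<in> carrier W" for F
    using lcomb_closed[OF W] lc_on_snd'[OF N(3)] lc_on_snd'[OF M(3)] by blast+
  have J: "lcomb W (map (apfst F) J) = lcomb W (map (apfst (\<lambda>f. F (\<lambda>t. f (c t)))) L) \<oplus>\<^bsub>W\<^esub>
      lcomb W (map (apfst (\<lambda>f. F (\<lambda>t. (-1) * f (c t)))) K)" for F
    unfolding J_def map_append
    by (subst lcomb_append[OF W])
      (use lc_on_snd[OF N(3)] lc_on_snd[OF M(3)] in \<open>auto simp: o_def apfst_compose image_subset_iff\<close>)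
  have J': "lcomb W (map (apfst F) J) = lcomb W (map (apfst (\<lambda>f. F (\<lambda>t. f (c t)))) L) \<ominus>\<^bsub>W\<^esub>
      lcomb W (map (apfst G) K)"
    if "\<And>f x. (f, x) \<in> set K \<Longrightarrow> F (\<lambda>t. (-1) * f (c t)) = (-1) * G f" for F G
  proof -
    have K: "map (apfst (\<lambda>f. F (\<lambda>t. (-1) * f (c t)))) K = map (apfst (\<lambda>f. (-1) * G f)) K"
      using that by auto
    have "lcomb W (map (apfst (\<lambda>f. F (\<lambda>t. (-1) * f (c t)))) K) = (-1) \<odot>\<^bsub>W\<^esub> lcomb W (map (apfst G) K)"
      unfolding K by (rule lcomb_smult[OF W lc_on_snd[OF M(3)]])
    then show ?thesis using J[of F] vsp_minus[OF W closed(1) closed(2)] by simp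
  qed
  have dL: "((\<lambda>t. f (c t)) has_real_derivative dirderiv n f u v) (at 0)" if "(f, x) \<in> set L" for f x
    unfolding c_def by (rule has_derivative_along_line[OF N(1,2) v lc_on_coeff[OF N(3) that]])
  have dK: "((\<lambda>t. f (c t)) has_real_derivative dirderiv n f u v) (at 0)" if "(f, x) \<in> set K" for f x
    unfolding c_def by (rule has_derivative_along_line[OF M(1,2) v lc_on_coeff[OF M(3) that]])
  have "lcomb W (map (apfst (\<lambda>f. deriv f 0)) J) = \<zero>\<^bsub>W\<^esub>"
  proof (rule lcomb_deriv_zero[OF W])
    show "snd ` set J \<subseteq> carrier W"
      using lc_on_snd[OF N(3)] lc_on_snd[OF M(3)] by (auto simp: J_def image_subset_iff)
    show "f differentiable at 0" if "(f, x) \<in> set J" for f x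
    proof -
      have "\<exists>g. (g, x) \<in> set L \<and> f = (\<lambda>t. g (c t)) \<or> (g, x) \<in> set K \<and> f = (\<lambda>t. (-1) * g (c t))"
        using that by (auto simp: J_def)
      then show ?thesis
        using dL dK DERIV_cmult[of "\<lambda>t. g (c t)" _ 0 UNIV "-1" for g]
        unfolding real_differentiable_def by metis
    qed
    have "\<forall>\<^sub>F t in nhds 0. c t \<in> N \<and> c t \<in> M"
      unfolding c_def by (intro eventually_conj eventually_line_in[OF N(1,2) v] eventually_line_in[OF M(1,2) v])
    then show "\<forall>\<^sub>F t in nhds 0. lcomb W (map (apfst (\<lambda>f. f t)) J) = \<zero>\<^bsub>W\<^esub>"
    proof (rule eventually_mono)
      fix t assume t: "c t \<in> N \<and> c t \<in> M"
      have "lcomb W (map (apfst (\<lambda>f. f (c t))) L) = lcomb W (map (apfst (\<lambda>f. f (c t))) K)"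
        using lc_on_eq[OF N(3)] lc_on_eq[OF M(3)] t by metis
      then show "lcomb W (map (apfst (\<lambda>f. f t)) J) = \<zero>\<^bsub>W\<^esub>"
        using J'[of "\<lambda>f. f t" "\<lambda>f. f (c t)"] closed by (simp add: a_minus_def r_neg)
    qed
  qed
  moreover have "deriv (\<lambda>t. (-1) * f (c t)) 0 = (-1) * dirderiv n f u v" if "(f, x) \<in> set K" for f x
    by (rule DERIV_imp_deriv[OF DERIV_cmult[OF dK[OF that]]])
  ultimately have "lcomb W (map (apfst (\<lambda>f. deriv (\<lambda>t. f (c t)) 0)) L) \<ominus>\<^bsub>W\<^esub>
      lcomb W (map (apfst (\<lambda>f. dirderiv n f u v)) K) = \<zero>\<^bsub>W\<^esub>"
    using J'[of "\<lambda>f. deriv f 0" "\<lambda>f. dirderiv n f u v"] by simp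
  moreover have "map (apfst (\<lambda>f. deriv (\<lambda>t. f (c t)) 0)) L = map (apfst (\<lambda>f. dirderiv n f u v)) L"
    using DERIV_imp_deriv[OF dL] by auto
  ultimately show ?thesis
    using closed minus_equality[of "lcomb W (map (apfst (\<lambda>f. dirderiv n f u v)) L)"
        "\<ominus>\<^bsub>W\<^esub> lcomb W (map (apfst (\<lambda>f. dirderiv n f u v)) K)"]
    by (simp add: a_minus_def)
qed

lemma fine_deriv_eq:
  assumes "is_vsp W" "v \<in> Euc n" "eopen n N" "u \<in> N" "lc_on W n N L p"
  shows "fine_deriv W n p u v = lcomb W (map (apfst (\<lambda>f. dirderiv n f u v)) L)"
  unfolding fine_deriv_def
  by (rule the_equality) (use assms lcomb_dirderiv_unique in blast)+

lemma fine_diffE: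
  assumes "(n, U, p) \<in> fine_diff W" "u \<in> U"
  obtains N L where "eopen n N" "u \<in> N" "N \<subseteq> U" "lc_on W n N L p"
  using assms unfolding fine_diff_def by blast

lemma fine_deriv_closed:
  assumes W: "is_vsp W" and p: "(n, U, p) \<in> fine_diff W" "u \<in> U" "v \<in> Euc n"
  shows "fine_deriv W n p u v \<in> carrier W"
proof -
  obtain N L where N: "eopen n N" "u \<in> N" "N \<subseteq> U" "lc_on W n N L p" using fine_diffE[OF p(1,2)] .
  show ?thesis
    unfolding fine_deriv_eq[OF W p(3) N(1,2,4)] by (rule lcomb_closed[OF W lc_on_snd'[OF N(4)]])
qed

lemma fine_deriv_add:
  assumes W: "is_vsp W" and p: "(n, U, p) \<in> fine_diff W" "u \<in> U"
    and v: "v \<in> Euc n" "w \<in> Euc n"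
  shows "fine_deriv W n p u (\<lambda>i. v i + w i) = fine_deriv W n p u v \<oplus>\<^bsub>W\<^esub> fine_deriv W n p u w"
proof -
  obtain N L where N: "eopen n N" "u \<in> N" "N \<subseteq> U" "lc_on W n N L p" using fine_diffE[OF p] .
  have vw: "(\<lambda>i. v i + w i) \<in> Euc n" using v by simp
  have "dirderiv n f u (\<lambda>i. v i + w i) = dirderiv n f u v + dirderiv n f u w" for f
    by (simp add: dirderiv_def algebra_simps sum.distrib)
  then show ?thesis
    using lcomb_add[OF W lc_on_snd[OF N(4)], of "\<lambda>f. dirderiv n f u v" "\<lambda>f. dirderiv n f u w"]
    by (simp add: fine_deriv_eq[OF W _ N(1,2,4)] vw v del: topspace_Euc)
qed

lemma fine_deriv_smult:
  assumes W: "is_vsp W" and p: "(n, U, p) \<in> fine_diff W" "u \<in> U"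
    and v: "v \<in> Euc n"
  shows "fine_deriv W n p u (\<lambda>i. a * v i) = a \<odot>\<^bsub>W\<^esub> fine_deriv W n p u v"
proof -
  obtain N L where N: "eopen n N" "u \<in> N" "N \<subseteq> U" "lc_on W n N L p" using fine_diffE[OF p] .
  have av: "(\<lambda>i. a * v i) \<in> Euc n" using v by simp
  have "dirderiv n f u (\<lambda>i. a * v i) = a * dirderiv n f u v" for f
    by (simp add: dirderiv_def sum_distrib_left algebra_simps)
  then show ?thesis
    using lcomb_smult[OF W lc_on_snd[OF N(4)], of a "\<lambda>f. dirderiv n f u v"]
    by (simp add: fine_deriv_eq[OF W _ N(1,2,4)] av v del: topspace_Euc)
qed

text \<open>Composing a presentation of \<open>q\<close> near \<open>f u\<close> with
  \<open>f\<close> presents \<open>p\<close> near \<open>u\<close> by the same vectors, so the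
  scalar chain rule applies to each coefficient.\<close>

lemma fine_deriv_compose:
  assumes W: "is_vsp W" and q: "(m, V, q) \<in> fine_diff W" and V: "eopen m V" and U: "eopen n U" and f: "smooth_map n U V f"
    and p: "\<And>y. y \<in> U \<Longrightarrow> p y = q (f y)" and u: "u \<in> U" and v: "v \<in> Euc n"
    and dv: "differential n f u v \<in> Euc m"
  shows "fine_deriv W n p u v = fine_deriv W m q (f u) (differential n f u v)"
proof -
  have "f u \<in> V" using f u by (auto simp: smooth_map_def)
  then obtain N L where N: "eopen m N" "f u \<in> N" "N \<subseteq> V" "lc_on W m N L q" using fine_diffE[OF q] by blast
  define M where "M = {x \<in> U. f x \<in> N}"
  have M: "eopen n M" unfolding M_def by (rule eopen_smooth_preimage[OF U V f N(1)])
  have uM: "u \<in> M" using u N(2) by (simp add: M_def)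
  have fM: "smooth_map n M N f" by (rule smooth_map_restrict[OF f]) (auto simp: M_def)
  have L: "lc_on W n M (map (apfst (\<lambda>g x. g (f x))) L) p"
    by (rule lc_on_cong[OF lc_on_compose[OF N(1) M fM N(4)]]) (simp add: p M_def)
  have "dirderiv n (\<lambda>x. g (f x)) u v = dirderiv m g (f u) (differential n f u v)" if "(g, x) \<in> set L" for g x
    by (rule dirderiv_compose[OF N(1) M fM lc_on_coeff[OF N(4) that] uM])
  then have "map (apfst (\<lambda>f. dirderiv n f u v)) (map (apfst (\<lambda>g x. g (f x))) L) =
      map (apfst (\<lambda>g. dirderiv m g (f u) (differential n f u v))) L"
    by auto
  then show ?thesis
    by (simp only: fine_deriv_eq[OF W v M uM L] fine_deriv_eq[OF W dv N(1,2,4)])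
qed

section \<open>Joint dependence of derivatives on base point and vector\<close>

lemma eopen_tangent:
  assumes "eopen n U"
  shows "eopen (2 * n) {z \<in> Euc (2 * n). base_part n z \<in> U}"
    and "smooth_map (2 * n) {z \<in> Euc (2 * n). base_part n z \<in> U} U (base_part n)"
proof -
  have s: "smooth_map (2 * n) A (Euc n) (base_part n)" for A
    unfolding smooth_map_def
  proof (intro conjI allI)
    show "base_part n \<in> A \<rightarrow> Euc n" by (auto simp: base_part_def)
    show "C_infinity (2 * n) A (\<lambda>x. base_part n x j)" for j
      by (cases "j < n") (simp_all add: base_part_def C_infinity_coord C_infinity_const)
  qed
  show "eopen (2 * n) {z \<in> Euc (2 * n). base_part n z \<in> U}"
    by (rule eopen_smooth_preimage[OF eopen_space eopen_space s assms])
  show "smooth_map (2 * n) {z \<in> Euc (2 * n). base_part n z \<in> U} U (base_part n)"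
    by (rule smooth_map_restrict[OF s order_refl]) auto
qed

lemma vec_part_space: "z \<in> Euc (2 * n) \<Longrightarrow> vec_part n z \<in> Euc n"
  by (simp add: vec_part_def)

text \<open>The vectors of a presentation are kept, and each coefficient \<open>g\<close> is
  replaced by its directional derivative, which is smooth in the base point and linear in the
  vector. This is the reason why derivatives of plots of \<open>W\<close> are smooth along the
  generating plots of a tangent bundle.\<close>

lemma fine_deriv_plot:
  assumes W: "is_vsp W" and p: "(n, U, p) \<in> fine_diff W"
  defines "TU \<equiv> {z \<in> Euc (2 * n). base_part n z \<in> U}"
  shows "(2 * n, TU, \<lambda>z\<in>TU. fine_deriv W n p (base_part n z) (vec_part n z)) \<in> fine_diff W"
proof -
  have U: "eopen n U" using p by (auto simp: fine_diff_def params_iff)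
  have "\<exists>N L. eopen (2 * n) N \<and> z \<in> N \<and> N \<subseteq> TU \<and>
      lc_on W (2 * n) N L (\<lambda>z\<in>TU. fine_deriv W n p (base_part n z) (vec_part n z))" if z: "z \<in> TU" for z
  proof -
    have "base_part n z \<in> U" using z by (simp add: TU_def)
    then obtain N L where N: "eopen n N" "base_part n z \<in> N" "N \<subseteq> U" "lc_on W n N L p"
      using fine_diffE[OF p] by blast
    define M where "M = {z \<in> Euc (2 * n). base_part n z \<in> N}"
    have M: "eopen (2 * n) M" and b: "smooth_map (2 * n) M N (base_part n)"
      unfolding M_def by (rule eopen_tangent[OF N(1)])+
    have MT: "M \<subseteq> TU" using N(3) by (auto simp: M_def TU_def)
    have "C_infinity (2 * n) M (\<lambda>y. dirderiv n g (base_part n y) (vec_part n y))" if g: "(g, x) \<in> set L" for g x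
      unfolding dirderiv_def vec_part_def
    proof (intro C_infinity_sum[OF M] C_infinity_mult[OF M] C_infinity_coord)
      fix i assume "i \<in> {..<n}"
      then have "C_infinity n N (partial i g)" using C_infinity_partial[OF lc_on_coeff[OF N(4) g]] by simp
      then show "C_infinity (2 * n) M (\<lambda>x. partial i g (base_part n x))"
        by (rule C_infinity_compose[OF N(1) M b])
    qed
    then have "lc_on W (2 * n) M (map (apfst (\<lambda>g y. dirderiv n g (base_part n y) (vec_part n y))) L)
        (\<lambda>z\<in>TU. fine_deriv W n p (base_part n z) (vec_part n z))"
      unfolding lc_on_def using lc_on_snd[OF N(4)] MT
      by (auto simp: fine_deriv_eq[OF W vec_part_space N(1) _ N(4)] M_def o_def apfst_compose subset_iff
          simp del: topspace_Euc)
    moreover have "z \<in> M" using z N(2) by (simp add: M_def TU_def)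
    ultimately show ?thesis using M MT by blast
  qed
  moreover have "(2 * n, TU, \<lambda>z\<in>TU. fine_deriv W n p (base_part n z) (vec_part n z)) \<in> params (carrier W)"
    unfolding params_iff
    using eopen_tangent(1)[OF U] fine_deriv_closed[OF W p _ vec_part_space] by (auto simp: TU_def simp del: topspace_Euc)
  ultimately show ?thesis unfolding fine_diff_def by blast
qed

lemma smooth_map_translate:
  assumes U: "eopen n U" and u: "u \<in> Euc n"
  defines "U' \<equiv> {y \<in> Euc n. (\<lambda>i. y i + u i) \<in> U}"
  shows "eopen n U'" "smooth_map n U' U (\<lambda>y i. y i + u i)"
proof -
  have s: "smooth_map n (Euc n) (Euc n) (\<lambda>y i. y i + u i)"
    unfolding smooth_map_def using u
    by (auto intro!: C_infinity_add C_infinity_coord C_infinity_const)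
  show "eopen n U'"
    unfolding U'_def by (rule eopen_smooth_preimage[OF eopen_space eopen_space s U])
  show "smooth_map n U' U (\<lambda>y i. y i + u i)"
    by (rule smooth_map_restrict[OF s]) (auto simp: U'_def)
qed

lemma differential_translate:
  assumes v: "v \<in> Euc n"
  shows "differential n (\<lambda>y i. y i + u i) x v = v"
proof
  fix j
  have "partial i (\<lambda>y. y j + u j) x = of_bool (i = j)" for i
    by (rule partial_eqI) (cases "i = j"; auto intro!: derivative_eq_intros)
  then show "differential n (\<lambda>y i. y i + u i) x v j = v j"
    using v by (cases "j < n") (simp_all add: differential_def of_bool_def if_distrib[of "\<lambda>x. x * _"] cong: if_cong)
qed

section \<open>The tangent bundle and derivatives along a map to a fine space\<close>

lemma diffeology_Inter:
  assumes "\<D> \<noteq> {}" "\<And>D. D \<in> \<D> \<Longrightarrow> diffeology X D"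
  shows "diffeology X (\<Inter>\<D>)"
proof
  show "\<Inter>\<D> \<subseteq> params X" using assms diffeology.plots_params by blast
  show "(n, U, \<lambda>u\<in>U. x) \<in> \<Inter>\<D>" if "eopen n U" "x \<in> X" for n U x
    using diffeology.plot_const[OF assms(2) that] by blast
  show "(n, U, p) \<in> \<Inter>\<D>"
    if "(n, U, p) \<in> params X" "open_cover n \<W> U" "\<And>W. W \<in> \<W> \<Longrightarrow> (n, W, restrict p W) \<in> \<Inter>\<D>" for n U p \<W>
    using diffeology.plot_local[OF assms(2) that(1,2)] that(3) by blast
  show "(m, V, compose V p f) \<in> \<Inter>\<D>" if "(n, U, p) \<in> \<Inter>\<D>" "eopen m V" "smooth_map m V U f" for n U p m V f
    using diffeology.plot_compose[OF assms(2) _ that(2,3)] that(1) by blast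
qed

text \<open>The relative version of \<open>dvs_iff\<close>: a plot of the fibre product is a pair of
  plots over the same base points, so the conditions become closure under fibrewise pointwise
  operations.\<close>

lemma dvs_over_iff:
  assumes X: "diffeology X D"
  shows "dvs_over X D F E \<longleftrightarrow> (\<forall>x\<in>X. is_vsp (F x)) \<and> diffeology (SIGMA x:X. carrier (F x)) E \<and>
    (\<forall>n U p. (n, U, p) \<in> E \<longrightarrow> (n, U, compose U fst p) \<in> D) \<and>
    (\<forall>n U p q. (n, U, p) \<in> E \<longrightarrow> (n, U, q) \<in> E \<longrightarrow> (\<forall>y\<in>U. fst (p y) = fst (q y)) \<longrightarrow>
      (n, U, \<lambda>y\<in>U. (fst (p y), snd (p y) \<oplus>\<^bsub>F (fst (p y))\<^esub> snd (q y))) \<in> E) \<and>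
    (\<forall>n U f p. C_infinity n U f \<longrightarrow> (n, U, p) \<in> E \<longrightarrow>
      (n, U, \<lambda>y\<in>U. (fst (p y), f y \<odot>\<^bsub>F (fst (p y))\<^esub> snd (p y))) \<in> E) \<and>
    (\<forall>n U p. (n, U, p) \<in> D \<longrightarrow> (n, U, \<lambda>y\<in>U. (p y, \<zero>\<^bsub>F (p y)\<^esub>)) \<in> E)"
proof (cases "(\<forall>x\<in>X. is_vsp (F x)) \<and> diffeology (SIGMA x:X. carrier (F x)) E")
  case True
  define T where "T = (SIGMA x:X. carrier (F x))"
  define T2 where "T2 = {(a, b) \<in> T \<times> T. fst a = fst b}"
  have V: "\<And>x. x \<in> X \<Longrightarrow> is_vsp (F x)" and E: "diffeology T E" using True by (auto simp: T_def)
  have ext: "p \<in> extensional U" if "(n, U, p) \<in> E" for n U p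
    using diffeologyD(3)[OF E that] .
  have prod1: "(n, U, r) \<in> prod_diff E E \<longleftrightarrow>
      (\<exists>p q. (n, U, p) \<in> E \<and> (n, U, q) \<in> E \<and> r = (\<lambda>y\<in>U. (p y, q y)))" for n U r
    by (rule prod_diff_iff) (auto intro: ext)
  have prod2: "(n, U, r) \<in> prod_diff real_diff E \<longleftrightarrow>
      (\<exists>p q. (n, U, p) \<in> real_diff \<and> (n, U, q) \<in> E \<and> r = (\<lambda>y\<in>U. (p y, q y)))" for n U r
    by (rule prod_diff_iff) (auto simp: real_diff_iff ext)
  have 1: "dsmooth T E X D fst \<longleftrightarrow> (\<forall>n U p. (n, U, p) \<in> E \<longrightarrow> (n, U, compose U fst p) \<in> D)"
    by (auto simp: dsmooth_def T_def)
  have 2: "dsmooth T2 (sub_diff (prod_diff E E) T2) T E (\<lambda>((x, \<xi>), (_, \<eta>)). (x, \<xi> \<oplus>\<^bsub>F x\<^esub> \<eta>)) \<longleftrightarrow>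
      (\<forall>n U p q. (n, U, p) \<in> E \<longrightarrow> (n, U, q) \<in> E \<longrightarrow> (\<forall>y\<in>U. fst (p y) = fst (q y)) \<longrightarrow>
      (n, U, \<lambda>y\<in>U. (fst (p y), snd (p y) \<oplus>\<^bsub>F (fst (p y))\<^esub> snd (q y))) \<in> E)" (is "dsmooth _ _ _ _ ?f \<longleftrightarrow> ?r")
  proof
    assume l: "dsmooth T2 (sub_diff (prod_diff E E) T2) T E ?f"
    show ?r
    proof (intro allI impI)
      fix n U p q assume p: "(n, U, p) \<in> E" and q: "(n, U, q) \<in> E" and pq: "\<forall>y\<in>U. fst (p y) = fst (q y)"
      have "(n, U, \<lambda>y\<in>U. (p y, q y)) \<in> sub_diff (prod_diff E E) T2"
        unfolding sub_diff_def T2_def using p q pq prod1 diffeologyD(1,2)[OF E p] diffeologyD(2)[OF E q]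
        by (auto simp: params_iff)
      then have "(n, U, compose U ?f (\<lambda>y\<in>U. (p y, q y))) \<in> E" by (rule dsmoothD(2)[OF l])
      then show "(n, U, \<lambda>y\<in>U. (fst (p y), snd (p y) \<oplus>\<^bsub>F (fst (p y))\<^esub> snd (q y))) \<in> E"
        by (simp add: compose_def case_prod_unfold cong: restrict_cong)
    qed
  next
    assume r: ?r
    show "dsmooth T2 (sub_diff (prod_diff E E) T2) T E ?f"
    proof (rule dsmoothI)
      fix n U s assume s: "(n, U, s) \<in> sub_diff (prod_diff E E) T2"
      then obtain p q where pq: "(n, U, p) \<in> E" "(n, U, q) \<in> E" "s = (\<lambda>y\<in>U. (p y, q y))"
        using prod1 by (auto simp: sub_diff_def)
      have "\<forall>y\<in>U. fst (p y) = fst (q y)"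
        using s by (auto simp: sub_diff_def params_iff pq(3) T2_def)
      then have "(n, U, \<lambda>y\<in>U. (fst (p y), snd (p y) \<oplus>\<^bsub>F (fst (p y))\<^esub> snd (q y))) \<in> E"
        using r pq by blast
      then show "(n, U, compose U ?f s) \<in> E"
        by (simp add: pq(3) compose_def case_prod_unfold cong: restrict_cong)
    next
      fix s assume "s \<in> T2"
      then obtain x \<xi> \<eta> where s: "s = ((x, \<xi>), (x, \<eta>))" "x \<in> X" "\<xi> \<in> carrier (F x)" "\<eta> \<in> carrier (F x)"
        by (auto simp: T2_def T_def)
      interpret module real_ring "F x" by (rule V[OF s(2)])
      show "?f s \<in> T" using s by (auto simp: T_def)
    qed
  qed
  have 3: "dsmooth (UNIV \<times> T) (prod_diff real_diff E) T E (\<lambda>(a, (x, \<xi>)). (x, a \<odot>\<^bsub>F x\<^esub> \<xi>)) \<longleftrightarrow>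
      (\<forall>n U f p. C_infinity n U f \<longrightarrow> (n, U, p) \<in> E \<longrightarrow>
      (n, U, \<lambda>y\<in>U. (fst (p y), f y \<odot>\<^bsub>F (fst (p y))\<^esub> snd (p y))) \<in> E)" (is "dsmooth _ _ _ _ ?f \<longleftrightarrow> ?r")
  proof
    assume l: "dsmooth (UNIV \<times> T) (prod_diff real_diff E) T E ?f"
    show ?r
    proof (intro allI impI)
      fix n U f q assume f: "C_infinity n U f" and q: "(n, U, q) \<in> E"
      have "(n, U, restrict f U) \<in> real_diff"
        using restrict_real_diff f diffeologyD(1)[OF E q] by blast
      then have "(n, U, \<lambda>y\<in>U. (restrict f U y, q y)) \<in> prod_diff real_diff E"
        using q prod2 by blast
      then have "(n, U, compose U ?f (\<lambda>y\<in>U. (restrict f U y, q y))) \<in> E"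
        by (rule dsmoothD(2)[OF l])
      then show "(n, U, \<lambda>y\<in>U. (fst (q y), f y \<odot>\<^bsub>F (fst (q y))\<^esub> snd (q y))) \<in> E"
        by (simp add: compose_def case_prod_unfold cong: restrict_cong)
    qed
  next
    assume r: ?r
    show "dsmooth (UNIV \<times> T) (prod_diff real_diff E) T E ?f"
    proof (rule dsmoothI)
      fix n U s assume "(n, U, s) \<in> prod_diff real_diff E"
      then obtain p q where pq: "(n, U, p) \<in> real_diff" "(n, U, q) \<in> E" "s = (\<lambda>y\<in>U. (p y, q y))"
        using prod2 by blast
      then have "(n, U, \<lambda>y\<in>U. (fst (q y), p y \<odot>\<^bsub>F (fst (q y))\<^esub> snd (q y))) \<in> E"
        using r by (simp add: real_diff_iff)
      then show "(n, U, compose U ?f s) \<in> E"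
        by (simp add: pq(3) compose_def case_prod_unfold cong: restrict_cong)
    next
      fix s :: "real \<times> 'a \<times> 'b" assume "s \<in> UNIV \<times> T"
      then obtain a x \<xi> where s: "s = (a, x, \<xi>)" "x \<in> X" "\<xi> \<in> carrier (F x)"
        by (auto simp: T_def)
      show "?f s \<in> T" using s vsp_smult(1)[OF V[OF s(2)] s(3)] by (simp add: T_def)
    qed
  qed
  have 4: "dsmooth X D T E (\<lambda>x. (x, \<zero>\<^bsub>F x\<^esub>)) \<longleftrightarrow>
      (\<forall>n U p. (n, U, p) \<in> D \<longrightarrow> (n, U, \<lambda>y\<in>U. (p y, \<zero>\<^bsub>F (p y)\<^esub>)) \<in> E)"
  proof -
    have "\<zero>\<^bsub>F x\<^esub> \<in> carrier (F x)" if "x \<in> X" for x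
    proof -
      interpret module real_ring "F x" by (rule V[OF that])
      show ?thesis by blast
    qed
    then show ?thesis by (auto simp: dsmooth_def T_def compose_def)
  qed
  show ?thesis
    using True unfolding dvs_over_def Let_def T_def[symmetric] T2_def[symmetric] 1 2 3 4 by simp
qed (auto simp: dvs_over_def Let_def)

text \<open>All the conditions are closure conditions, apart from smoothness of the projection,
  which any single member supplies. Nonemptiness matters because the empty intersection would
  contain every parametrization; for the tangent bundle \<open>lift_diff\<close> will be the
  witness.\<close>

lemma dvs_over_Inter:
  assumes X: "diffeology X D" and ne: "\<E> \<noteq> {}" and E: "\<And>E. E \<in> \<E> \<Longrightarrow> dvs_over X D F E"
  shows "dvs_over X D F (\<Inter>\<E>)"
proof -
  note E' = E[unfolded dvs_over_iff[OF X]]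
  obtain E0 where E0: "E0 \<in> \<E>" using ne by blast
  have "diffeology (SIGMA x:X. carrier (F x)) (\<Inter>\<E>)"
    by (rule diffeology_Inter[OF ne]) (use E' in blast)
  then show ?thesis
    unfolding dvs_over_iff[OF X]
  proof (intro conjI allI impI)
    show "\<forall>x\<in>X. is_vsp (F x)" using E'[OF E0] by blast
    show "(n, U, compose U fst p) \<in> D" if "(n, U, p) \<in> \<Inter>\<E>" for n U p
      using E'[OF E0] that E0 by blast
    show "(n, U, \<lambda>y\<in>U. (fst (p y), snd (p y) \<oplus>\<^bsub>F (fst (p y))\<^esub> snd (q y))) \<in> \<Inter>\<E>"
      if "(n, U, p) \<in> \<Inter>\<E>" "(n, U, q) \<in> \<Inter>\<E>" "\<forall>y\<in>U. fst (p y) = fst (q y)" for n U p q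
      using E' that by (meson InterE InterI)
    show "(n, U, \<lambda>y\<in>U. (fst (p y), f y \<odot>\<^bsub>F (fst (p y))\<^esub> snd (p y))) \<in> \<Inter>\<E>"
      if "C_infinity n U f" "(n, U, p) \<in> \<Inter>\<E>" for n U f p
      using E' that by (meson InterE InterI)
    show "(n, U, \<lambda>y\<in>U. (p y, \<zero>\<^bsub>F (p y)\<^esub>)) \<in> \<Inter>\<E>" if "(n, U, p) \<in> D" for n U p
      using E' that by (meson InterI)
  qed
qed

text \<open>A smooth map \<open>c\<close> from a diffeological space to a fine space can be
  differentiated along plots. This yields a linear map from each tangent space into \<open>W\<close>
  itself, so no tangent space of \<open>W\<close> is involved.\<close>

locale tan_lift =
  fixes X :: "'x set" and DX :: "'x param set" and W :: "'w vsp" and c :: "'x \<Rightarrow> 'w"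
  assumes diffeology_X: "diffeology X DX" and vsp_W: "is_vsp W"
    and smooth_c: "dsmooth X DX (carrier W) (fine_diff W) c"
begin

interpretation W: module real_ring W by (rule vsp_W)

definition plot_deriv :: "'x param \<Rightarrow> (nat \<Rightarrow> real) \<Rightarrow> 'w" where
  "plot_deriv P v = fine_deriv W (fst P) (compose (fst (snd P)) c (snd (snd P))) origin v"

definition sum_deriv :: "('x param \<Rightarrow> nat \<Rightarrow> real) \<Rightarrow> 'w" where
  "sum_deriv s = (\<Oplus>\<^bsub>W\<^esub>P\<in>{P. s P \<noteq> origin}. plot_deriv P (s P))"

text \<open>No base point occurs, so one function serves all fibres. This is what allows it to be
  tested on plots of the whole bundle.\<close>

definition tlift :: "'x tvec \<Rightarrow> 'w" where
  "tlift = coset_lift sum_deriv"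

lemma plot_c: "(n, U, p) \<in> plots_at DX x \<Longrightarrow> (n, U, compose U c p) \<in> fine_diff W"
  using dsmoothD(2)[OF smooth_c] by (simp add: plots_at_iff)

lemma plot_deriv:
  assumes "(n, U, p) \<in> plots_at DX x" "v \<in> Euc n"
  shows plot_deriv_closed: "plot_deriv (n, U, p) v \<in> carrier W"
    and plot_deriv_add: "w \<in> Euc n \<Longrightarrow>
      plot_deriv (n, U, p) (\<lambda>i. v i + w i) = plot_deriv (n, U, p) v \<oplus>\<^bsub>W\<^esub> plot_deriv (n, U, p) w"
    and plot_deriv_smult: "plot_deriv (n, U, p) (\<lambda>i. a * v i) = a \<odot>\<^bsub>W\<^esub> plot_deriv (n, U, p) v"
  using fine_deriv_closed[OF vsp_W plot_c[OF assms(1)] _ assms(2), of origin]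
    fine_deriv_add[OF vsp_W plot_c[OF assms(1)] _ assms(2), of origin w]
    fine_deriv_smult[OF vsp_W plot_c[OF assms(1)] _ assms(2), of origin a] assms(1)
  by (simp_all add: plot_deriv_def plots_at_iff)

lemma plot_deriv_tan_sum:
  assumes "s \<in> carrier (tan_sum DX x)" "P \<in> plots_at DX x"
  shows "plot_deriv P (s P) \<in> carrier W"
proof (cases P)
  case (fields n U p)
  have "s P \<in> Euc (fst P)" using assms(1) unfolding carrier_tan_sum by blast
  then show ?thesis using plot_deriv_closed assms(2) fields by simp
qed

lemma plot_deriv_zero: "P \<in> plots_at DX x \<Longrightarrow> plot_deriv P origin = \<zero>\<^bsub>W\<^esub>"
  using plot_deriv_smult[of "fst P" "fst (snd P)" "snd (snd P)" x origin 0]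
    plot_deriv_closed[of "fst P" "fst (snd P)" "snd (snd P)" x origin]
  by (simp add: vsp_smult[OF vsp_W])

lemma sum_deriv_superset:
  assumes "s \<in> carrier (tan_sum DX x)" "finite A" "A \<subseteq> plots_at DX x" "{P. s P \<noteq> origin} \<subseteq> A"
  shows "sum_deriv s = (\<Oplus>\<^bsub>W\<^esub>P\<in>A. plot_deriv P (s P))"
  unfolding sum_deriv_def
proof (rule W.add.finprod_mono_neutral_cong_left[OF assms(2,4)])
  show "plot_deriv P (s P) = \<zero>\<^bsub>W\<^esub>" if "P \<in> A - {P. s P \<noteq> origin}" for P
    using assms(3) plot_deriv_zero[of P] that by auto
  show "(\<lambda>P. plot_deriv P (s P)) \<in> A \<rightarrow> carrier W"
    using assms(3) plot_deriv_tan_sum[OF assms(1)] by blast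
qed simp

lemma linear_map_sum_deriv: "linear_map (tan_sum DX x) W sum_deriv"
  unfolding linear_map_def
proof (intro conjI ballI allI)
  interpret T: module real_ring "tan_sum DX x" by (rule is_vsp_tan_sum)
  have supp: "finite {P. s P \<noteq> origin}" "{P. s P \<noteq> origin} \<subseteq> plots_at DX x"
    if "s \<in> carrier (tan_sum DX x)" for s
    using that by (auto simp: carrier_tan_sum)
  show "sum_deriv \<in> carrier (tan_sum DX x) \<rightarrow> carrier W"
  proof
    fix s assume s: "s \<in> carrier (tan_sum DX x)"
    show "sum_deriv s \<in> carrier W"
      unfolding sum_deriv_def using supp[OF s] plot_deriv_tan_sum[OF s] by (intro W.finsum_closed) auto
  qed
  fix s assume s: "s \<in> carrier (tan_sum DX x)"
  {
    fix t assume t: "t \<in> carrier (tan_sum DX x)"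
    define A where "A = {P. s P \<noteq> origin} \<union> {P. t P \<noteq> origin}"
    have A: "finite A" "A \<subseteq> plots_at DX x" "{P. s P \<noteq> origin} \<subseteq> A" "{P. t P \<noteq> origin} \<subseteq> A"
      "{P. (s \<oplus>\<^bsub>tan_sum DX x\<^esub> t) P \<noteq> origin} \<subseteq> A"
      using supp[OF s] supp[OF t] by (auto simp: A_def tan_sum_ops)
    have "plot_deriv P ((s \<oplus>\<^bsub>tan_sum DX x\<^esub> t) P) = plot_deriv P (s P) \<oplus>\<^bsub>W\<^esub> plot_deriv P (t P)"
      if P: "P \<in> A" for P
    proof (cases P)
      case (fields n U p)
      have "s P \<in> Euc n" "t P \<in> Euc n"
        using s t fields by (auto simp: carrier_tan_sum simp del: topspace_Euc)
      then show ?thesis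
        using plot_deriv_add[of n U p x "s P" "t P"] A(2) P fields by (auto simp: tan_sum_ops simp del: topspace_Euc)
    qed
    moreover have sP: "plot_deriv P (s P) \<in> carrier W" and tP: "plot_deriv P (t P) \<in> carrier W" if "P \<in> A" for P
      using plot_deriv_tan_sum[OF s, of P] plot_deriv_tan_sum[OF t, of P] that A(2) by blast+
    ultimately have "sum_deriv (s \<oplus>\<^bsub>tan_sum DX x\<^esub> t) =
        (\<Oplus>\<^bsub>W\<^esub>P\<in>A. plot_deriv P (s P) \<oplus>\<^bsub>W\<^esub> plot_deriv P (t P))"
      unfolding sum_deriv_superset[OF T.a_closed[OF s t] A(1,2,5)] by (intro W.finsum_cong') auto
    also have "\<dots> = (\<Oplus>\<^bsub>W\<^esub>P\<in>A. plot_deriv P (s P)) \<oplus>\<^bsub>W\<^esub> (\<Oplus>\<^bsub>W\<^esub>P\<in>A. plot_deriv P (t P))"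
      using sP tP by (intro W.finsum_addf) auto
    finally show "sum_deriv (s \<oplus>\<^bsub>tan_sum DX x\<^esub> t) = sum_deriv s \<oplus>\<^bsub>W\<^esub> sum_deriv t"
      by (simp add: sum_deriv_superset[OF s A(1,2,3)] sum_deriv_superset[OF t A(1,2,4)])
  }
  fix a
  define A where "A = {P. s P \<noteq> origin}"
  have A: "finite A" "A \<subseteq> plots_at DX x" "{P. s P \<noteq> origin} \<subseteq> A"
    "{P. (a \<odot>\<^bsub>tan_sum DX x\<^esub> s) P \<noteq> origin} \<subseteq> A"
    using supp[OF s] by (auto simp: A_def tan_sum_ops)
  have "plot_deriv P ((a \<odot>\<^bsub>tan_sum DX x\<^esub> s) P) = a \<odot>\<^bsub>W\<^esub> plot_deriv P (s P)" if P: "P \<in> A" for P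
  proof (cases P)
    case (fields n U p)
    have "s P \<in> Euc n"
      using s fields by (auto simp: carrier_tan_sum simp del: topspace_Euc)
    then show ?thesis
      using plot_deriv_smult[of n U p x "s P"] A(2) P fields by (auto simp: tan_sum_ops simp del: topspace_Euc)
  qed
  moreover have sP: "plot_deriv P (s P) \<in> carrier W" if "P \<in> A" for P
    using plot_deriv_tan_sum[OF s, of P] that A(2) by blast
  ultimately have "sum_deriv (a \<odot>\<^bsub>tan_sum DX x\<^esub> s) = (\<Oplus>\<^bsub>W\<^esub>P\<in>A. a \<odot>\<^bsub>W\<^esub> plot_deriv P (s P))"
    unfolding sum_deriv_superset[OF vsp_smult(1)[OF is_vsp_tan_sum s] A(1,2,4)]
    by (intro W.finsum_cong') (auto simp: vsp_smult[OF vsp_W])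
  also have "\<dots> = a \<odot>\<^bsub>W\<^esub> (\<Oplus>\<^bsub>W\<^esub>P\<in>A. plot_deriv P (s P))"
    using sP A(1) by (intro W.finsum_smult_ldistr[symmetric]) auto
  finally show "sum_deriv (a \<odot>\<^bsub>tan_sum DX x\<^esub> s) = a \<odot>\<^bsub>W\<^esub> sum_deriv s"
    by (simp add: sum_deriv_superset[OF s A(1,2,3)])
qed

lemma sum_deriv_single:
  assumes "(n, U, p) \<in> plots_at DX x" "v \<in> Euc n"
  shows "sum_deriv (tan_single (n, U, p) v) = plot_deriv (n, U, p) v"
proof -
  have "sum_deriv (tan_single (n, U, p) v) =
      (\<Oplus>\<^bsub>W\<^esub>P\<in>{(n, U, p)}. plot_deriv P (tan_single (n, U, p) v P))"
    by (rule sum_deriv_superset[OF tan_single_closed[OF assms]]) (use assms(1) in \<open>auto simp: tan_single_def\<close>)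
  then show ?thesis
    using plot_deriv_closed[OF assms] by (simp add: tan_single_def)
qed

text \<open>For \<open>p\<close> equal to \<open>q\<close> after \<open>g\<close>, the composite of
  \<open>c\<close> with \<open>p\<close> is that of \<open>c\<close> with \<open>q\<close>, followed
  on the source side by \<open>g\<close>; the chain rule for \<open>fine_deriv\<close> says
  precisely that both ends of the relation have equal derivatives.\<close>

lemma sum_deriv_rel:
  assumes "s \<in> tan_rel DX x"
  shows "sum_deriv s = \<zero>\<^bsub>W\<^esub>"
proof -
  have "sum_deriv s \<in> {\<zero>\<^bsub>W\<^esub>}"
  proof (rule tan_rel_linear[OF vsp_W linear_map_sum_deriv submodule_zero[OF vsp_W] _ assms])
    fix n U p v m V q g
    assume *: "(n, U, p) \<in> plots_at DX x" "(m, V, q) \<in> plots_at DX x"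
      "v \<in> Euc n" "differential n g origin v \<in> Euc m"
      "smooth_map n U V g" "g origin = origin" "p = compose U q g"
    have U: "eopen n U" "origin \<in> U" and V: "eopen m V"
      using * diffeologyD(1)[OF diffeology_X] by (auto simp: plots_at_iff)
    have gV: "g y \<in> V" if "y \<in> U" for y using *(5) that by (auto simp: smooth_map_def)
    have "fine_deriv W n (compose U c p) origin v =
        fine_deriv W m (compose V c q) (g origin) (differential n g origin v)"
      by (rule fine_deriv_compose[OF vsp_W plot_c[OF *(2)] V U(1) *(5) _ U(2) *(3,4)])
        (simp add: *(7) compose_def gV)
    then have "plot_deriv (n, U, p) v = plot_deriv (m, V, q) (differential n g origin v)"
      by (simp add: plot_deriv_def *(6))
    then show "sum_deriv (tan_single (n, U, p) v) \<ominus>\<^bsub>W\<^esub>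
        sum_deriv (tan_single (m, V, q) (differential n g origin v)) \<in> {\<zero>\<^bsub>W\<^esub>}"
      using plot_deriv_closed[OF *(2,4)]
      by (simp add: sum_deriv_single[OF *(1,3)] sum_deriv_single[OF *(2,4)] a_minus_def W.r_neg)
  qed
  then show ?thesis by simp
qed

lemma linear_map_tlift: "linear_map (tan_space DX x) W tlift"
  unfolding tlift_def tan_space_def
  by (rule linear_map_coset_lift[OF is_vsp_tan_sum vsp_W submodule_tan_rel linear_map_sum_deriv sum_deriv_rel])

lemma tlift_class:
  assumes "(n, U, p) \<in> plots_at DX x" "v \<in> Euc n"
  shows "tlift (tan_class DX x (n, U, p) v) = fine_deriv W n (compose U c p) origin v"
  unfolding tlift_def
  by (subst tan_class_def, subst coset_lift_coset[OF is_vsp_tan_sum vsp_W submodule_tan_rel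
        linear_map_sum_deriv sum_deriv_rel tan_single_closed[OF assms]])
    (simp_all add: sum_deriv_single[OF assms] plot_deriv_def)

text \<open>The largest vector space diffeology over \<open>X\<close> for which the fibrewise lift is smooth.\<close>

definition lift_diff :: "('x \<times> 'x tvec) param set" where
  "lift_diff = pullback_diff (tan_bundle X DX) fst DX \<inter>
    pullback_diff (tan_bundle X DX) (\<lambda>z. tlift (snd z)) (fine_diff W)"

lemma lift_diff_iff: "(n, U, p) \<in> lift_diff \<longleftrightarrow> (n, U, p) \<in> params (tan_bundle X DX) \<and>
    (n, U, compose U fst p) \<in> DX \<and> (n, U, compose U (\<lambda>z. tlift (snd z)) p) \<in> fine_diff W"
  by (auto simp: lift_diff_def)

text \<open>Each fibrewise operation commutes with \<open>tlift\<close> by linearity, so its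
  smoothness is inherited from the fine diffeology of \<open>W\<close>, while the base component is
  unchanged.\<close>

lemma dvs_over_lift_diff: "dvs_over X DX (tan_space DX) lift_diff"
  unfolding dvs_over_iff[OF diffeology_X]
proof (intro conjI allI impI ballI)
  note T = is_vsp_tan_space[of DX]
  note dvsW = dvs_fine_diff[OF vsp_W]
  have "diffeology (tan_bundle X DX) (\<Inter>{
      pullback_diff (tan_bundle X DX) fst DX,
      pullback_diff (tan_bundle X DX) (\<lambda>z. tlift (snd z)) (fine_diff W)})"
  proof (rule diffeology_Inter)
    have "diffeology (tan_bundle X DX) (pullback_diff (tan_bundle X DX) fst DX)"
      by (rule diffeology_pullback[OF diffeology_X]) (auto simp: tan_bundle_def)
    moreover have "diffeology (tan_bundle X DX)
        (pullback_diff (tan_bundle X DX) (\<lambda>z. tlift (snd z)) (fine_diff W))"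
      by (rule diffeology_pullback[OF dvsD(2)[OF dvsW]])
        (auto simp: tan_bundle_def intro: linear_mapD(1)[OF linear_map_tlift])
    ultimately show "diffeology (tan_bundle X DX) D" if "D \<in> {
      pullback_diff (tan_bundle X DX) fst DX,
      pullback_diff (tan_bundle X DX) (\<lambda>z. tlift (snd z)) (fine_diff W)}" for D
      using that by blast
  qed simp
  then show "diffeology (SIGMA x:X. carrier (tan_space DX x)) lift_diff"
    by (simp add: lift_diff_def tan_bundle_def)
  show "is_vsp (tan_space DX x)" for x by (rule T)
  show "(n, U, compose U fst p) \<in> DX" if "(n, U, p) \<in> lift_diff" for n U p
    using that by (simp add: lift_diff_iff)
  have mem: "fst (p y) \<in> X" "snd (p y) \<in> carrier (tan_space DX (fst (p y)))"
    if "(n, U, p) \<in> lift_diff" "y \<in> U" for n U p y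
    using that by (force simp: lift_diff_iff params_iff tan_bundle_def)+
  show "(n, U, \<lambda>y\<in>U. (fst (p y), snd (p y) \<oplus>\<^bsub>tan_space DX (fst (p y))\<^esub> snd (q y))) \<in> lift_diff"
    (is "(n, U, ?r) \<in> _")
    if p: "(n, U, p) \<in> lift_diff" and q: "(n, U, q) \<in> lift_diff" and pq: "\<forall>y\<in>U. fst (p y) = fst (q y)" for n U p q
  proof -
    have cl: "snd (p y) \<oplus>\<^bsub>tan_space DX (fst (p y))\<^esub> snd (q y) \<in> carrier (tan_space DX (fst (p y)))" if "y \<in> U" for y
    proof -
      interpret M: module real_ring "tan_space DX (fst (p y))" by (rule T)
      show ?thesis using mem[OF p that] mem[OF q that] pq that by (intro M.a_closed) simp_all
    qed
    have 1: "compose U fst ?r = compose U fst p" by (auto simp: compose_def fun_eq_iff)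
    have 2: "compose U (\<lambda>z. tlift (snd z)) ?r =
        (\<lambda>y\<in>U. compose U (\<lambda>z. tlift (snd z)) p y \<oplus>\<^bsub>W\<^esub> compose U (\<lambda>z. tlift (snd z)) q y)"
      using mem[OF p] mem[OF q] pq linear_mapD(2)[OF linear_map_tlift] by (auto simp: compose_def fun_eq_iff)
    show ?thesis
      unfolding lift_diff_iff 1 2
      using p q dvsD(3)[OF dvsW] cl mem[OF p] by (auto simp: lift_diff_iff params_iff tan_bundle_def)
  qed
  show "(n, U, \<lambda>y\<in>U. (fst (p y), f y \<odot>\<^bsub>tan_space DX (fst (p y))\<^esub> snd (p y))) \<in> lift_diff"
    (is "(n, U, ?r) \<in> _")
    if f: "C_infinity n U f" and p: "(n, U, p) \<in> lift_diff" for n U f p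
  proof -
    have 1: "compose U fst ?r = compose U fst p" by (auto simp: compose_def fun_eq_iff)
    have 2: "compose U (\<lambda>z. tlift (snd z)) ?r =
        (\<lambda>y\<in>U. f y \<odot>\<^bsub>W\<^esub> compose U (\<lambda>z. tlift (snd z)) p y)"
      using mem[OF p] linear_mapD(3)[OF linear_map_tlift] by (auto simp: compose_def fun_eq_iff)
    show ?thesis
      unfolding lift_diff_iff 1 2
      using p f dvsD(4)[OF dvsW] mem[OF p] vsp_smult(1)[OF T]
      by (auto simp: lift_diff_iff params_iff tan_bundle_def)
  qed
  show "(n, U, \<lambda>y\<in>U. (p y, \<zero>\<^bsub>tan_space DX (p y)\<^esub>)) \<in> lift_diff" (is "(n, U, ?r) \<in> _")
    if p: "(n, U, p) \<in> DX" for n U p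
  proof -
    have z: "\<zero>\<^bsub>tan_space DX x\<^esub> \<in> carrier (tan_space DX x)" for x
    proof -
      interpret M: module real_ring "tan_space DX x" by (rule T)
      show ?thesis by blast
    qed
    have 1: "compose U fst ?r = p"
      using diffeologyD(3)[OF diffeology_X p] by (auto simp: compose_def intro!: extensionalityI[of _ U])
    have 2: "compose U (\<lambda>z. tlift (snd z)) ?r = (\<lambda>y\<in>U. \<zero>\<^bsub>W\<^esub>)"
      using linear_map_zero[OF T vsp_W linear_map_tlift] by (auto simp: compose_def fun_eq_iff)
    show ?thesis
      unfolding lift_diff_iff 1 2
      using p diffeologyD[OF diffeology_X p] z diffeology.plot_const[OF dvsD(2)[OF dvsW]]
      by (auto simp: params_iff tan_bundle_def)
  qed
qed

lemma translate_plot_eq: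
  assumes p: "(n, U, p) \<in> DX" and u: "u \<in> U"
  defines "U' \<equiv> {y \<in> Euc n. (\<lambda>i. y i + u i) \<in> U}"
  shows "translate_plot u (n, U, p) = (n, U', compose U' p (\<lambda>y i. y i + u i))"
    and "(n, U', compose U' p (\<lambda>y i. y i + u i)) \<in> plots_at DX (p u)"
proof -
  have U: "eopen n U" using diffeologyD(1)[OF diffeology_X p] .
  have us: "u \<in> Euc n" using eopen_support[OF U u] by simp
  note t = smooth_map_translate[OF U us, folded U'_def]
  show "translate_plot u (n, U, p) = (n, U', compose U' p (\<lambda>y i. y i + u i))"
    unfolding translate_plot_def Let_def U'_def by (simp add: compose_def)
  show "(n, U', compose U' p (\<lambda>y i. y i + u i)) \<in> plots_at DX (p u)"
    using diffeology.plot_compose[OF diffeology_X p t] u by (simp add: plots_at_iff U'_def compose_def)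
qed

text \<open>A translation has the identity as differential, so the chain rule turns the derivative
  of the translated plot at the origin into that of the original plot at \<open>u\<close>.\<close>

lemma tlift_translate:
  assumes p: "(n, U, p) \<in> DX" and u: "u \<in> U" and v: "v \<in> Euc n"
  shows "tan_class DX (p u) (translate_plot u (n, U, p)) v \<in> carrier (tan_space DX (p u))"
    and "tlift (tan_class DX (p u) (translate_plot u (n, U, p)) v) = fine_deriv W n (compose U c p) u v"
proof -
  define U' where "U' = {y \<in> Euc n. (\<lambda>i. y i + u i) \<in> U}"
  define f where "f = (\<lambda>y i. y i + u i)"
  have U: "eopen n U" using diffeologyD(1)[OF diffeology_X p] .
  have us: "u \<in> Euc n" using eopen_support[OF U u] by simp
  note t = smooth_map_translate[OF U us, folded U'_def f_def]
  note tr = translate_plot_eq[OF p u, folded U'_def f_def]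
  have f0: "f origin = u" and oU: "origin \<in> U'" using u by (auto simp: f_def U'_def)
  have fU: "f y \<in> U" if "y \<in> U'" for y using that by (simp add: f_def U'_def)
  have d: "differential n f origin v = v" unfolding f_def by (rule differential_translate[OF v])
  show "tan_class DX (p u) (translate_plot u (n, U, p)) v \<in> carrier (tan_space DX (p u))"
    unfolding tr(1) by (rule tan_class_closed[OF tr(2) v])
  have "fine_deriv W n (compose U' c (compose U' p f)) origin v =
      fine_deriv W n (compose U c p) (f origin) (differential n f origin v)"
    by (rule fine_deriv_compose[OF vsp_W dsmoothD(2)[OF smooth_c p] U t(1,2) _ oU v])
      (use fU v d in \<open>simp_all add: compose_def del: topspace_Euc\<close>)
  then show "tlift (tan_class DX (p u) (translate_plot u (n, U, p)) v) = fine_deriv W n (compose U c p) u v"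
    unfolding tr(1) tlift_class[OF tr(2) v] by (simp add: f0 d)
qed

text \<open>On the plot of the bundle induced by \<open>p\<close>, the lift is the derivative of
  \<open>c\<close> after \<open>p\<close> as a function of base point and vector, which is a plot of
  \<open>W\<close> by \<open>fine_deriv_plot\<close>.\<close>

lemma tan_plot_lift_diff: "tan_plot DX ` DX \<subseteq> lift_diff"
proof (rule image_subsetI)
  fix Q assume "Q \<in> DX"
  moreover obtain n U p where Q: "Q = (n, U, p)" by (cases Q)
  ultimately have p: "(n, U, p) \<in> DX" by simp
  have U: "eopen n U" using diffeologyD(1)[OF diffeology_X p] .
  define TU where "TU = {z \<in> Euc (2 * n). base_part n z \<in> U}"
  define P where "P = (\<lambda>z\<in>TU. (p (base_part n z),
    tan_class DX (p (base_part n z)) (translate_plot (base_part n z) (n, U, p)) (vec_part n z)))"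
  have P: "tan_plot DX (n, U, p) = (2 * n, TU, P)"
    by (simp add: tan_plot_def TU_def P_def Let_def)
  note TU = eopen_tangent[OF U, folded TU_def]
  have z: "base_part n z \<in> U" "vec_part n z \<in> Euc n" if "z \<in> TU" for z
    using that vec_part_space by (auto simp: TU_def simp del: topspace_Euc)
  have "(2 * n, TU, P) \<in> params (tan_bundle X DX)"
    using TU(1) diffeologyD(2)[OF diffeology_X p z(1)] tlift_translate(1)[OF p z]
    by (auto simp: params_iff P_def tan_bundle_def)
  moreover have "compose TU fst P = compose TU p (base_part n)"
    by (auto simp: compose_def P_def fun_eq_iff)
  moreover have "compose TU (\<lambda>z. tlift (snd z)) P =
      (\<lambda>z\<in>TU. fine_deriv W n (compose U c p) (base_part n z) (vec_part n z))"
    using tlift_translate(2)[OF p z] by (auto simp: compose_def P_def fun_eq_iff)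
  ultimately show "tan_plot DX Q \<in> lift_diff"
    unfolding Q P lift_diff_iff
    using diffeology.plot_compose[OF diffeology_X p TU]
      fine_deriv_plot[OF vsp_W dsmoothD(2)[OF smooth_c p], folded TU_def] by simp
qed

lemma gen_diff_lift_diff: "gen_diff (tan_bundle X DX) (tan_plot DX ` DX) \<subseteq> lift_diff"
  using dvs_over_lift_diff tan_plot_lift_diff
  unfolding gen_diff_def dvs_over_iff[OF diffeology_X] tan_bundle_def by blast

text \<open>\<open>lift_diff\<close> belongs to the family being intersected. Every statement about
  smoothness of maps out of the tangent bundle rests on this inclusion.\<close>

lemma tan_bundle_diff_lift_diff: "tan_bundle_diff X DX \<subseteq> lift_diff"
  unfolding tan_bundle_diff_def using dvs_over_lift_diff gen_diff_lift_diff by blast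

lemma dvs_over_tan_bundle_diff: "dvs_over X DX (tan_space DX) (tan_bundle_diff X DX)"
  unfolding tan_bundle_diff_def
  by (rule dvs_over_Inter[OF diffeology_X]) (use dvs_over_lift_diff gen_diff_lift_diff in auto)

lemma tan_diff_eq:
  assumes "x \<in> X"
  shows "tan_diff X DX x = {(n, U, p) \<in> params (carrier (tan_space DX x)).
    (n, U, compose U (Pair x) p) \<in> tan_bundle_diff X DX}"
  by (auto simp: tan_diff_def param_map_def sub_diff_def params_iff compose_def)

text \<open>The fibre carries the pullback of the bundle diffeology along \<open>Pair x\<close>, and
  the fibrewise operations restrict to it. The tangent space thereby becomes an admissible target
  for linear maps out of fine spaces, whose smoothness is then automatic.\<close>

lemma dvs_tan_space:
  assumes x: "x \<in> X"
  shows "dvs (tan_space DX x) (tan_diff X DX x)"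
proof -
  note T = is_vsp_tan_space[of DX x]
  interpret T: module real_ring "tan_space DX x" by (rule T)
  note B = dvs_over_tan_bundle_diff[unfolded dvs_over_iff[OF diffeology_X]]
  have Bd: "diffeology (SIGMA x:X. carrier (tan_space DX x)) (tan_bundle_diff X DX)" using B by blast
  have Badd: "(n, U, \<lambda>y\<in>U. (fst (p y), snd (p y) \<oplus>\<^bsub>tan_space DX (fst (p y))\<^esub> snd (q y))) \<in> tan_bundle_diff X DX"
    if "(n, U, p) \<in> tan_bundle_diff X DX" "(n, U, q) \<in> tan_bundle_diff X DX" "\<And>y. y \<in> U \<Longrightarrow> fst (p y) = fst (q y)"
    for n U p q using B that by blast
  have Bsmult: "(n, U, \<lambda>y\<in>U. (fst (p y), f y \<odot>\<^bsub>tan_space DX (fst (p y))\<^esub> snd (p y))) \<in> tan_bundle_diff X DX"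
    if "C_infinity n U f" "(n, U, p) \<in> tan_bundle_diff X DX" for n U f p using B that by blast
  have "diffeology (carrier (tan_space DX x)) (tan_diff X DX x)"
    unfolding tan_diff_eq[OF x] by (rule diffeology_pullback[OF Bd]) (use x in auto)
  moreover have "(n, U, \<lambda>y\<in>U. p y \<oplus>\<^bsub>tan_space DX x\<^esub> q y) \<in> tan_diff X DX x"
    if p: "(n, U, p) \<in> tan_diff X DX x" and q: "(n, U, q) \<in> tan_diff X DX x" for n U p q
  proof -
    have "(\<lambda>y\<in>U. (fst (compose U (Pair x) p y), snd (compose U (Pair x) p y)
        \<oplus>\<^bsub>tan_space DX (fst (compose U (Pair x) p y))\<^esub> snd (compose U (Pair x) q y))) =
      compose U (Pair x) (\<lambda>y\<in>U. p y \<oplus>\<^bsub>tan_space DX x\<^esub> q y)"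
      by (auto simp: compose_def fun_eq_iff)
    then have "(n, U, compose U (Pair x) (\<lambda>y\<in>U. p y \<oplus>\<^bsub>tan_space DX x\<^esub> q y)) \<in> tan_bundle_diff X DX"
      using Badd[of n U "compose U (Pair x) p" "compose U (Pair x) q"] p q
      by (simp add: tan_diff_eq[OF x] compose_def)
    then show ?thesis using p q by (auto simp: tan_diff_eq[OF x] params_iff)
  qed
  moreover have "(n, U, \<lambda>y\<in>U. f y \<odot>\<^bsub>tan_space DX x\<^esub> p y) \<in> tan_diff X DX x"
    if f: "C_infinity n U f" and p: "(n, U, p) \<in> tan_diff X DX x" for n U f p
  proof -
    have "(\<lambda>y\<in>U. (fst (compose U (Pair x) p y), f y
        \<odot>\<^bsub>tan_space DX (fst (compose U (Pair x) p y))\<^esub> snd (compose U (Pair x) p y))) =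
      compose U (Pair x) (\<lambda>y\<in>U. f y \<odot>\<^bsub>tan_space DX x\<^esub> p y)"
      by (auto simp: compose_def fun_eq_iff)
    then have "(n, U, compose U (Pair x) (\<lambda>y\<in>U. f y \<odot>\<^bsub>tan_space DX x\<^esub> p y)) \<in> tan_bundle_diff X DX"
      using Bsmult[OF f, of "compose U (Pair x) p"] p by (simp add: tan_diff_eq[OF x])
    then show ?thesis using p by (auto simp: tan_diff_eq[OF x] params_iff vsp_smult(1)[OF T])
  qed
  ultimately show ?thesis unfolding dvs_iff using T by blast
qed

lemma tlift_smooth:
  assumes x: "x \<in> X"
  shows "dsmooth (carrier (tan_space DX x)) (tan_diff X DX x) (carrier W) (fine_diff W) tlift"
proof (rule dsmoothI)
  fix n U p assume "(n, U, p) \<in> tan_diff X DX x"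
  then have "(n, U, compose U (Pair x) p) \<in> lift_diff"
    using tan_bundle_diff_lift_diff by (auto simp: tan_diff_eq[OF x])
  moreover have "compose U (\<lambda>z. tlift (snd z)) (compose U (Pair x) p) = compose U tlift p"
    by (auto simp: compose_def fun_eq_iff)
  ultimately show "(n, U, compose U tlift p) \<in> fine_diff W" by (simp add: lift_diff_iff)
qed (rule linear_mapD(1)[OF linear_map_tlift])

end

section \<open>Quotients of fine vector spaces\<close>

lemma dvs_iso_inv:
  assumes V: "dvs V D" and h: "dvs_iso V D W E h"
  shows "dvs_iso W E V D (inv_into (carrier V) h)"
proof -
  have bij: "bij_betw h (carrier V) (carrier W)" using h by (simp add: dvs_iso_def)
  have "dsmooth (carrier V) D (carrier W) E (inv_into (carrier W) (inv_into (carrier V) h))"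
    by (rule dsmooth_cong[OF dvsD(2)[OF V], of h])
      (use h inv_into_inv_into_eq[OF bij] in \<open>auto simp: dvs_iso_def\<close>)
  then show ?thesis
    using h linear_map_inv_into[OF dvsD(1)[OF V] _ bij] bij_betw_inv_into[OF bij]
    by (simp add: dvs_iso_def)
qed

lemma dvs_iso_compose:
  assumes W: "dvs W E" and f: "dvs_iso U C V D f" and g: "dvs_iso V D W E g"
  shows "dvs_iso U C W E (\<lambda>x. g (f x))"
proof -
  have bf: "bij_betw f (carrier U) (carrier V)" and bg: "bij_betw g (carrier V) (carrier W)"
    using f g by (simp_all add: dvs_iso_def)
  have bgf: "bij_betw (\<lambda>x. g (f x)) (carrier U) (carrier W)"
    using bij_betw_trans[OF bf bg] by (simp add: o_def)
  have "dsmooth (carrier W) E (carrier U) C (inv_into (carrier U) (\<lambda>x. g (f x)))"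
  proof (rule dsmooth_cong[OF dvsD(2)[OF W]])
    show "dsmooth (carrier W) E (carrier U) C (\<lambda>z. inv_into (carrier U) f (inv_into (carrier V) g z))"
      by (rule dsmooth_compose[where Y = "carrier V" and E = D]) (use f g in \<open>simp_all add: dvs_iso_def\<close>)
    fix z assume "z \<in> carrier W"
    then have v: "inv_into (carrier V) g z \<in> carrier V" "g (inv_into (carrier V) g z) = z"
      using bg by (auto simp: bij_betw_def inv_into_into f_inv_into_f)
    then have "inv_into (carrier U) f (inv_into (carrier V) g z) \<in> carrier U"
      "f (inv_into (carrier U) f (inv_into (carrier V) g z)) = inv_into (carrier V) g z"
      using bf by (auto simp: bij_betw_def inv_into_into f_inv_into_f)
    then show "inv_into (carrier U) f (inv_into (carrier V) g z) = inv_into (carrier U) (\<lambda>x. g (f x)) z"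
      using v(2) by (intro inv_into_f_eq[OF bij_betw_imp_inj_on[OF bgf], symmetric]) simp_all
  qed
  then show ?thesis
    using f g bgf linear_map_compose[of U V f W g] dsmooth_compose[of "carrier U" C "carrier V" D f "carrier W" E g]
    by (simp add: dvs_iso_def)
qed

text \<open>\<open>F\<close> matches the two subspaces, so \<open>F\<close> and its inverse both
  descend. Each induced map is smooth because it may be tested before the quotient, where it is an
  isomorphism followed by a projection.\<close>

lemma dvs_iso_quot_vsp:
  assumes A: "dvs A E" and V: "dvs V D" and F: "dvs_iso A E V D F"
    and S: "submodule S real_ring A" and S': "submodule S' real_ring V"
    and SS': "\<And>a. a \<in> carrier A \<Longrightarrow> F a \<in> S' \<longleftrightarrow> a \<in> S"
  defines "K \<equiv> coset_lift (\<lambda>a. S' +>\<^bsub>V\<^esub> F a)"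
  shows "dvs_iso (quot_vsp A S) (quot_vsp_diff A E S) (quot_vsp V S') (quot_vsp_diff V D S') K"
    and "a \<in> carrier A \<Longrightarrow> K (S +>\<^bsub>A\<^esub> a) = S' +>\<^bsub>V\<^esub> F a"
proof -
  note vA = dvsD(1)[OF A] and vV = dvsD(1)[OF V]
  interpret A: module real_ring A by (rule vA)
  have lF: "linear_map A V F" and bF: "bij_betw F (carrier A) (carrier V)"
    and sF: "dsmooth (carrier A) E (carrier V) D F"
    and sF': "dsmooth (carrier V) D (carrier A) E (inv_into (carrier A) F)"
    using F by (simp_all add: dvs_iso_def)
  note cA = carrier_quot_vsp[OF vA S] and cV = carrier_quot_vsp[OF vV S']
  have lin: "linear_map A (quot_vsp V S') (\<lambda>a. S' +>\<^bsub>V\<^esub> F a)"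
    by (rule linear_map_compose[OF lF linear_map_coset[OF vV S']])
  have ker: "S' +>\<^bsub>V\<^esub> F s = \<zero>\<^bsub>quot_vsp V S'\<^esub>" if "s \<in> S" for s
    using that submoduleD(1)[OF S] SS' linear_mapD(1)[OF lF] coset_eq_zero_iff[OF vV S'] by blast
  have K: "K (S +>\<^bsub>A\<^esub> a) = S' +>\<^bsub>V\<^esub> F a" if "a \<in> carrier A" for a
    unfolding K_def using coset_lift_coset[OF vA is_vsp_quot_vsp[OF vV S'] S lin ker that] .
  then show "a \<in> carrier A \<Longrightarrow> K (S +>\<^bsub>A\<^esub> a) = S' +>\<^bsub>V\<^esub> F a" .
  have lK: "linear_map (quot_vsp A S) (quot_vsp V S') K"
    unfolding K_def by (rule linear_map_coset_lift[OF vA is_vsp_quot_vsp[OF vV S'] S lin ker])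
  have Fim: "F ` carrier A = carrier V" using bF by (simp add: bij_betw_def)
  have inj: "inj_on K (carrier (quot_vsp A S))"
  proof (rule inj_onI)
    fix x y assume "x \<in> carrier (quot_vsp A S)" "y \<in> carrier (quot_vsp A S)" and eq: "K x = K y"
    then obtain a b where ab: "a \<in> carrier A" "b \<in> carrier A" "x = S +>\<^bsub>A\<^esub> a" "y = S +>\<^bsub>A\<^esub> b"
      by (auto simp: cA)
    have "F a \<ominus>\<^bsub>V\<^esub> F b \<in> S'"
      using eq ab K coset_eq_iff[OF vV S'] linear_mapD(1)[OF lF] by simp
    then have "a \<ominus>\<^bsub>A\<^esub> b \<in> S"
      using SS'[of "a \<ominus>\<^bsub>A\<^esub> b"] linear_map_minus[OF vA vV lF ab(1,2)] ab by simp
    then show "x = y" using ab coset_eq_iff[OF vA S] by simp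
  qed
  moreover have "K ` carrier (quot_vsp A S) = carrier (quot_vsp V S')"
    using K by (auto simp: cA cV Fim[symmetric] image_image)
  ultimately have bK: "bij_betw K (carrier (quot_vsp A S)) (carrier (quot_vsp V S'))"
    by (simp add: bij_betw_def)
  have dA: "diffeology (carrier (quot_vsp A S)) (quot_vsp_diff A E S)"
    unfolding quot_vsp_diff_def by (rule diffeology_quot_diff[OF dvsD(2)[OF A] cA[symmetric]])
  have dV: "diffeology (carrier (quot_vsp V S')) (quot_vsp_diff V D S')"
    unfolding quot_vsp_diff_def by (rule diffeology_quot_diff[OF dvsD(2)[OF V] cV[symmetric]])
  have qA: "dsmooth (carrier A) E (carrier (quot_vsp A S)) (quot_vsp_diff A E S) (\<lambda>a. S +>\<^bsub>A\<^esub> a)"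
    unfolding quot_vsp_diff_def by (rule dsmooth_quot_map[OF dvsD(2)[OF A]]) (simp add: cA)
  have qV: "dsmooth (carrier V) D (carrier (quot_vsp V S')) (quot_vsp_diff V D S') (\<lambda>a. S' +>\<^bsub>V\<^esub> a)"
    unfolding quot_vsp_diff_def by (rule dsmooth_quot_map[OF dvsD(2)[OF V]]) (simp add: cV)
  have sK: "dsmooth (carrier (quot_vsp A S)) (quot_vsp_diff A E S) (carrier (quot_vsp V S')) (quot_vsp_diff V D S') K"
    unfolding quot_vsp_diff_def[of A]
  proof (rule dsmooth_quot_lift[OF dvsD(2)[OF A] dV])
    show "dsmooth (carrier A) E (carrier (quot_vsp V S')) (quot_vsp_diff V D S') (\<lambda>a. K (S +>\<^bsub>A\<^esub> a))"
      by (rule dsmooth_cong[OF dvsD(2)[OF A] _ dsmooth_compose[OF sF qV]]) (simp add: K)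
  qed (use linear_mapD(1)[OF lK] in blast)
  have sK': "dsmooth (carrier (quot_vsp V S')) (quot_vsp_diff V D S') (carrier (quot_vsp A S)) (quot_vsp_diff A E S)
      (inv_into (carrier (quot_vsp A S)) K)"
    unfolding quot_vsp_diff_def[of V]
  proof (rule dsmooth_quot_lift[OF dvsD(2)[OF V] dA])
    show "inv_into (carrier (quot_vsp A S)) K x \<in> carrier (quot_vsp A S)" if "x \<in> carrier (quot_vsp V S')" for x
      using that bK by (simp add: bij_betw_def inv_into_into)
    show "dsmooth (carrier V) D (carrier (quot_vsp A S)) (quot_vsp_diff A E S)
        (\<lambda>v. inv_into (carrier (quot_vsp A S)) K (S' +>\<^bsub>V\<^esub> v))"
    proof (rule dsmooth_cong[OF dvsD(2)[OF V] _ dsmooth_compose[OF sF' qA]])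
      fix v assume "v \<in> carrier V"
      then obtain a where a: "a \<in> carrier A" "v = F a" using Fim by blast
      have "inv_into (carrier A) F v = a" using a bF by (simp add: bij_betw_def)
      moreover have "inv_into (carrier (quot_vsp A S)) K (S' +>\<^bsub>V\<^esub> v) = S +>\<^bsub>A\<^esub> a"
        using a K cA by (intro inv_into_f_eq[OF inj]) auto
      ultimately show "S +>\<^bsub>A\<^esub> inv_into (carrier A) F v = inv_into (carrier (quot_vsp A S)) K (S' +>\<^bsub>V\<^esub> v)"
        by simp
    qed
  qed
  show "dvs_iso (quot_vsp A S) (quot_vsp_diff A E S) (quot_vsp V S') (quot_vsp_diff V D S') K"
    using lK bK sK sK' by (simp add: dvs_iso_def)
qed

text \<open>The linear map from coordinate vectors to \<open>V\<close> that takes the unit vectors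
  to the members of \<open>vs\<close>. Positions in the list serve as labels, so that the lemmas on
  \<open>lcomb\<close> apply directly.\<close>

definition vcomb :: "'a vsp \<Rightarrow> 'a list \<Rightarrow> (nat \<Rightarrow> real) \<Rightarrow> 'a" where
  "vcomb V vs y = lcomb V (map (apfst y) (zip [0..<length vs] vs))"

lemma snd_zip_subset: "set vs \<subseteq> A \<Longrightarrow> snd ` set (zip is vs) \<subseteq> A"
  by (auto dest: set_zip_rightD)

context
  fixes V :: "'a vsp" and vs :: "'a list"
  assumes vsp: "is_vsp V" and vs: "set vs \<subseteq> carrier V"
begin

lemma vcomb_closed: "vcomb V vs y \<in> carrier V"
  unfolding vcomb_def by (rule lcomb_closed[OF vsp]) (use vs in \<open>auto dest: set_zip_rightD\<close>)

lemma vcomb_smult: "vcomb V vs (\<lambda>i. a * y i) = a \<odot>\<^bsub>V\<^esub> vcomb V vs y"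
  unfolding vcomb_def by (rule lcomb_smult[OF vsp snd_zip_subset[OF vs]])

lemma vcomb_zero: "vcomb V vs origin = \<zero>\<^bsub>V\<^esub>"
  unfolding vcomb_def by (rule lcomb_zero[OF vsp snd_zip_subset[OF vs]]) simp

lemma vcomb_plot:
  "(n, Euc n, \<lambda>y\<in>Euc n. vcomb V vs y) \<in> fine_diff V"
proof -
  have "lc_on V n (Euc n) (map (apfst (\<lambda>i y. y i)) (zip [0..<length vs] vs))
      (\<lambda>y\<in>Euc n. vcomb V vs y)"
    using vs by (auto simp: lc_on_def vcomb_def C_infinity_coord o_def apfst_compose dest: set_zip_rightD)
  then show ?thesis
    unfolding fine_diff_def params_iff using vcomb_closed by (auto simp del: topspace_Euc)
qed

end

lemma vcomb_one: "is_vsp V \<Longrightarrow> v \<in> carrier V \<Longrightarrow> vcomb V [v] y = y 0 \<odot>\<^bsub>V\<^esub> v"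
  using lcomb_append[of V "[(y 0, v)]" "[]"] module.axioms(2)[of real_ring V]
  by (simp add: vcomb_def vsp_smult(1) abelian_group_def abelian_monoid.r_zero)

lemma vcomb_two:
  assumes "is_vsp V" "v \<in> carrier V" "w \<in> carrier V"
  shows "vcomb V [v, w] y = y 0 \<odot>\<^bsub>V\<^esub> v \<oplus>\<^bsub>V\<^esub> y 1 \<odot>\<^bsub>V\<^esub> w"
proof -
  interpret module real_ring V by fact
  show ?thesis using assms by (simp add: vcomb_def upt_rec vsp_smult(1))
qed

lemma tan_class_transfer:
  assumes "(n, U, p) \<in> plots_at D x" "(m, V, q) \<in> plots_at D x"
    "v \<in> Euc n" "w \<in> Euc m" "differential n f origin v = w"
    "smooth_map n U V f" "f origin = origin" "\<And>y. y \<in> U \<Longrightarrow> p y = q (f y)" "p \<in> extensional U"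
  shows "tan_class D x (n, U, p) v = tan_class D x (m, V, q) w"
proof -
  have "p = compose U q f" using assms(8,9) by (auto simp: compose_def intro!: extensionalityI[of _ U])
  then show ?thesis using tan_class_eq[OF assms(1,2,3) _ assms(6,7)] assms(4,5) by simp
qed

definition unit_vec :: "nat \<Rightarrow> nat \<Rightarrow> real" where
  "unit_vec k = (\<lambda>i. of_bool (i = k))"

text \<open>Used twice: with identities, for \<open>V\<close> itself, and with the orbit projection
  and the coinvariants. \<open>r\<close> is the expected derivative of \<open>\<pi>\<close> at zero,
  and \<open>c\<close> expresses that \<open>r\<close> factors through \<open>\<pi>\<close>.
  \<open>fibre_zero\<close> forces every lift of a plot centred at the base point to be centred at
  zero.\<close>

locale fine_quotient =
  fixes V :: "'v vsp" and X :: "'x set" and DX :: "'x param set" and \<pi> :: "'v \<Rightarrow> 'x"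
    and W :: "'w vsp" and r :: "'v \<Rightarrow> 'w" and c :: "'x \<Rightarrow> 'w"
  assumes vsp_V: "is_vsp V" and vsp_codomain: "is_vsp W"
    and \<pi>_onto: "\<pi> ` carrier V = X"
    and DX: "DX = quot_diff (fine_diff V) X \<pi>"
    and fibre_zero: "\<And>v. v \<in> carrier V \<Longrightarrow> \<pi> v = \<pi> \<zero>\<^bsub>V\<^esub> \<Longrightarrow> v = \<zero>\<^bsub>V\<^esub>"
    and linear_r: "linear_map V W r" and r_onto: "r ` carrier V = carrier W"
    and c: "\<And>v. v \<in> carrier V \<Longrightarrow> c (\<pi> v) = r v"
begin

lemma diffeology_V: "diffeology (carrier V) (fine_diff V)"
  using dvsD(2)[OF dvs_fine_diff[OF vsp_V]] .

text \<open>Smoothness of \<open>c\<close> is tested after \<open>\<pi>\<close>, where it becomes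
  the linear map \<open>r\<close> between fine spaces; linearity of \<open>c\<close> itself would
  have no meaning.\<close>

sublocale tan_lift X DX W c
proof (rule tan_lift.intro)
  show "diffeology X DX"
    unfolding DX by (rule diffeology_quot_diff[OF diffeology_V \<pi>_onto])
  show "dsmooth X DX (carrier W) (fine_diff W) c"
    unfolding DX
  proof (rule dsmooth_quot_lift[OF diffeology_V dvsD(2)[OF dvs_fine_diff[OF vsp_codomain]]])
    show "c x \<in> carrier W" if "x \<in> X" for x
      using that c linear_mapD(1)[OF linear_r] \<pi>_onto by auto
    show "dsmooth (carrier V) (fine_diff V) (carrier W) (fine_diff W) (\<lambda>x. c (\<pi> x))"
      by (rule dsmooth_cong[OF diffeology_V _
            fine_diff_linear_smooth[OF vsp_V dvs_fine_diff[OF vsp_codomain] linear_r]]) (simp add: c)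
  qed
qed (rule vsp_codomain)

interpretation V: module real_ring V by (rule vsp_V)

abbreviation x0 :: 'x where "x0 \<equiv> \<pi> \<zero>\<^bsub>V\<^esub>"

lemma x0: "x0 \<in> X"
  using \<pi>_onto by blast

lemma smooth_\<pi>: "dsmooth (carrier V) (fine_diff V) X DX \<pi>"
  unfolding DX by (rule dsmooth_quot_map[OF diffeology_V]) (simp add: \<pi>_onto)

definition vec_plot :: "'v list \<Rightarrow> (nat \<Rightarrow> real) \<Rightarrow> 'x" where
  "vec_plot vs = (\<lambda>y\<in>Euc (length vs). \<pi> (vcomb V vs y))"

definition vec_class :: "'v \<Rightarrow> 'x tvec" where
  "vec_class v = tan_class DX x0 (1, Euc 1, vec_plot [v]) (unit_vec 0)"

lemma unit_vec_space: "k < n \<Longrightarrow> unit_vec k \<in> Euc n"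
  by (simp add: unit_vec_def)

lemma vec_plot:
  assumes "set vs \<subseteq> carrier V" "n = length vs"
  shows "(n, Euc n, vec_plot vs) \<in> plots_at DX x0"
proof -
  have "compose (Euc n) \<pi> (\<lambda>y\<in>Euc n. vcomb V vs y) = vec_plot vs"
    by (auto simp: compose_def vec_plot_def assms(2) fun_eq_iff)
  then have "(n, Euc n, vec_plot vs) \<in> DX"
    using dsmoothD(2)[OF smooth_\<pi> vcomb_plot[OF vsp_V assms(1)]] by metis
  then show ?thesis
    using vcomb_zero[OF vsp_V assms(1)] by (simp add: plots_at_iff vec_plot_def)
qed

text \<open>The line \<open>t \<mapsto> t y\<close> carries the one-dimensional plot of the combined
  vector into \<open>vec_plot vs\<close>, and its differential takes the unit vector to
  \<open>y\<close>. Tangent vectors along plots of several variables thus reduce to those along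
  curves.\<close>

lemma tan_class_vec_plot:
  assumes vs: "set vs \<subseteq> carrier V" "m = length vs" and y: "y \<in> Euc m"
  shows "tan_class DX x0 (m, Euc m, vec_plot vs) y = vec_class (vcomb V vs y)"
  unfolding vec_class_def
proof (rule tan_class_transfer[symmetric, where f = "\<lambda>t i. t 0 * y i"])
  have v: "vcomb V vs y \<in> carrier V" by (rule vcomb_closed[OF vsp_V vs(1)])
  show "(1, Euc 1, vec_plot [vcomb V vs y]) \<in> plots_at DX x0"
    by (rule vec_plot) (use v in auto)
  show "(m, Euc m, vec_plot vs) \<in> plots_at DX x0"
    by (rule vec_plot[OF vs])
  show "unit_vec 0 \<in> Euc 1" by (rule unit_vec_space) simp
  show "y \<in> Euc m" by (rule y)
  have "partial 0 (\<lambda>t. t 0 * y j) origin = y j" for j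
    by (rule partial_eqI) (auto intro!: derivative_eq_intros)
  then show "differential 1 (\<lambda>t i. t 0 * y i) origin (unit_vec 0) = y"
    by (auto simp: differential_def unit_vec_def)
  show "smooth_map 1 (Euc 1) (Euc m) (\<lambda>t i. t 0 * y i)"
    unfolding smooth_map_def using y
    by (auto intro!: C_infinity_mult C_infinity_coord C_infinity_const)
  show "(\<lambda>i. origin 0 * y i) = origin" by simp
  show "vec_plot [vcomb V vs y] t = vec_plot vs (\<lambda>i. t 0 * y i)" if "t \<in> Euc 1" for t
    using that y by (simp add: vec_plot_def vs(2)[symmetric] vcomb_one[OF vsp_V v] vcomb_smult[OF vsp_V vs(1)])
  show "vec_plot [vcomb V vs y] \<in> extensional (Euc 1)"
    by (simp add: vec_plot_def)
qed

lemma vec_class_closed: "v \<in> carrier V \<Longrightarrow> vec_class v \<in> carrier (tan_space DX x0)"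
  unfolding vec_class_def by (intro tan_class_closed vec_plot unit_vec_space) auto

text \<open>Classes along different plots are added only formally, in the direct sum. Both curves
  are therefore moved into the plane plot \<open>vec_plot [v, w]\<close>, where the sum becomes an
  addition of vectors along one plot.\<close>

lemma linear_map_vec_class: "linear_map V (tan_space DX x0) vec_class"
  unfolding linear_map_def
proof (intro conjI ballI allI)
  show "vec_class \<in> carrier V \<rightarrow> carrier (tan_space DX x0)" using vec_class_closed by blast
  fix v assume v: "v \<in> carrier V"
  {
    fix w assume w: "w \<in> carrier V"
    have vw: "set [v, w] \<subseteq> carrier V" "2 = length [v, w]" using v w by auto
    have u: "unit_vec 0 \<in> Euc 2" "unit_vec 1 \<in> Euc 2"
      by (rule unit_vec_space, simp)+
    then have s: "(\<lambda>i. unit_vec 0 i + unit_vec 1 i) \<in> Euc 2" by simp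
    have *: "vcomb V [v, w] (unit_vec 0) = v" "vcomb V [v, w] (unit_vec 1) = w"
      "vcomb V [v, w] (\<lambda>i. unit_vec 0 i + unit_vec 1 i) = v \<oplus>\<^bsub>V\<^esub> w"
      using v w by (simp_all add: vcomb_two[OF vsp_V v w] unit_vec_def vsp_smult[OF vsp_V])
    show "vec_class (v \<oplus>\<^bsub>V\<^esub> w) = vec_class v \<oplus>\<^bsub>tan_space DX x0\<^esub> vec_class w"
      using tan_class_add[OF vec_plot[OF vw] u]
      unfolding tan_class_vec_plot[OF vw u(1)] tan_class_vec_plot[OF vw u(2)] tan_class_vec_plot[OF vw s] * .
  }
  fix a
  have vv: "set [v] \<subseteq> carrier V" "1 = length [v]" using v by auto
  have u: "unit_vec 0 \<in> Euc 1" by (rule unit_vec_space) simp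
  then have s: "(\<lambda>i. a * unit_vec 0 i) \<in> Euc 1" by simp
  have *: "vcomb V [v] (unit_vec 0) = v" "vcomb V [v] (\<lambda>i. a * unit_vec 0 i) = a \<odot>\<^bsub>V\<^esub> v"
    using v by (simp_all add: vcomb_one[OF vsp_V v] unit_vec_def vsp_smult[OF vsp_V])
  show "vec_class (a \<odot>\<^bsub>V\<^esub> v) = a \<odot>\<^bsub>tan_space DX x0\<^esub> vec_class v"
    using tan_class_smult[OF vec_plot[OF vv] u, of a]
    unfolding tan_class_vec_plot[OF vv u] tan_class_vec_plot[OF vv s] * .
qed

text \<open>
  Near the origin a plot centred at \<open>x0\<close> is \<open>\<pi>\<close> composed with a combination of finitely many
  vectors, whose coefficients may be normalised to vanish at the origin because the fibre over \<open>x0\<close>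
  is trivial; it therefore factors through a plot \<open>vec_plot vs\<close>.
\<close>

lemma tan_class_vec_class:
  assumes p: "(n, U, p) \<in> plots_at DX x0" and e: "e \<in> Euc n"
  shows "tan_class DX x0 (n, U, p) e \<in> vec_class ` carrier V"
proof -
  have pD: "(n, U, p) \<in> DX" "origin \<in> U" "p origin = x0" using p by (auto simp: plots_at_iff)
  then obtain M f where M: "eopen n M" "origin \<in> M" "M \<subseteq> U" "(n, M, f) \<in> fine_diff V" "\<forall>y\<in>M. p y = \<pi> (f y)"
    unfolding DX quot_diff_iff by blast
  obtain N L where N: "eopen n N" "origin \<in> N" "N \<subseteq> M" "lc_on V n N L f"
    using fine_diffE[OF M(4,2)] .
  have fV: "f y \<in> carrier V" if "y \<in> M" for y using diffeologyD(2)[OF diffeology_V M(4) that] .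
  have f0: "f origin = \<zero>\<^bsub>V\<^esub>" using fibre_zero[OF fV[OF M(2)]] M(2,5) pD(3) by simp
  define m where "m = length L"
  define vs where "vs = map snd L"
  define F where "F y i = (if i < m then fst (L ! i) y + (-1) * fst (L ! i) origin else 0)" for y i
  have vs: "set vs \<subseteq> carrier V" "m = length vs" using lc_on_snd[OF N(4)] by (auto simp: vs_def m_def)
  have Fvs: "vcomb V vs (F y) = f y" if y: "y \<in> N" for y
  proof -
    have "map (apfst (F y)) (zip [0..<length vs] vs) = map (apfst (\<lambda>g. g y + (-1) * g origin)) L"
      by (rule nth_equalityI) (auto simp: vs_def F_def m_def prod_eq_iff)
    \<comment> \<open>The constants subtracted in \<open>F\<close> contribute the combination at the
      origin, which is \<open>f origin\<close> and hence zero. The normalised coefficients present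
      the same \<open>f\<close>.\<close>
    then have "vcomb V vs (F y) = lcomb V (map (apfst (\<lambda>g. g y)) L) \<oplus>\<^bsub>V\<^esub> (-1) \<odot>\<^bsub>V\<^esub> lcomb V (map (apfst (\<lambda>g. g origin)) L)"
      unfolding vcomb_def
      using lcomb_add[OF vsp_V lc_on_snd[OF N(4)], of "\<lambda>g. g y" "\<lambda>g. (-1) * g origin"]
        lcomb_smult[OF vsp_V lc_on_snd[OF N(4)], of "-1" "\<lambda>g. g origin"] by simp
    also have "\<dots> = f y"
      unfolding lc_on_eq[OF N(4) y, symmetric] lc_on_eq[OF N(4,2), symmetric] f0
      using fV y N(3) by (auto simp: vsp_smult[OF vsp_V])
    finally show ?thesis .
  qed
  have CF: "C_infinity n N (\<lambda>y. F y i)" for i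
  proof (cases "i < m")
    case True
    then have "C_infinity n N (fst (L ! i))"
      using lc_on_coeff[OF N(4), of "fst (L ! i)" "snd (L ! i)"] by (simp add: m_def)
    then show ?thesis
      using True C_infinity_add[OF N(1) _ C_infinity_const[of n N "- fst (L ! i) origin"]] by (simp add: F_def)
  qed (simp add: F_def C_infinity_const)
  have F: "smooth_map n N (Euc m) F"
    unfolding smooth_map_def using CF by (auto simp: F_def)
  have dF: "differential n F origin e \<in> Euc m"
    by (auto simp: differential_def F_def partial_def)
  have pN: "(n, N, restrict p N) \<in> plots_at DX x0"
    using plot_restrict[OF diffeology_X pD(1) N(1)] M(3) N(2,3) pD(3) by (auto simp: plots_at_iff)
  \<comment> \<open>Shrinking the domain keeps the class: the inclusion is a translation by
    \<open>origin\<close>, so its differential is the identity.\<close>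
  have "tan_class DX x0 (n, N, restrict p N) e = tan_class DX x0 (n, U, p) e"
  proof (rule tan_class_transfer[OF pN p e e])
    show "differential n (\<lambda>y. y) origin e = e" using differential_translate[OF e, of origin] by simp
    show "smooth_map n N U (\<lambda>y. y)" by (rule smooth_map_id) (use M(3) N(3) in blast)
  qed auto
  moreover have "tan_class DX x0 (n, N, restrict p N) e =
      tan_class DX x0 (m, Euc m, vec_plot vs) (differential n F origin e)"
  proof (rule tan_class_transfer[OF pN vec_plot[OF vs] e dF refl F])
    show "F origin = origin" by (auto simp: F_def)
    show "restrict p N y = vec_plot vs (F y)" if "y \<in> N" for y
      using that M(5) N(3) Fvs[OF that] vs(2) by (auto simp: vec_plot_def F_def)
  qed simp
  ultimately have "tan_class DX x0 (n, U, p) e = vec_class (vcomb V vs (differential n F origin e))"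
    using tan_class_vec_plot[OF vs dF] by simp
  then show ?thesis using vcomb_closed[OF vsp_V vs(1)] by blast
qed

lemma vec_class_onto: "vec_class ` carrier V = carrier (tan_space DX x0)"
proof (intro equalityI subsetI)
  fix \<xi> assume "\<xi> \<in> carrier (tan_space DX x0)"
  then show "\<xi> \<in> vec_class ` carrier V"
  proof (induction rule: tan_space_induct)
    case zero
    then show ?case
      using linear_map_zero[OF vsp_V is_vsp_tan_space linear_map_vec_class] by (metis V.zero_closed imageI)
  next
    case (add n U p v \<xi>)
    then obtain a b where "a \<in> carrier V" "tan_class DX x0 (n, U, p) v = vec_class a"
      "b \<in> carrier V" "\<xi> = vec_class b"
      using tan_class_vec_class[OF add(1,2)] by blast
    then show ?case using linear_mapD(2)[OF linear_map_vec_class, symmetric] by auto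
  qed
qed (use vec_class_closed in blast)

text \<open>Along the curve \<open>t \<mapsto> \<pi> (t v)\<close> the map \<open>c\<close> takes
  the values \<open>t \<odot> r v\<close>, a combination with a single term whose coefficient has
  derivative 1.\<close>

lemma tlift_vec_class:
  assumes v: "v \<in> carrier V"
  shows "tlift (vec_class v) = r v"
proof -
  define E where "E = Euc 1"
  have u: "unit_vec 0 \<in> E" unfolding E_def by (rule unit_vec_space) simp
  have P: "(1, E, vec_plot [v]) \<in> plots_at DX x0" unfolding E_def by (rule vec_plot) (use v in auto)
  have rv: "r v \<in> carrier W" using linear_mapD(1)[OF linear_r v] .
  interpret W: module real_ring W by (rule vsp_W)
  have cE: "compose E c (vec_plot [v]) y = y 0 \<odot>\<^bsub>W\<^esub> r v" if "y \<in> E" for y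
    using that v by (simp add: E_def compose_def vec_plot_def vcomb_one[OF vsp_V v] c
        vsp_smult(1)[OF vsp_V] linear_mapD(3)[OF linear_r v])
  have "lc_on W 1 E [(\<lambda>y. y 0, r v)] (compose E c (vec_plot [v]))"
    using rv cE by (simp add: lc_on_def C_infinity_coord vsp_smult(1)[OF vsp_W])
  then have "fine_deriv W 1 (compose E c (vec_plot [v])) origin (unit_vec 0) =
      lcomb W (map (apfst (\<lambda>f. dirderiv 1 f origin (unit_vec 0))) [(\<lambda>y. y 0, r v)])"
    by (intro fine_deriv_eq[OF vsp_W]) (use u in \<open>auto simp: E_def\<close>)
  moreover have "partial 0 (\<lambda>y. y 0) origin = 1"
    by (rule partial_eqI) auto
  ultimately show ?thesis
    unfolding vec_class_def using tlift_class[OF P u[unfolded E_def]] rv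
    by (simp add: E_def dirderiv_def unit_vec_def vsp_smult[OF vsp_W])
qed

text \<open>Since \<open>vec_class\<close> is onto and \<open>tlift\<close> after
  \<open>vec_class\<close> is \<open>r\<close>, injectivity of \<open>tlift\<close> amounts to
  \<open>vec_class\<close> vanishing on the kernel of \<open>r\<close>. This hypothesis is left to
  each instance: it is immediate when \<open>r\<close> is the identity and uses the action in the
  case of orbits.\<close>

lemma dvs_iso_tlift:
  assumes ker: "\<And>v. v \<in> carrier V \<Longrightarrow> r v = \<zero>\<^bsub>W\<^esub> \<Longrightarrow> vec_class v = \<zero>\<^bsub>tan_space DX x0\<^esub>"
  shows "dvs_iso (tan_space DX x0) (tan_diff X DX x0) W (fine_diff W) tlift"
    and "v \<in> carrier V \<Longrightarrow> inv_into (carrier (tan_space DX x0)) tlift (r v) = vec_class v"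
proof -
  let ?T = "carrier (tan_space DX x0)"
  interpret W: module real_ring W by (rule vsp_W)
  interpret T: module real_ring "tan_space DX x0" by (rule is_vsp_tan_space)
  have inj: "inj_on tlift ?T"
  proof (rule inj_onI)
    fix \<xi> \<eta> assume "\<xi> \<in> ?T" "\<eta> \<in> ?T" and eq: "tlift \<xi> = tlift \<eta>"
    moreover obtain a where a: "a \<in> carrier V" "\<xi> = vec_class a"
      using \<open>\<xi> \<in> ?T\<close> unfolding vec_class_onto[symmetric] by (rule imageE)
    moreover obtain b where b: "b \<in> carrier V" "\<eta> = vec_class b"
      using \<open>\<eta> \<in> ?T\<close> unfolding vec_class_onto[symmetric] by (rule imageE)
    ultimately have ab: "a \<in> carrier V" "b \<in> carrier V" "\<xi> = vec_class a" "\<eta> = vec_class b"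
      by simp_all
    have "r a = r b" using eq ab by (simp add: tlift_vec_class)
    then have "r (a \<ominus>\<^bsub>V\<^esub> b) = \<zero>\<^bsub>W\<^esub>"
      unfolding linear_map_minus[OF vsp_V vsp_W linear_r ab(1,2)]
      using linear_mapD(1)[OF linear_r ab(2)] by (simp add: a_minus_def W.r_neg)
    then have "\<xi> \<ominus>\<^bsub>tan_space DX x0\<^esub> \<eta> = \<zero>\<^bsub>tan_space DX x0\<^esub>"
      using ker[of "a \<ominus>\<^bsub>V\<^esub> b"] ab linear_map_minus[OF vsp_V is_vsp_tan_space linear_map_vec_class] by simp
    then show "\<xi> = \<eta>"
      using T.minus_equality[of \<xi> "\<ominus>\<^bsub>tan_space DX x0\<^esub> \<eta>"] \<open>\<xi> \<in> ?T\<close> \<open>\<eta> \<in> ?T\<close> by (simp add: a_minus_def)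
  qed
  have "tlift ` ?T = carrier W"
    unfolding vec_class_onto[symmetric] r_onto[symmetric] image_image using tlift_vec_class by auto
  then have bij: "bij_betw tlift ?T (carrier W)" using inj by (simp add: bij_betw_def)
  have inv: "inv_into ?T tlift (r v) = vec_class v" if "v \<in> carrier V" for v
    using that vec_class_closed tlift_vec_class by (intro inv_into_f_eq[OF inj]) auto
  then show "v \<in> carrier V \<Longrightarrow> inv_into ?T tlift (r v) = vec_class v" .
  \<comment> \<open>The fine diffeology of \<open>W\<close> is the quotient diffeology along
    \<open>r\<close>, so the inverse may be tested on \<open>V\<close>, where it is the linear and
    hence smooth map \<open>vec_class\<close>.\<close>
  have "dsmooth (carrier W) (quot_diff (fine_diff V) (carrier W) r) ?T (tan_diff X DX x0) (inv_into ?T tlift)"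
  proof (rule dsmooth_quot_lift[OF diffeology_V dvsD(2)[OF dvs_tan_space[OF x0]]])
    show "inv_into ?T tlift w \<in> ?T" if "w \<in> carrier W" for w
      using that bij by (simp add: bij_betw_def inv_into_into)
    show "dsmooth (carrier V) (fine_diff V) ?T (tan_diff X DX x0) (\<lambda>v. inv_into ?T tlift (r v))"
      by (rule dsmooth_cong[OF diffeology_V _
            fine_diff_linear_smooth[OF vsp_V dvs_tan_space[OF x0] linear_map_vec_class]]) (simp add: inv)
  qed
  then show "dvs_iso (tan_space DX x0) (tan_diff X DX x0) W (fine_diff W) tlift"
    unfolding fine_diff_quot[OF vsp_V vsp_W linear_r r_onto] dvs_iso_def
    using linear_map_tlift bij tlift_smooth[OF x0] by blast
qed

end

theorem corollary3p35:
  fixes V :: "(real, 'v) module" and D :: "'v param set"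
    and G :: "('g, 'm) monoid_scheme" and \<phi> :: "'g \<Rightarrow> 'v \<Rightarrow> 'v"
  assumes fine: "fine_dvs V D"
    and group: "group G"
    and action: "linear_action G V \<phi>"
  defines "Q \<equiv> orbits G (carrier V) \<phi>"
    and "\<pi> \<equiv> orbit G \<phi>"
    and "DQ \<equiv> orbit_diff G (carrier V) D \<phi>"
    and "\<rho> \<equiv> (\<lambda>g. tan_map D D (\<phi> g) \<zero>\<^bsub>V\<^esub>)"
  shows "(\<forall>g\<in>carrier G. dsmooth (carrier V) D (carrier V) D (\<phi> g) \<and> \<phi> g \<zero>\<^bsub>V\<^esub> = \<zero>\<^bsub>V\<^esub>) \<and>
    (\<exists>h. (\<forall>\<xi>\<in>carrier (tan_space D \<zero>\<^bsub>V\<^esub>).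
            h (coinv_sub G (tan_space D \<zero>\<^bsub>V\<^esub>) \<rho> +>\<^bsub>tan_space D \<zero>\<^bsub>V\<^esub>\<^esub> \<xi>) =
              tan_map D DQ \<pi> \<zero>\<^bsub>V\<^esub> \<xi>) \<and>
         dvs_iso
           (coinv G (tan_space D \<zero>\<^bsub>V\<^esub>) \<rho>)
           (coinv_diff G (tan_space D \<zero>\<^bsub>V\<^esub>) (tan_diff (carrier V) D \<zero>\<^bsub>V\<^esub>) \<rho>)
           (tan_space DQ (\<pi> \<zero>\<^bsub>V\<^esub>))
           (tan_diff Q DQ (\<pi> \<zero>\<^bsub>V\<^esub>)) h) \<and>
    (\<exists>k. dvs_iso
           (tan_space DQ (\<pi> \<zero>\<^bsub>V\<^esub>))
           (tan_diff Q DQ (\<pi> \<zero>\<^bsub>V\<^esub>))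
           (coinv G V \<phi>)
           (coinv_diff G V D \<phi>) k)"
proof -
  have V: "is_vsp V" and D: "D = fine_diff V" using fine by (simp_all add: fine_dvs_iff)
  have dvsV: "dvs V D" using dvs_fine_diff[OF V] D by simp
  interpret V: module real_ring V by (rule V)
  interpret G: group G by (rule group)
  have ga: "group_action G (carrier V) \<phi>" and lin: "\<And>g. g \<in> carrier G \<Longrightarrow> linear_map V V (\<phi> g)"
    using action by (simp_all add: linear_action_def)
  interpret \<phi>: group_action G "carrier V" \<phi> by (rule ga)
  have \<phi>V: "\<phi> g v \<in> carrier V" if "g \<in> carrier G" "v \<in> carrier V" for g v
    using linear_mapD(1)[OF lin[OF that(1)] that(2)] .
  have \<phi>0: "\<phi> g \<zero>\<^bsub>V\<^esub> = \<zero>\<^bsub>V\<^esub>" if "g \<in> carrier G" for g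
    using linear_map_zero[OF V V lin[OF that]] .
  have smooth\<phi>: "dsmooth (carrier V) D (carrier V) D (\<phi> g)" if "g \<in> carrier G" for g
    unfolding D by (rule fine_diff_linear_smooth[OF V dvs_fine_diff[OF V] lin[OF that]])
  define S where "S = coinv_sub G V \<phi>"
  have Sgen: "{w \<ominus>\<^bsub>V\<^esub> \<phi> h w | w h. w \<in> carrier V \<and> h \<in> carrier G} \<subseteq> carrier V"
    using \<phi>V by auto
  have S: "submodule S real_ring V"
    unfolding S_def coinv_sub_def by (rule submodule_vspan[OF V Sgen])
  have SI: "w \<ominus>\<^bsub>V\<^esub> \<phi> h w \<in> S" if "w \<in> carrier V" "h \<in> carrier G" for w h
    unfolding S_def coinv_sub_def by (rule subsetD[OF vspan_superset]) (use that in blast)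
  define W where "W = coinv G V \<phi>"
  have W_eq: "W = quot_vsp V S" by (simp add: W_def coinv_def S_def)
  have W: "is_vsp W" unfolding W_eq by (rule is_vsp_quot_vsp[OF V S])
  have r: "linear_map V W (\<lambda>v. S +>\<^bsub>V\<^esub> v)" unfolding W_eq by (rule linear_map_coset[OF V S])
  have r_onto: "(\<lambda>v. S +>\<^bsub>V\<^esub> v) ` carrier V = carrier W"
    by (simp add: W_eq carrier_quot_vsp[OF V S])
  \<comment> \<open>The coinvariants carry a quotient diffeology by definition. Recognising it as
    fine makes them a possible target for differentiation.\<close>
  have DW: "coinv_diff G V D \<phi> = fine_diff W"
    unfolding coinv_diff_def quot_vsp_diff_def S_def[symmetric] W_eq[symmetric] D
    by (rule fine_diff_quot[OF V W r r_onto])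
  have orbit_self: "v \<in> \<pi> v" if "v \<in> carrier V" for v
    unfolding \<pi>_def by (rule \<phi>.orbit_refl[OF that])
  have orbit_\<phi>: "\<pi> (\<phi> h v) = \<pi> v" if h: "h \<in> carrier G" and v: "v \<in> carrier V" for h v
  proof (intro equalityI subsetI)
    fix x assume "x \<in> \<pi> (\<phi> h v)"
    then obtain g where g: "g \<in> carrier G" "x = \<phi> g (\<phi> h v)" by (auto simp: \<pi>_def orbit_def)
    then show "x \<in> \<pi> v"
      unfolding \<pi>_def orbit_def using \<phi>.composition_rule[OF v g(1) h] h
      by (intro CollectI exI[of _ "g \<otimes>\<^bsub>G\<^esub> h"]) simp
  next
    fix x assume "x \<in> \<pi> v"
    then obtain g where g: "g \<in> carrier G" "x = \<phi> g v" by (auto simp: \<pi>_def orbit_def)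
    have "\<phi> (g \<otimes>\<^bsub>G\<^esub> inv\<^bsub>G\<^esub> h) (\<phi> h v) = \<phi> (g \<otimes>\<^bsub>G\<^esub> inv\<^bsub>G\<^esub> h \<otimes>\<^bsub>G\<^esub> h) v"
      using \<phi>.composition_rule[OF v, of "g \<otimes>\<^bsub>G\<^esub> inv\<^bsub>G\<^esub> h" h] g h by simp
    also have "\<dots> = x" using g h by (simp add: G.m_assoc)
    finally show "x \<in> \<pi> (\<phi> h v)"
      using g h unfolding \<pi>_def orbit_def
      by (intro CollectI exI[of _ "g \<otimes>\<^bsub>G\<^esub> inv\<^bsub>G\<^esub> h"]) simp
  qed
  \<comment> \<open>An orbit lies in a single coset of \<open>S\<close> because
    \<open>v \<ominus> \<phi> g v\<close> belongs to \<open>S\<close>. Hence the class of an orbit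
    in the coinvariants can be taken at any of its points.\<close>
  have orbit_coset: "the_elem ((\<lambda>v. S +>\<^bsub>V\<^esub> v) ` \<pi> v) = S +>\<^bsub>V\<^esub> v" if v: "v \<in> carrier V" for v
  proof -
    have "S +>\<^bsub>V\<^esub> \<phi> g v = S +>\<^bsub>V\<^esub> v" if "g \<in> carrier G" for g
      using coset_eq_iff[OF V S v \<phi>V[OF that v]] SI[OF v that] by simp
    then have "(\<lambda>v. S +>\<^bsub>V\<^esub> v) ` \<pi> v = {S +>\<^bsub>V\<^esub> v}"
      using orbit_self[OF v] by (auto simp: \<pi>_def orbit_def)
    then show ?thesis by simp
  qed
  have fibre0: "v = \<zero>\<^bsub>V\<^esub>" if "v \<in> carrier V" "\<pi> v = \<pi> \<zero>\<^bsub>V\<^esub>" for v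
    using orbit_self[OF that(1)] that(2) \<phi>0 by (auto simp: \<pi>_def orbit_def)

  interpret A: fine_quotient V "carrier V" D "\<lambda>v. v" V "\<lambda>v. v" "\<lambda>v. v"
  proof (rule fine_quotient.intro)
    have "linear_map V V (\<lambda>v. v)" by (simp add: linear_map_def)
    then show "linear_map V V (\<lambda>v. v)" "D = quot_diff (fine_diff V) (carrier V) (\<lambda>v. v)"
      using fine_diff_quot[OF V V] D by simp_all
  qed (use V in auto)
  interpret B: fine_quotient V Q DQ \<pi> W "\<lambda>v. S +>\<^bsub>V\<^esub> v" "\<lambda>x. the_elem ((\<lambda>v. S +>\<^bsub>V\<^esub> v) ` x)"
  proof (rule fine_quotient.intro)
    show "\<pi> ` carrier V = Q" by (auto simp: Q_def orbits_def \<pi>_def)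
    show "DQ = quot_diff (fine_diff V) Q \<pi>" by (simp add: DQ_def orbit_diff_def D Q_def \<pi>_def)
  qed (use V W r r_onto orbit_coset fibre0 in auto)

  define TV where "TV = tan_space D \<zero>\<^bsub>V\<^esub>"
  define TX where "TX = tan_space DQ (\<pi> \<zero>\<^bsub>V\<^esub>)"
  have dvsTV: "dvs TV (tan_diff (carrier V) D \<zero>\<^bsub>V\<^esub>)" unfolding TV_def by (rule A.dvs_tan_space) simp
  have dvsTX: "dvs TX (tan_diff Q DQ (\<pi> \<zero>\<^bsub>V\<^esub>))" unfolding TX_def by (rule B.dvs_tan_space[OF B.x0])
  have vTV: "is_vsp TV" using dvsD(1)[OF dvsTV] .
  interpret TV: module real_ring TV by (rule vTV)
  interpret TX: module real_ring TX by (rule dvsD(1)[OF dvsTX])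
  have lA: "linear_map V TV A.vec_class" unfolding TV_def by (rule A.linear_map_vec_class)
  have lB: "linear_map V TX B.vec_class" unfolding TX_def by (rule B.linear_map_vec_class)
  have ontoA: "\<exists>v\<in>carrier V. \<xi> = A.vec_class v" if "\<xi> \<in> carrier TV" for \<xi>
    using A.vec_class_onto that unfolding TV_def by blast

  \<comment> \<open>By linearity \<open>\<phi> h\<close> carries \<open>t w\<close> to
    \<open>t (\<phi> h w)\<close>, so the curves of \<open>w\<close> and \<open>\<phi> h w\<close>
    have the same image in the orbit space. They are equal as plots, and therefore have equal
    classes; the generators of \<open>S\<close> go to zero.\<close>
  have "B.vec_class v = \<zero>\<^bsub>TX\<^esub>" if v: "v \<in> S" for v
  proof -
    have "B.vec_class (\<phi> h w) = B.vec_class w" if "w \<in> carrier V" "h \<in> carrier G" for w h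
    proof -
      have "\<pi> (a \<odot>\<^bsub>V\<^esub> \<phi> h w) = \<pi> (a \<odot>\<^bsub>V\<^esub> w)" for a
        using linear_mapD(3)[OF lin[OF that(2)] that(1), of a]
          orbit_\<phi>[OF that(2) vsp_smult(1)[OF V that(1)], of a] by simp
      then have "B.vec_plot [\<phi> h w] = B.vec_plot [w]"
        by (simp add: B.vec_plot_def vcomb_one[OF V] that \<phi>V)
      then show ?thesis by (simp add: B.vec_class_def)
    qed
    then have "B.vec_class (w \<ominus>\<^bsub>V\<^esub> \<phi> h w) = \<zero>\<^bsub>TX\<^esub>" if "w \<in> carrier V" "h \<in> carrier G" for w h
      unfolding linear_map_minus[OF V dvsD(1)[OF dvsTX] lB that(1) \<phi>V[OF that(2,1)]]
      using linear_mapD(1)[OF lB] that by (simp add: a_minus_def TX.r_neg)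
    then have "B.vec_class x \<in> {\<zero>\<^bsub>TX\<^esub>}" if "x \<in> {w \<ominus>\<^bsub>V\<^esub> \<phi> h w | w h. w \<in> carrier V \<and> h \<in> carrier G}" for x
      using that by blast
    then have "B.vec_class v \<in> {\<zero>\<^bsub>TX\<^esub>}"
      using linear_map_vspan[OF V dvsD(1)[OF dvsTX] lB submodule_zero[OF dvsD(1)[OF dvsTX]] Sgen] v
      unfolding S_def coinv_sub_def by blast
    then show ?thesis by simp
  qed
  then have ker: "B.vec_class v = \<zero>\<^bsub>TX\<^esub>" if "v \<in> carrier V" "S +>\<^bsub>V\<^esub> v = \<zero>\<^bsub>W\<^esub>" for v
    using that coset_eq_zero_iff[OF V S] by (simp add: W_eq)
  have isoB: "dvs_iso TX (tan_diff Q DQ (\<pi> \<zero>\<^bsub>V\<^esub>)) W (fine_diff W) B.tlift"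
    and invB: "\<And>v. v \<in> carrier V \<Longrightarrow> inv_into (carrier TX) B.tlift (S +>\<^bsub>V\<^esub> v) = B.vec_class v"
    unfolding TX_def by (rule B.dvs_iso_tlift; use ker in \<open>simp add: TX_def\<close>)+
  have isoA: "dvs_iso TV (tan_diff (carrier V) D \<zero>\<^bsub>V\<^esub>) V D A.tlift"
    unfolding TV_def D
    by (rule A.dvs_iso_tlift(1)[unfolded D])
      (use linear_map_zero[OF V vTV lA] in \<open>simp add: TV_def D\<close>)

  have plotA: "(1, Euc 1, A.vec_plot [v]) \<in> plots_at D \<zero>\<^bsub>V\<^esub>"
    and unit: "unit_vec 0 \<in> Euc 1" if "v \<in> carrier V" for v
    using A.vec_plot[of "[v]" 1] A.unit_vec_space[of 0 1] that by simp_all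
  \<comment> \<open>Equivariance of \<open>A.vec_class\<close>, again because a linear map carries
    the curve through \<open>v\<close> to the curve through its image.\<close>
  have \<rho>A: "\<rho> g (A.vec_class v) = A.vec_class (\<phi> g v)" if g: "g \<in> carrier G" and v: "v \<in> carrier V" for g v
  proof -
    have "compose (Euc 1) (\<phi> g) (A.vec_plot [v]) = A.vec_plot [\<phi> g v]"
      using linear_mapD(3)[OF lin[OF g] v] vcomb_one[OF V v] vcomb_one[OF V \<phi>V[OF g v]]
      by (auto simp: compose_def A.vec_plot_def fun_eq_iff)
    then show ?thesis
      unfolding \<rho>_def A.vec_class_def tan_map_class[OF smooth\<phi>[OF g] plotA[OF v] unit[OF v]] \<phi>0[OF g] by simp
  qed
  \<comment> \<open>This determines \<open>T(\<pi>)\<close> entirely, since every tangent vector of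
    \<open>V\<close> at zero has the form \<open>A.vec_class v\<close>.\<close>
  have \<pi>A: "tan_map D DQ \<pi> \<zero>\<^bsub>V\<^esub> (A.vec_class v) = B.vec_class v" if v: "v \<in> carrier V" for v
  proof -
    have "compose (Euc 1) \<pi> (A.vec_plot [v]) = B.vec_plot [v]"
      by (auto simp: compose_def A.vec_plot_def B.vec_plot_def fun_eq_iff)
    then show ?thesis
      unfolding A.vec_class_def B.vec_class_def
        tan_map_class[OF B.smooth_\<pi>[folded D] plotA[OF v] unit[OF v]] by simp
  qed

  define SA where "SA = coinv_sub G TV \<rho>"
  have \<rho>TV: "\<rho> g \<xi> \<in> carrier TV" if "g \<in> carrier G" "\<xi> \<in> carrier TV" for g \<xi>
    using ontoA[OF that(2)] \<rho>A[OF that(1)] linear_mapD(1)[OF lA \<phi>V[OF that(1)]] by auto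
  have SAgen: "{w \<ominus>\<^bsub>TV\<^esub> \<rho> h w | w h. w \<in> carrier TV \<and> h \<in> carrier G} \<subseteq> carrier TV"
    using \<rho>TV by auto
  have SA: "submodule SA real_ring TV"
    unfolding SA_def coinv_sub_def by (rule submodule_vspan[OF vTV SAgen])
  \<comment> \<open>By equivariance, \<open>A.vec_class\<close> takes generators of \<open>S\<close>
    to generators of \<open>SA\<close>, and \<open>A.tlift\<close> takes generators of
    \<open>SA\<close> back to generators of \<open>S\<close>. Spans follow in both
    directions.\<close>
  have SA_iff: "A.tlift \<xi> \<in> S \<longleftrightarrow> \<xi> \<in> SA" if \<xi>: "\<xi> \<in> carrier TV" for \<xi>
  proof
    obtain v where v: "v \<in> carrier V" "\<xi> = A.vec_class v" using ontoA[OF \<xi>] by blast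
    assume "A.tlift \<xi> \<in> S"
    then have "v \<in> S" by (simp add: v A.tlift_vec_class)
    moreover have "A.vec_class x \<in> SA" if x: "x \<in> {w \<ominus>\<^bsub>V\<^esub> \<phi> h w | w h. w \<in> carrier V \<and> h \<in> carrier G}" for x
    proof -
      obtain w h where w: "x = w \<ominus>\<^bsub>V\<^esub> \<phi> h w" "w \<in> carrier V" "h \<in> carrier G" using x by blast
      have "A.vec_class x = A.vec_class w \<ominus>\<^bsub>TV\<^esub> \<rho> h (A.vec_class w)"
        unfolding w(1) using w \<phi>V by (simp add: linear_map_minus[OF V vTV lA] \<rho>A)
      then show ?thesis
        unfolding SA_def coinv_sub_def using linear_mapD(1)[OF lA w(2)] w(3)
        by (intro subsetD[OF vspan_superset]) blast
    qed
    ultimately show "\<xi> \<in> SA"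
      using linear_map_vspan[OF V vTV lA SA Sgen] v unfolding S_def coinv_sub_def by blast
  next
    have lT: "linear_map TV V A.tlift" unfolding TV_def by (rule A.linear_map_tlift)
    have "A.tlift x \<in> S" if x: "x \<in> {w \<ominus>\<^bsub>TV\<^esub> \<rho> h w | w h. w \<in> carrier TV \<and> h \<in> carrier G}" for x
    proof -
      obtain w h where w: "x = w \<ominus>\<^bsub>TV\<^esub> \<rho> h w" "w \<in> carrier TV" "h \<in> carrier G" using x by blast
      obtain v where v: "v \<in> carrier V" "w = A.vec_class v" using ontoA[OF w(2)] by blast
      show ?thesis
        unfolding w(1) linear_map_minus[OF vTV V lT w(2) \<rho>TV[OF w(3,2)]]
        using SI[OF v(1) w(3)] v w(3) \<phi>V by (simp add: \<rho>A A.tlift_vec_class)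
    qed
    moreover assume "\<xi> \<in> SA"
    ultimately show "A.tlift \<xi> \<in> S"
      using linear_map_vspan[OF vTV V lT S SAgen] unfolding SA_def coinv_sub_def by blast
  qed
  define K where "K = coset_lift (\<lambda>a. S +>\<^bsub>V\<^esub> A.tlift a)"
  note K = dvs_iso_quot_vsp[OF dvsTV dvsV isoA SA S SA_iff, folded K_def]
  have isoK: "dvs_iso (coinv G TV \<rho>) (coinv_diff G TV (tan_diff (carrier V) D \<zero>\<^bsub>V\<^esub>) \<rho>) W (fine_diff W) K"
  proof -
    have "quot_vsp_diff V D S = fine_diff W" using DW by (simp add: coinv_diff_def S_def)
    then show ?thesis
      using K(1) unfolding coinv_diff_def coinv_def[of G TV] SA_def[symmetric] W_eq by simp
  qed
  \<comment> \<open>\<open>h\<close> passes from the coinvariants of the tangent space to those of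
    \<open>V\<close>, and from there to the tangent space of the orbit space. It is induced by
    \<open>T(\<pi>)\<close> because both send the class of \<open>A.vec_class v\<close> to
    \<open>B.vec_class v\<close>.\<close>
  define h where "h = (\<lambda>x. inv_into (carrier TX) B.tlift (K x))"
  have "dvs_iso (coinv G TV \<rho>) (coinv_diff G TV (tan_diff (carrier V) D \<zero>\<^bsub>V\<^esub>) \<rho>)
      TX (tan_diff Q DQ (\<pi> \<zero>\<^bsub>V\<^esub>)) h"
    unfolding h_def by (rule dvs_iso_compose[OF dvsTX isoK dvs_iso_inv[OF dvsTX isoB]])
  moreover have "h (SA +>\<^bsub>TV\<^esub> \<xi>) = tan_map D DQ \<pi> \<zero>\<^bsub>V\<^esub> \<xi>" if \<xi>: "\<xi> \<in> carrier TV" for \<xi>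
  proof -
    obtain v where v: "v \<in> carrier V" "\<xi> = A.vec_class v" using ontoA[OF \<xi>] by blast
    show ?thesis
      using K(2) \<xi> by (simp add: h_def v A.tlift_vec_class invB \<pi>A)
  qed
  ultimately show ?thesis
    using smooth\<phi> \<phi>0 isoB unfolding TV_def[symmetric] TX_def[symmetric] SA_def[symmetric] DW W_def by blast
qed

end
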